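(* The simplicial model of homotopy type theory satisfies $\mathrm{AC}_{\infty}$. More precisely: for every $0$-truncated Kan fibration $p : X \to \Gamma$ of simplicial sets and every $(-1)$-connected Kan fibration $e : Y \to X$, the $(-1)$-truncation of the fibration $\Pi_p e$ in the slice over $\Gamma$ has a section.
   Context: The metatheory is classical (with the axiom of choice). In the simplicial model (Kapulkin--Lumsdaine), a type in context $\Gamma$ is a Kan fibration over $\Gamma$, a term is a section of it, and $\Pi_p$ denotes the right adjoint to pullback along the Kan fibration $p$ (so $\Pi_p e$ is a Kan fibration over $\Gamma$ whose sections correspond to sections of $e$). $\mathrm{AC}_\infty$ is the statement that for every $0$-type $X$ in some context $\Gamma$, every family of merely inhabited types over $X$ merely has a section. Truncatedness and connectedness of fibrations mean the interpretation in the model of the type-theoretic definitions. Explicitly, for a Kan fibration $f:X\to\Gamma$, let $P_\Gamma X\to X\times_\Gamma X$ be a path fibration (a factorization of the diagonal $X\to X\times_\Gamma X$ as a trivial cofibration followed by a fibration). Then $f$ is $(-1)$-truncated if $P_\Gamma X\to X\times_\Gamma X$ has a section, and $f$ is $0$-truncated if $P_\Gamma X\to X\times_\Gamma X$ is $(-1)$-truncated. The $(-1)$-truncation of $f$ in the slice over $\Gamma$ is the interpretation of propositional truncation: a $(-1)$-truncated fibration $\|f\|_{-1}:\|X\|_{-1}\to\Gamma$ with a map $X\to\|X\|_{-1}$ over $\Gamma$ such that, also after pullback along any map $\Delta\to\Gamma$, every map over the base from $X$ to a $(-1)$-truncated fibration factors through $\|X\|_{-1}$. The fibration $f$ is $(-1)$-connected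 if $\|f\|_{-1}$ has a section. *)

theory Defs
  imports Main "HOL-Library.FuncSet"
begin

section \<open>Simplicial sets\<close>

text \<open>Morphisms \<open>[m] \<rightarrow> [n]\<close> of the simplex category; \<open>[n]\<close> is \<open>{..n}\<close>.\<close>

definition simp_op :: "nat \<Rightarrow> nat \<Rightarrow> (nat \<Rightarrow> nat) set" where
  "simp_op m n = {\<alpha> \<in> {..m} \<rightarrow>\<^sub>E {..n}. mono_on {..m} \<alpha>}"

text \<open>\<open>act X m n \<alpha>\<close> is the operation \<open>X\<^sub>n \<rightarrow> X\<^sub>m\<close> induced by \<open>\<alpha> : [m] \<rightarrow> [n]\<close>. The sets of cells
  in different dimensions need not be disjoint.\<close>

record 'a sset =
  cells :: "nat \<Rightarrow> 'a set"
  act :: "nat \<Rightarrow> nat \<Rightarrow> (nat \<Rightarrow> nat) \<Rightarrow> 'a \<Rightarrow> 'a"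

definition simplicial_set :: "'a sset \<Rightarrow> bool" where
  "simplicial_set X \<longleftrightarrow>
     (\<forall>m n. \<forall>\<alpha>\<in>simp_op m n. \<forall>x\<in>cells X n. act X m n \<alpha> x \<in> cells X m) \<and>
     (\<forall>n. \<forall>x\<in>cells X n. act X n n (\<lambda>i\<in>{..n}. i) x = x) \<and>
     (\<forall>k m n. \<forall>\<alpha>\<in>simp_op m n. \<forall>\<beta>\<in>simp_op k m. \<forall>x\<in>cells X n.
        act X k n (compose {..k} \<alpha> \<beta>) x = act X k m \<beta> (act X m n \<alpha> x))"

type_synonym ('a, 'b) smap = "nat \<Rightarrow> 'a \<Rightarrow> 'b"

definition simplicial_map :: "'a sset \<Rightarrow> 'b sset \<Rightarrow> ('a, 'b) smap \<Rightarrow> bool" where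
  "simplicial_map X Y f \<longleftrightarrow> simplicial_set X \<and> simplicial_set Y \<and>
     (\<forall>n. \<forall>x\<in>cells X n. f n x \<in> cells Y n) \<and>
     (\<forall>m n. \<forall>\<alpha>\<in>simp_op m n. \<forall>x\<in>cells X n. f m (act X m n \<alpha> x) = act Y m n \<alpha> (f n x))"

definition scomp :: "('b, 'c) smap \<Rightarrow> ('a, 'b) smap \<Rightarrow> ('a, 'c) smap"  (infixl "\<circ>\<^sub>s" 55) where
  "g \<circ>\<^sub>s f = (\<lambda>n x. g n (f n x))"

text \<open>Equality of simplicial maps out of \<open>X\<close>; values off the cells of \<open>X\<close> are irrelevant.\<close>

definition eq_smap :: "'a sset \<Rightarrow> ('a, 'b) smap \<Rightarrow> ('a, 'b) smap \<Rightarrow> bool" where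
  "eq_smap X f g \<longleftrightarrow> (\<forall>n. \<forall>x\<in>cells X n. f n x = g n x)"

definition pullback :: "'a sset \<Rightarrow> ('a, 'c) smap \<Rightarrow> 'b sset \<Rightarrow> ('b, 'c) smap \<Rightarrow> ('a \<times> 'b) sset" where
  "pullback X f Y g =
     \<lparr>cells = (\<lambda>n. {(x, y). x \<in> cells X n \<and> y \<in> cells Y n \<and> f n x = g n y}),
      act = (\<lambda>m n \<alpha>. map_prod (act X m n \<alpha>) (act Y m n \<alpha>))\<rparr>"

definition spr1 :: "('a \<times> 'b, 'a) smap" where "spr1 = (\<lambda>n. fst)"
definition spr2 :: "('a \<times> 'b, 'b) smap" where "spr2 = (\<lambda>n. snd)"

text \<open>The map \<open>h \<times> id\<close> between pullbacks.\<close>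

definition base_change :: "('a, 'b) smap \<Rightarrow> ('a \<times> 'c, 'b \<times> 'c) smap" where
  "base_change h = (\<lambda>n. map_prod (h n) id)"

definition has_section :: "'a sset \<Rightarrow> 'b sset \<Rightarrow> ('a, 'b) smap \<Rightarrow> bool" where
  "has_section X B f \<longleftrightarrow> (\<exists>s. simplicial_map B X s \<and> eq_smap B (f \<circ>\<^sub>s s) (\<lambda>n b. b))"


section \<open>Kan fibrations and trivial cofibrations\<close>

definition std_simplex :: "nat \<Rightarrow> (nat \<Rightarrow> nat) sset" where
  "std_simplex n = \<lparr>cells = (\<lambda>m. simp_op m n), act = (\<lambda>k m \<beta> \<alpha>. compose {..k} \<alpha> \<beta>)\<rparr>"

text \<open>\<open>horn n k\<close> is the union of all faces of the \<open>n\<close>-simplex except the one opposite to \<open>k\<close>.\<close>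

definition horn :: "nat \<Rightarrow> nat \<Rightarrow> (nat \<Rightarrow> nat) sset" where
  "horn n k = (std_simplex n)
     \<lparr>cells := (\<lambda>m. {\<alpha> \<in> simp_op m n. \<exists>i\<le>n. i \<noteq> k \<and> i \<notin> \<alpha> ` {..m}})\<rparr>"

definition has_lifting ::
    "'a sset \<Rightarrow> 'b sset \<Rightarrow> ('a, 'b) smap \<Rightarrow> 'x sset \<Rightarrow> 'y sset \<Rightarrow> ('x, 'y) smap \<Rightarrow> bool" where
  "has_lifting A B i X Y p \<longleftrightarrow>
     (\<forall>u v. simplicial_map A X u \<and> simplicial_map B Y v \<and> eq_smap A (p \<circ>\<^sub>s u) (v \<circ>\<^sub>s i) \<longrightarrow>
        (\<exists>w. simplicial_map B X w \<and> eq_smap A (w \<circ>\<^sub>s i) u \<and> eq_smap B (p \<circ>\<^sub>s w) v))"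

definition kan_fibration :: "'a sset \<Rightarrow> 'b sset \<Rightarrow> ('a, 'b) smap \<Rightarrow> bool" where
  "kan_fibration X Y p \<longleftrightarrow> simplicial_map X Y p \<and>
     (\<forall>n\<ge>1. \<forall>k\<le>n. has_lifting (horn n k) (std_simplex n) (\<lambda>m \<alpha>. \<alpha>) X Y p)"

text \<open>The trivial cofibrations are the left class of the weak factorization system of the
  Kan--Quillen model structure whose right class is the Kan fibrations: the monomorphisms with
  the left lifting property against all Kan fibrations.
  It suffices to test against Kan fibrations whose cells are drawn from the same
  type as those of \<open>A\<close> and \<open>B\<close>, provided that type is infinite: factoring \<open>i\<close> by the small object
  argument as a relative horn complex followed by a Kan fibration stays within
  that cardinality, so \<open>i\<close> is then a retract of a relative horn complex.\<close>

definition trivial_cofibration :: "'a sset \<Rightarrow> 'a sset \<Rightarrow> ('a, 'a) smap \<Rightarrow> bool" where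
  "trivial_cofibration A B i \<longleftrightarrow> simplicial_map A B i \<and> (\<forall>n. inj_on (i n) (cells A n)) \<and>
     (\<forall>(X :: 'a sset) (Y :: 'a sset) p. kan_fibration X Y p \<longrightarrow> has_lifting A B i X Y p)"


section \<open>Truncatedness\<close>

text \<open>\<open>q\<close> is a path fibration of \<open>f : X \<rightarrow> B\<close>, the diagonal of \<open>f\<close> being \<open>q \<circ> i\<close>.\<close>

definition path_fibration ::
    "'a sset \<Rightarrow> 'b sset \<Rightarrow> ('a, 'b) smap \<Rightarrow>
     'a sset \<Rightarrow> ('a, 'a) smap \<Rightarrow> ('a, 'a \<times> 'a) smap \<Rightarrow> bool" where
  "path_fibration X B f P i q \<longleftrightarrow>
     trivial_cofibration X P i \<and> kan_fibration P (pullback X f X f) q \<and>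
     eq_smap X (q \<circ>\<^sub>s i) (\<lambda>n x. (x, x))"

definition minus_one_truncated :: "'a sset \<Rightarrow> 'b sset \<Rightarrow> ('a, 'b) smap \<Rightarrow> bool" where
  "minus_one_truncated X B f \<longleftrightarrow> kan_fibration X B f \<and>
     (\<exists>P i q. path_fibration X B f P i q \<and> has_section P (pullback X f X f) q)"

definition zero_truncated :: "'a sset \<Rightarrow> 'b sset \<Rightarrow> ('a, 'b) smap \<Rightarrow> bool" where
  "zero_truncated X B f \<longleftrightarrow> kan_fibration X B f \<and>
     (\<exists>P i q. path_fibration X B f P i q \<and> minus_one_truncated P (pullback X f X f) q)"

text \<open>\<open>t : T \<rightarrow> B\<close> together with \<open>\<eta> : X \<rightarrow> T\<close> over \<open>B\<close> is a \<open>(-1)\<close>-truncation of \<open>f : X \<rightarrow> B\<close>. The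
  map \<open>d : D \<rightarrow> B\<close> is the one along which everything is pulled back.\<close>

definition is_minus_one_truncation ::
    "'a sset \<Rightarrow> 'b sset \<Rightarrow> ('a, 'b) smap \<Rightarrow>
     'a sset \<Rightarrow> ('a, 'b) smap \<Rightarrow> ('a, 'a) smap \<Rightarrow> bool" where
  "is_minus_one_truncation X B f T t \<eta> \<longleftrightarrow>
     minus_one_truncated T B t \<and> simplicial_map X T \<eta> \<and> eq_smap X (t \<circ>\<^sub>s \<eta>) f \<and>
     (\<forall>(D :: 'b sset) d (Z :: 'a sset) z g.
        simplicial_map D B d \<and> minus_one_truncated Z D z \<and>
        simplicial_map (pullback X f D d) Z g \<and> eq_smap (pullback X f D d) (z \<circ>\<^sub>s g) spr2 \<longrightarrow>
        (\<exists>h. simplicial_map (pullback T t D d) Z h \<and>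
             eq_smap (pullback T t D d) (z \<circ>\<^sub>s h) spr2 \<and>
             eq_smap (pullback X f D d) (h \<circ>\<^sub>s base_change \<eta>) g))"

definition minus_one_connected :: "'a sset \<Rightarrow> 'b sset \<Rightarrow> ('a, 'b) smap \<Rightarrow> bool" where
  "minus_one_connected X B f \<longleftrightarrow>
     (\<exists>T t \<eta>. is_minus_one_truncation X B f T t \<eta> \<and> has_section T B t)"


section \<open>Dependent products\<close>

text \<open>\<open>\<pi> : Q \<rightarrow> B\<close> is the value at \<open>e : Y \<rightarrow> X\<close> of the right adjoint of pullback along \<open>p : X \<rightarrow> B\<close>,
  with counit \<open>\<epsilon>\<close>: maps \<open>D \<rightarrow> Q\<close> over \<open>B\<close> correspond to maps \<open>D \<times>\<^bsub>B\<^esub> X \<rightarrow> Y\<close> over \<open>X\<close>.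
  Testing with \<open>D\<close> over the cell type of \<open>B\<close> suffices when that type is infinite, since it then
  accommodates all standard simplices. The dependent product exists for a suitable
  cell type \<open>'q\<close>: an \<open>n\<close>-cell is an \<open>n\<close>-cell \<open>b\<close> of \<open>B\<close> with a map from the pullback of \<open>X\<close> along
  \<open>b\<close> to \<open>Y\<close> over \<open>X\<close>.\<close>

definition is_dependent_product ::
    "'x sset \<Rightarrow> 'b sset \<Rightarrow> ('x, 'b) smap \<Rightarrow> 'y sset \<Rightarrow> ('y, 'x) smap \<Rightarrow>
     'q sset \<Rightarrow> ('q, 'b) smap \<Rightarrow> ('q \<times> 'x, 'y) smap \<Rightarrow> bool" where
  "is_dependent_product X B p Y e Q \<pi> \<epsilon> \<longleftrightarrow>
     simplicial_map Q B \<pi> \<and>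
     simplicial_map (pullback Q \<pi> X p) Y \<epsilon> \<and> eq_smap (pullback Q \<pi> X p) (e \<circ>\<^sub>s \<epsilon>) spr2 \<and>
     (\<forall>(D :: 'b sset) d g.
        simplicial_map D B d \<and>
        simplicial_map (pullback D d X p) Y g \<and> eq_smap (pullback D d X p) (e \<circ>\<^sub>s g) spr2 \<longrightarrow>
        (\<exists>h. simplicial_map D Q h \<and> eq_smap D (\<pi> \<circ>\<^sub>s h) d \<and>
             eq_smap (pullback D d X p) (\<epsilon> \<circ>\<^sub>s base_change h) g \<and>
             (\<forall>h'. simplicial_map D Q h' \<and> eq_smap D (\<pi> \<circ>\<^sub>s h') d \<and>
                   eq_smap (pullback D d X p) (\<epsilon> \<circ>\<^sub>s base_change h') g \<longrightarrow> eq_smap D h' h)))"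

end

theory Submission
  imports Defs
begin

text \<open>A \<open>(-1)\<close>-truncated fibration has the right lifting property against every boundary inclusion
  whose base simplex has a lifted vertex; so it has a section as soon as it is surjective on vertices.
  For \<open>T \<rightarrow> \<Gamma>\<close> it is therefore enough to find a vertex of \<open>\<Pi>\<^sub>p e\<close> over each vertex of \<open>\<Gamma>\<close>, that is, a
  section of \<open>e\<close> over each fibre \<open>F\<close> of \<open>p\<close>. Since \<open>F\<close> is 0-truncated, it contracts onto a set of
  representatives of its components. Connectedness of \<open>e\<close> says that \<open>e\<close> is surjective on vertices, so
  the axiom of choice gives a section over the representatives, and homotopy lifting transports it
  along the contraction.

  The homotopical input is that a section \<open>i\<close> of a Kan fibration which is a trivial cofibration is a
  fibrewise deformation retract: \<open>i\<close> lifts against the fibration of paths starting in \<open>i\<close>.\<close>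

subsection \<open>Simplicial operators\<close>

text \<open>One obstacle is size: \<open>trivial_cofibration\<close> tests lifting only against
  fibrations whose cells have a fixed type, while the path fibration consists of functions on
  prisms. A path over an \<open>n\<close>-simplex is determined by the \<open>n + 1\<close> maximal
  simplices of its prism, so in each dimension the paths embed into lists of fixed length, hence
  into the infinite cell type. Another is coherence: sections chosen vertex by vertex need not fit
  together over the higher simplices of the base. They need not, because they are compared only in
  the truncation. Within one fibre coherence does matter, and there it comes from a choice that is
  constant on components. The homotopy theory is reduced to horns through one Zorn argument,
  \<open>cell_extension\<close>, with a parameter \<open>J\<close>: a point for \<open>J\<close>
  gives sections, the interval gives homotopy lifting. Only the open prisms over simplices have to
  be filled by an explicit sequence of horns.\<close>

abbreviation id_op :: "nat \<Rightarrow> nat \<Rightarrow> nat" where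
  "id_op n \<equiv> (\<lambda>i\<in>{..n}. i)"

text \<open>The vertex \<open>i\<close> of \<open>[n]\<close> is \<open>const_op i 0\<close>, and \<open>const_op 0 m\<close> is the operator \<open>[m] \<rightarrow> [0]\<close>.\<close>

definition const_op :: "nat \<Rightarrow> nat \<Rightarrow> nat \<Rightarrow> nat" where
  "const_op c n = (\<lambda>i\<in>{..n}. c)"

lemma const_op_apply [simp]: "i \<le> n \<Longrightarrow> const_op c n i = c"
  by (simp add: const_op_def)

lemma simp_opI:
  assumes "\<And>i. i \<le> m \<Longrightarrow> f i \<le> n" and "\<And>i j. i \<le> j \<Longrightarrow> j \<le> m \<Longrightarrow> f i \<le> f j"
  shows "(\<lambda>i\<in>{..m}. f i) \<in> simp_op m n"
  using assms by (auto simp: simp_op_def mono_on_def)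

lemma simp_op_le: "\<alpha> \<in> simp_op m n \<Longrightarrow> i \<le> m \<Longrightarrow> \<alpha> i \<le> n"
  by (auto simp: simp_op_def)

lemma simp_op_mono: "\<alpha> \<in> simp_op m n \<Longrightarrow> i \<le> j \<Longrightarrow> j \<le> m \<Longrightarrow> \<alpha> i \<le> \<alpha> j"
  by (auto simp: simp_op_def mono_on_def)

lemma simp_op_eqI:
  assumes "\<alpha> \<in> simp_op m n" "\<beta> \<in> simp_op m n'" "\<And>i. i \<le> m \<Longrightarrow> \<alpha> i = \<beta> i"
  shows "\<alpha> = \<beta>"
proof
  fix i show "\<alpha> i = \<beta> i"
    using assms by (cases "i \<le> m") (auto simp: simp_op_def PiE_def extensional_def)
qed

lemma id_op_simp_op [simp]: "id_op n \<in> simp_op n n"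
  by (rule simp_opI) auto

lemma const_op_simp_op [simp]: "c \<le> n \<Longrightarrow> const_op c m \<in> simp_op m n"
  unfolding const_op_def by (rule simp_opI) auto

lemma compose_simp_op [intro, simp]:
  assumes "\<alpha> \<in> simp_op m n" "\<beta> \<in> simp_op k m"
  shows "compose {..k} \<alpha> \<beta> \<in> simp_op k n"
  unfolding compose_def using assms
  by (intro simp_opI) (auto intro: simp_op_le simp_op_mono)

lemma compose_apply [simp]: "i \<le> k \<Longrightarrow> compose {..k} \<alpha> \<beta> i = \<alpha> (\<beta> i)"
  by (simp add: compose_def)

lemma compose_id_op [simp]: "\<alpha> \<in> simp_op m n \<Longrightarrow> compose {..m} \<alpha> (id_op m) = \<alpha>"
  by (rule simp_op_eqI[of _ m n]) auto

lemma id_op_compose [simp]: "\<alpha> \<in> simp_op m n \<Longrightarrow> compose {..m} (id_op n) \<alpha> = \<alpha>"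
  by (rule simp_op_eqI[of _ m n, OF compose_simp_op[of _ n]]) (auto dest: simp_op_le)

lemma compose_const_op [simp]:
  "\<alpha> \<in> simp_op m n \<Longrightarrow> compose {..m} (const_op c n) \<alpha> = const_op c m"
  by (rule simp_op_eqI[of _ m c _ c, OF compose_simp_op[of _ n]]) (auto dest: simp_op_le)

lemma compose_const: "compose {..m} \<alpha> (const_op i m) = const_op (\<alpha> i) m"
  by (auto simp: compose_def const_op_def fun_eq_iff)

lemma const_op_0_0: "const_op 0 0 = id_op 0"
  by (auto simp: const_op_def fun_eq_iff)

lemma simp_op_compose_assoc:
  assumes "\<gamma> \<in> simp_op k m"
  shows "compose {..k} \<alpha> (compose {..k} \<beta> \<gamma>) = compose {..k} (compose {..m} \<alpha> \<beta>) \<gamma>"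
  using assms by (intro compose_assoc) (auto dest: simp_op_le)

text \<open>Counting makes the surjection injective, hence strictly increasing; climbing from
  \<open>0\<close> then gives \<open>i \<le> \<alpha> i\<close>, and descending from
  \<open>n\<close> gives the converse bound.\<close>

lemma simp_op_surj_id:
  assumes \<alpha>: "\<alpha> \<in> simp_op n n" and surj: "\<And>i. i \<le> n \<Longrightarrow> i \<in> \<alpha> ` {..n}"
  shows "\<alpha> = id_op n"
proof -
  have im: "\<alpha> ` {..n} = {..n}"
    using \<alpha> surj by (auto dest: simp_op_le)
  have inj: "inj_on \<alpha> {..n}"
    by (rule eq_card_imp_inj_on) (simp_all add: im)
  have sm: "\<alpha> i < \<alpha> j" if "i < j" "j \<le> n" for i j
    using simp_op_mono[OF \<alpha>, of i j] inj that by (force simp: inj_on_def order_le_less)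
  have ge: "i \<le> \<alpha> i" if "i \<le> n" for i
    using that
  proof (induction i)
    case (Suc i)
    then show ?case using sm[of i "Suc i"] by simp
  qed simp
  have le: "\<alpha> (n - i) \<le> n - i" if "i \<le> n" for i
    using that
  proof (induction i)
    case 0
    then show ?case using simp_op_le[OF \<alpha>] by simp
  next
    case (Suc i)
    then have "\<alpha> (n - Suc i) < \<alpha> (n - i)" by (intro sm) auto
    with Suc show ?case by simp
  qed
  show ?thesis
  proof (rule simp_op_eqI[OF \<alpha> id_op_simp_op])
    fix i assume "i \<le> n"
    then show "\<alpha> i = id_op n i" using ge[of i] le[of "n - i"] by simp
  qed
qed

text \<open>\<open>\<delta>\<close> is the coface skipping \<open>i\<close>, and
  \<open>\<sigma>\<close> closes the gap by lowering the values above \<open>i\<close>. Cells with a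
  missed vertex are thereby reduced to lower dimensions.\<close>

lemma simp_op_factor_coface:
  assumes \<alpha>: "\<alpha> \<in> simp_op m n" and i: "i \<le> n" "i \<notin> \<alpha> ` {..m}"
  obtains k \<delta> \<sigma> where "k < n" "\<delta> \<in> simp_op k n" "\<sigma> \<in> simp_op m k" "\<alpha> = compose {..m} \<delta> \<sigma>"
proof -
  have n: "0 < n"
    using simp_op_le[OF \<alpha>, of 0] i by (cases n) auto
  define \<delta> where "\<delta> = (\<lambda>x\<in>{..n-1}. if x < i then x else x + 1)"
  define \<sigma> where "\<sigma> = (\<lambda>x\<in>{..m}. if \<alpha> x < i then \<alpha> x else \<alpha> x - 1)"
  have ne: "\<alpha> x \<noteq> i" if "x \<le> m" for x using i that by auto
  have \<delta>: "\<delta> \<in> simp_op (n-1) n"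
    unfolding \<delta>_def using n by (intro simp_opI) auto
  have \<sigma>: "\<sigma> \<in> simp_op m (n-1)"
    unfolding \<sigma>_def
  proof (intro simp_opI)
    fix x assume "x \<le> m"
    then show "(if \<alpha> x < i then \<alpha> x else \<alpha> x - 1) \<le> n - 1"
      using simp_op_le[OF \<alpha>, of x] i by auto
  next
    fix x y assume "x \<le> y" "y \<le> m"
    then show "(if \<alpha> x < i then \<alpha> x else \<alpha> x - 1) \<le> (if \<alpha> y < i then \<alpha> y else \<alpha> y - 1)"
      using simp_op_mono[OF \<alpha>, of x y] by auto
  qed
  have "\<alpha> = compose {..m} \<delta> \<sigma>"
  proof (rule simp_op_eqI[OF \<alpha> compose_simp_op[OF \<delta> \<sigma>]])
    fix x assume x: "x \<le> m"
    have "\<sigma> x \<le> n - 1" using simp_op_le[OF \<sigma> x] .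
    with x ne[OF x] show "\<alpha> x = compose {..m} \<delta> \<sigma> x"
      by (auto simp: \<delta>_def \<sigma>_def)
  qed
  with n \<delta> \<sigma> show thesis by (intro that[of "n-1" \<delta> \<sigma>]) auto
qed

text \<open>Any choice of preimages is monotone, because \<open>\<alpha>\<close> is. Prescribing
  that the section passes through \<open>x\<close> later allows a surjection to be recovered from
  its sections.\<close>

lemma simp_op_section:
  assumes \<alpha>: "\<alpha> \<in> simp_op m n" and surj: "\<And>i. i \<le> n \<Longrightarrow> i \<in> \<alpha> ` {..m}" and x: "x \<le> m"
  obtains \<delta> where "\<delta> \<in> simp_op n m" "compose {..n} \<alpha> \<delta> = id_op n" "\<delta> (\<alpha> x) = x"
proof -
  have "\<exists>y\<le>m. \<alpha> y = i" if "i \<le> n" for i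
    using surj[OF that] by auto
  then obtain d where d: "\<And>i. i \<le> n \<Longrightarrow> d i \<le> m \<and> \<alpha> (d i) = i" by metis
  define \<delta> where "\<delta> = (\<lambda>i\<in>{..n}. if i = \<alpha> x then x else d i)"
  have *: "(if i = \<alpha> x then x else d i) \<le> m \<and> \<alpha> (if i = \<alpha> x then x else d i) = i" if "i \<le> n" for i
    using d[OF that] x by auto
  have \<delta>: "\<delta> \<in> simp_op n m" unfolding \<delta>_def
  proof (rule simp_opI)
    fix i j assume ij: "i \<le> j" "j \<le> n"
    let ?a = "if i = \<alpha> x then x else d i" and ?b = "if j = \<alpha> x then x else d j"
    show "?a \<le> ?b"
    proof (rule ccontr)
      assume "\<not> ?a \<le> ?b"
      then have "?b \<le> ?a" "?a \<noteq> ?b" by auto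
      have "\<alpha> ?b \<le> \<alpha> ?a"
        using \<open>?b \<le> ?a\<close> * [of i] ij by (intro simp_op_mono[OF \<alpha>]) auto
      then have "j \<le> i" using *[of i] *[of j] ij by simp
      then have "i = j" using ij by simp
      with \<open>?a \<noteq> ?b\<close> show False by fast
    qed
  qed (use * in auto)
  have "compose {..n} \<alpha> \<delta> = id_op n"
    by (rule simp_op_eqI[OF compose_simp_op[OF \<alpha> \<delta>] id_op_simp_op]) (use * in \<open>simp add: \<delta>_def\<close>)
  moreover have "\<delta> (\<alpha> x) = x"
    using simp_op_le[OF \<alpha> x] by (simp add: \<delta>_def)
  ultimately show thesis using \<delta> that by blast
qed


subsection \<open>Subcomplexes, products and pullbacks\<close>

lemma act_cells:
  "simplicial_set X \<Longrightarrow> \<alpha> \<in> simp_op m n \<Longrightarrow> x \<in> cells X n \<Longrightarrow> act X m n \<alpha> x \<in> cells X m"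
  by (simp add: simplicial_set_def)

lemma act_id: "simplicial_set X \<Longrightarrow> x \<in> cells X n \<Longrightarrow> act X n n (id_op n) x = x"
  by (simp add: simplicial_set_def)

lemma act_act:
  "simplicial_set X \<Longrightarrow> \<alpha> \<in> simp_op m n \<Longrightarrow> \<beta> \<in> simp_op k m \<Longrightarrow> x \<in> cells X n \<Longrightarrow>
    act X k m \<beta> (act X m n \<alpha> x) = act X k n (compose {..k} \<alpha> \<beta>) x"
  by (simp add: simplicial_set_def)

lemma smap_cells: "simplicial_map X Y f \<Longrightarrow> x \<in> cells X n \<Longrightarrow> f n x \<in> cells Y n"
  by (simp add: simplicial_map_def)

lemma smap_act:
  "simplicial_map X Y f \<Longrightarrow> \<alpha> \<in> simp_op m n \<Longrightarrow> x \<in> cells X n \<Longrightarrow>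
    f m (act X m n \<alpha> x) = act Y m n \<alpha> (f n x)"
  by (simp add: simplicial_map_def)

lemma smap_dom: "simplicial_map X Y f \<Longrightarrow> simplicial_set X"
  and smap_cod: "simplicial_map X Y f \<Longrightarrow> simplicial_set Y"
  by (simp_all add: simplicial_map_def)

lemma smap_comp:
  "simplicial_map X Y f \<Longrightarrow> simplicial_map Y Z g \<Longrightarrow> simplicial_map X Z (g \<circ>\<^sub>s f)"
  by (simp add: simplicial_map_def scomp_def)

lemma smap_id: "simplicial_set X \<Longrightarrow> simplicial_map X X (\<lambda>n x. x)"
  by (simp add: simplicial_map_def)

text \<open>A bare family of sets of cells; the simplicial set it spans is the record update
  \<open>X\<lparr>cells := D\<rparr>\<close>, which inherits the action, so restricting a map leaves
  the function itself unchanged.\<close>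

definition subcomplex :: "'a sset \<Rightarrow> (nat \<Rightarrow> 'a set) \<Rightarrow> bool" where
  "subcomplex X D \<longleftrightarrow> (\<forall>n. D n \<subseteq> cells X n) \<and>
     (\<forall>m n. \<forall>\<alpha>\<in>simp_op m n. \<forall>x\<in>D n. act X m n \<alpha> x \<in> D m)"

lemma subcomplex_simplicial_set:
  "simplicial_set X \<Longrightarrow> subcomplex X D \<Longrightarrow> simplicial_set (X\<lparr>cells := D\<rparr>)"
  by (auto simp: simplicial_set_def subcomplex_def subset_iff)

lemma smap_restrict:
  assumes f: "simplicial_map X Y f" and D: "subcomplex X D" and D': "subcomplex Y D'"
    and sub: "\<And>n x. x \<in> D n \<Longrightarrow> f n x \<in> D' n"
  shows "simplicial_map (X\<lparr>cells := D\<rparr>) (Y\<lparr>cells := D'\<rparr>) f"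
proof -
  have "x \<in> cells X n" if "x \<in> D n" for x n using D that by (auto simp: subcomplex_def)
  then show ?thesis
    using sub smap_act[OF f] subcomplex_simplicial_set[OF smap_dom[OF f] D]
      subcomplex_simplicial_set[OF smap_cod[OF f] D'] by (simp add: simplicial_map_def)
qed

definition sprod :: "'a sset \<Rightarrow> 'b sset \<Rightarrow> ('a \<times> 'b) sset" where
  "sprod X Y = \<lparr>cells = (\<lambda>n. cells X n \<times> cells Y n),
     act = (\<lambda>m n \<alpha>. map_prod (act X m n \<alpha>) (act Y m n \<alpha>))\<rparr>"

lemma sprod_cells [simp]: "cells (sprod X Y) n = cells X n \<times> cells Y n"
  by (simp add: sprod_def)

lemma sprod_act [simp]: "act (sprod X Y) m n \<alpha> (x, y) = (act X m n \<alpha> x, act Y m n \<alpha> y)"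
  by (simp add: sprod_def)

lemma sprod_simplicial_set:
  "simplicial_set X \<Longrightarrow> simplicial_set Y \<Longrightarrow> simplicial_set (sprod X Y)"
  by (auto simp: simplicial_set_def)

lemma sprod_snd:
  "simplicial_set X \<Longrightarrow> simplicial_set Y \<Longrightarrow> simplicial_map (sprod X Y) Y (\<lambda>n x. snd x)"
  by (auto simp: simplicial_map_def sprod_simplicial_set)

lemma pullback_cells [simp]:
  "cells (pullback X f Y g) n = {(x, y). x \<in> cells X n \<and> y \<in> cells Y n \<and> f n x = g n y}"
  by (simp add: pullback_def)

lemma pullback_act [simp]:
  "act (pullback X f Y g) m n \<alpha> (x, y) = (act X m n \<alpha> x, act Y m n \<alpha> y)"
  by (simp add: pullback_def)

lemma pullback_simplicial_set:
  "simplicial_map X B f \<Longrightarrow> simplicial_map Y B g \<Longrightarrow> simplicial_set (pullback X f Y g)"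
  by (auto simp: simplicial_map_def simplicial_set_def)

lemma std_simplex_cells [simp]: "cells (std_simplex n) m = simp_op m n"
  by (simp add: std_simplex_def)

lemma std_simplex_act [simp]: "act (std_simplex n) k m \<beta> \<alpha> = compose {..k} \<alpha> \<beta>"
  by (simp add: std_simplex_def)

lemma std_simplex_simplicial_set [simp]: "simplicial_set (std_simplex n)"
  by (auto simp: simplicial_set_def simp_op_compose_assoc)

lemma horn_eq:
  "horn n k = (std_simplex n)\<lparr>cells := \<lambda>m. {\<alpha> \<in> simp_op m n. \<exists>i\<le>n. i \<noteq> k \<and> i \<notin> \<alpha> ` {..m}}\<rparr>"
  by (simp add: horn_def)

lemma horn_cells [simp]:
  "cells (horn n k) m = {\<alpha> \<in> simp_op m n. \<exists>i\<le>n. i \<noteq> k \<and> i \<notin> \<alpha> ` {..m}}"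
  by (simp add: horn_def)

lemma horn_act [simp]: "act (horn n k) = act (std_simplex n)"
  by (simp add: horn_def)

lemma notin_image_compose:
  "i \<notin> \<alpha> ` {..m} \<Longrightarrow> \<beta> \<in> simp_op k m \<Longrightarrow> i \<notin> compose {..k} \<alpha> \<beta> ` {..k}"
  by (auto simp: compose_def dest: simp_op_le)

text \<open>One closure argument for horns and boundaries: precomposition can only shrink the image
  of an operator.\<close>

lemma faces_subcomplex:
  "subcomplex (std_simplex n) (\<lambda>m. {\<alpha> \<in> simp_op m n. \<exists>i\<le>n. Q i \<and> i \<notin> \<alpha> ` {..m}})"
proof -
  have "compose {..m} \<alpha> \<beta> \<in> {\<alpha> \<in> simp_op m n. \<exists>i\<le>n. Q i \<and> i \<notin> \<alpha> ` {..m}}"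
    if "\<beta> \<in> simp_op m k" "\<alpha> \<in> simp_op k n" "i \<le> n" "Q i" "i \<notin> \<alpha> ` {..k}" for m k \<alpha> \<beta> i
    using that notin_image_compose[OF that(5,1)] compose_simp_op[OF that(2,1)] by blast
  then show ?thesis
    unfolding subcomplex_def std_simplex_cells std_simplex_act by blast
qed

lemma horn_subcomplex: "subcomplex (std_simplex n) (cells (horn n k))"
  using faces_subcomplex[of n "\<lambda>i. i \<noteq> k"] by (simp add: horn_def)

lemma horn_simplicial_set [simp]: "simplicial_set (horn n k)"
  using subcomplex_simplicial_set[OF std_simplex_simplicial_set horn_subcomplex]
  by (simp add: horn_eq)

section \<open>Boundaries and maps out of a simplex\<close>

definition boundary :: "nat \<Rightarrow> nat \<Rightarrow> (nat \<Rightarrow> nat) set" where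
  "boundary n m = {\<alpha> \<in> simp_op m n. \<exists>i\<le>n. i \<notin> \<alpha> ` {..m}}"

lemma boundary_subcomplex: "subcomplex (std_simplex n) (boundary n)"
  using faces_subcomplex[of n "\<lambda>i. True"] by (simp add: boundary_def[abs_def])

text \<open>With \<open>yoneda_eq\<close> this is the Yoneda lemma: a map out of the simplex is a
  cell, namely the value at the identity operator.\<close>

lemma yoneda_smap:
  assumes "simplicial_set X" "x \<in> cells X n"
  shows "simplicial_map (std_simplex n) X (\<lambda>m \<alpha>. act X m n \<alpha> x)"
  using assms by (auto simp: simplicial_map_def act_cells act_act)

lemma yoneda_eq:
  assumes "simplicial_map (std_simplex n) X f" "\<alpha> \<in> simp_op m n"
  shows "f m \<alpha> = act X m n \<alpha> (f n (id_op n))"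
  using smap_act[OF assms(1) assms(2), of "id_op n"] assms(2) by simp


subsection \<open>Partial lifts\<close>

text \<open>A partial lift of \<open>v : B \<rightarrow> T\<close> along \<open>r : P \<rightarrow> T\<close>, as a subcomplex of \<open>B \<times>\<^bsub>T\<^esub> P\<close> that is
  single-valued over \<open>B\<close>. Represented by graphs, partial lifts are closed under unions of
  chains and under gluing.\<close>

definition plift ::
  "'b sset \<Rightarrow> 'p sset \<Rightarrow> ('p, 't) smap \<Rightarrow> ('b, 't) smap \<Rightarrow> (nat \<times> 'b \<times> 'p) set \<Rightarrow> bool" where
  "plift B P r v G \<longleftrightarrow>
     (\<forall>n b y. (n, b, y) \<in> G \<longrightarrow> b \<in> cells B n \<and> y \<in> cells P n \<and> r n y = v n b) \<and>
     (\<forall>m n b y. \<forall>\<alpha>\<in>simp_op m n. (n, b, y) \<in> G \<longrightarrow> (m, act B m n \<alpha> b, act P m n \<alpha> y) \<in> G) \<and>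
     (\<forall>n b y y'. (n, b, y) \<in> G \<longrightarrow> (n, b, y') \<in> G \<longrightarrow> y = y')"

definition gdom :: "(nat \<times> 'b \<times> 'p) set \<Rightarrow> nat \<Rightarrow> 'b set" where
  "gdom G n = {b. \<exists>y. (n, b, y) \<in> G}"

lemma gdomI: "(n, b, y) \<in> G \<Longrightarrow> b \<in> gdom G n"
  by (auto simp: gdom_def)

lemma plift_cells:
  assumes "plift B P r v G" "(n, b, y) \<in> G"
  shows "b \<in> cells B n" "y \<in> cells P n" "r n y = v n b"
  using assms by (auto simp: plift_def)

lemma plift_act:
  "plift B P r v G \<Longrightarrow> (n, b, y) \<in> G \<Longrightarrow> \<alpha> \<in> simp_op m n \<Longrightarrow>
    (m, act B m n \<alpha> b, act P m n \<alpha> y) \<in> G"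
  by (simp add: plift_def)

lemma plift_unique: "plift B P r v G \<Longrightarrow> (n, b, y) \<in> G \<Longrightarrow> (n, b, y') \<in> G \<Longrightarrow> y = y'"
  by (simp add: plift_def)

lemma plift_the:
  assumes "plift B P r v G" "b \<in> gdom G n"
  shows "(n, b, THE y. (n, b, y) \<in> G) \<in> G"
proof -
  obtain y where "(n, b, y) \<in> G" using assms(2) by (auto simp: gdom_def)
  moreover from this have "(THE y. (n, b, y) \<in> G) = y"
    using plift_unique[OF assms(1)] by blast
  ultimately show ?thesis by simp
qed

lemma plift_the_eq: "plift B P r v G \<Longrightarrow> (n, b, y) \<in> G \<Longrightarrow> (THE y. (n, b, y) \<in> G) = y"
  using plift_unique by (metis the_equality)

lemma plift_subcomplex: "plift B P r v G \<Longrightarrow> subcomplex B (gdom G)"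
  unfolding subcomplex_def by (auto simp: gdom_def dest: plift_cells(1) plift_act)

lemma plift_smap:
  assumes G: "plift B P r v G" and "simplicial_set B" "simplicial_set P"
  shows "simplicial_map (B\<lparr>cells := gdom G\<rparr>) P (\<lambda>n b. THE y. (n, b, y) \<in> G)"
proof -
  have "(THE y. (m, act B m n \<alpha> b, y) \<in> G) = act P m n \<alpha> (THE y. (n, b, y) \<in> G)"
    if "\<alpha> \<in> simp_op m n" "b \<in> gdom G n" for m n \<alpha> b
    using plift_act[OF G plift_the[OF G that(2)] that(1)] by (rule plift_the_eq[OF G])
  then show ?thesis
    unfolding simplicial_map_def
    using subcomplex_simplicial_set[OF assms(2) plift_subcomplex[OF G]] assms(3)
      plift_cells(2)[OF G plift_the[OF G]]
    by auto
qed

definition graph_of :: "(nat \<Rightarrow> 'b set) \<Rightarrow> ('b, 'p) smap \<Rightarrow> (nat \<times> 'b \<times> 'p) set" where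
  "graph_of D u = {(n, b, y). b \<in> D n \<and> y = u n b}"

lemma gdom_graph_of [simp]: "gdom (graph_of D u) = D"
  by (auto simp: gdom_def graph_of_def)

lemma plift_graph_of:
  assumes "subcomplex B D" "simplicial_map (B\<lparr>cells := D\<rparr>) P u"
    "\<And>n b. b \<in> D n \<Longrightarrow> r n (u n b) = v n b"
  shows "plift B P r v (graph_of D u)"
  using assms by (auto simp: plift_def graph_of_def subcomplex_def simplicial_map_def subset_iff)

text \<open>Restricts a partial lift to a simplex about to be attached; the resulting domain is the
  part of \<open>S\<close> on which the lift is already prescribed.\<close>

lemma plift_pull:
  assumes G: "plift B P r v G" and \<phi>: "simplicial_map S B \<phi>"
  shows "plift S P r (\<lambda>n x. v n (\<phi> n x)) {(n, x, y). x \<in> cells S n \<and> (n, \<phi> n x, y) \<in> G}"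
  unfolding plift_def using plift_cells[OF G] plift_act[OF G] plift_unique[OF G]
  by (auto simp: smap_act[OF \<phi>] act_cells[OF smap_dom[OF \<phi>]])

text \<open>Attaches \<open>S\<close> to the domain of \<open>G\<close> along \<open>\<phi>\<close>.
  Over old cells the two lifts agree by \<open>sub\<close>; over new ones \<open>\<phi>\<close> is
  injective, so no two values compete.\<close>

lemma plift_glue:
  assumes G: "plift B P r v G" and \<phi>: "simplicial_map S B \<phi>"
    and H: "plift S P r (\<lambda>n x. v n (\<phi> n x)) H"
    and sub: "\<And>n x y. x \<in> cells S n \<Longrightarrow> (n, \<phi> n x, y) \<in> G \<Longrightarrow> (n, x, y) \<in> H"
    and inj: "\<And>n x x'. x \<in> cells S n \<Longrightarrow> x' \<in> cells S n \<Longrightarrow> \<phi> n x = \<phi> n x' \<Longrightarrow>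
      \<phi> n x \<notin> gdom G n \<Longrightarrow> x = x'"
  shows "plift B P r v (G \<union> {(n, \<phi> n x, y) | n x y. (n, x, y) \<in> H})" (is "plift B P r v (G \<union> ?K)")
proof -
  have uniq1: "y = y'" if "(n, b, y) \<in> G" "(n, b, y') \<in> ?K" for n b y y'
  proof -
    from that(2) obtain x where x: "b = \<phi> n x" "(n, x, y') \<in> H" by auto
    then have "(n, x, y) \<in> H" using sub[of x n y] plift_cells(1)[OF H] that by auto
    then show ?thesis using plift_unique[OF H] x by blast
  qed
  have uniq2: "y = y'" if "(n, b, y) \<in> ?K" "(n, b, y') \<in> ?K" for n b y y'
  proof (cases "b \<in> gdom G n")
    case True
    then show ?thesis using uniq1 that unfolding gdom_def by blast
  next
    case False
    from that obtain x x' where x: "b = \<phi> n x" "(n, x, y) \<in> H" "b = \<phi> n x'" "(n, x', y') \<in> H"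
      by blast
    then have "x = x'" using inj[of x n x'] False plift_cells(1)[OF H] by auto
    then show ?thesis using plift_unique[OF H] x by blast
  qed
  have act: "(m, act B m n \<alpha> b, act P m n \<alpha> y) \<in> ?K" if "(n, b, y) \<in> ?K" "\<alpha> \<in> simp_op m n"
    for m n \<alpha> b y
  proof -
    from that obtain x where x: "b = \<phi> n x" "(n, x, y) \<in> H" by auto
    then have "(m, act S m n \<alpha> x, act P m n \<alpha> y) \<in> H" using plift_act[OF H] that by blast
    moreover have "act B m n \<alpha> b = \<phi> m (act S m n \<alpha> x)"
      using smap_act[OF \<phi> that(2)] plift_cells(1)[OF H x(2)] x by simp
    ultimately show ?thesis by auto
  qed
  have cells: "b \<in> cells B n \<and> y \<in> cells P n \<and> r n y = v n b" if "(n, b, y) \<in> ?K" for n b y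
    using that plift_cells[OF H] smap_cells[OF \<phi>] by auto
  show ?thesis
    unfolding plift_def
  proof (intro conjI allI impI ballI)
    fix n b y y' assume "(n, b, y) \<in> G \<union> ?K" "(n, b, y') \<in> G \<union> ?K"
    then show "y = y'" using uniq1 uniq2 plift_unique[OF G] by (metis (no_types, lifting) Un_iff)
  next
    fix m n b y \<alpha> assume "\<alpha> \<in> simp_op m n" "(n, b, y) \<in> G \<union> ?K"
    then show "(m, act B m n \<alpha> b, act P m n \<alpha> y) \<in> G \<union> ?K"
      using act plift_act[OF G] by (metis (no_types, lifting) Un_iff)
  next
    fix n b y assume "(n, b, y) \<in> G \<union> ?K"
    then show "b \<in> cells B n" "y \<in> cells P n" "r n y = v n b"
      using cells[of n b y] plift_cells[OF G, of n b y] by (metis (no_types, lifting) Un_iff)+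
  qed
qed

text \<open>The lifting property of \<open>D \<subseteq> B\<close> against \<open>r\<close>, for the fixed base map \<open>v\<close>.\<close>

definition extends ::
  "'b sset \<Rightarrow> (nat \<Rightarrow> 'b set) \<Rightarrow> 'p sset \<Rightarrow> ('p, 't) smap \<Rightarrow> ('b, 't) smap \<Rightarrow> bool" where
  "extends B D P r v \<longleftrightarrow> (\<forall>G. plift B P r v G \<longrightarrow> gdom G = D \<longrightarrow>
     (\<exists>G'. plift B P r v G' \<and> G \<subseteq> G' \<and> gdom G' = cells B))"

lemma plift_total:
  assumes "plift B P r v G" "gdom G = cells B" "simplicial_set B" "simplicial_set P"
  obtains w where "simplicial_map B P w" "\<And>n b. b \<in> cells B n \<Longrightarrow> (n, b, w n b) \<in> G"
proof -
  have "B\<lparr>cells := gdom G\<rparr> = B" using assms(2) by simp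
  then show thesis
    using that[of "\<lambda>n b. THE y. (n, b, y) \<in> G"] plift_smap[OF assms(1,3,4)] plift_the[OF assms(1)]
    by (simp add: assms(2))
qed

lemma extendsD:
  assumes ext: "extends B D P r v" and B: "simplicial_set B" and D: "subcomplex B D"
    and u: "simplicial_map (B\<lparr>cells := D\<rparr>) P u" and ru: "\<And>n b. b \<in> D n \<Longrightarrow> r n (u n b) = v n b"
  obtains w where "simplicial_map B P w" "\<And>n b. b \<in> D n \<Longrightarrow> w n b = u n b"
    "\<And>n b. b \<in> cells B n \<Longrightarrow> r n (w n b) = v n b"
proof -
  have G: "plift B P r v (graph_of D u)"
    using ru by (intro plift_graph_of[OF D u])
  obtain G' where G': "plift B P r v G'" "graph_of D u \<subseteq> G'" "gdom G' = cells B"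
    using ext[unfolded extends_def, rule_format, OF G gdom_graph_of] by blast
  obtain w where w: "simplicial_map B P w" "\<And>n b. b \<in> cells B n \<Longrightarrow> (n, b, w n b) \<in> G'"
    using plift_total[OF G'(1,3) B smap_cod[OF u]] by blast
  have "w n b = u n b" if "b \<in> D n" for n b
  proof -
    have "(n, b, u n b) \<in> G'" using that G'(2) by (auto simp: graph_of_def)
    moreover have "b \<in> cells B n" using D that by (auto simp: subcomplex_def)
    ultimately show ?thesis using w(2) plift_unique[OF G'(1)] by blast
  qed
  then show thesis using that w plift_cells(3)[OF G'(1)] by blast
qed

lemma extends_cong:
  assumes "\<And>n b. b \<in> cells B n \<Longrightarrow> v n b = v' n b"
  shows "extends B D P r v = extends B D P r v'"
proof -
  have "plift B P r v G \<longleftrightarrow> plift B P r v' G" for G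
    using assms by (auto simp: plift_def)
  then show ?thesis by (simp add: extends_def)
qed

text \<open>Lifting problems for Kan fibrations are posed for maps; here they enter the language of
  graphs, and \<open>extendsD\<close> leads back.\<close>

lemma extendsI:
  assumes B: "simplicial_set B" and P: "simplicial_set P"
    and lift: "\<And>u. simplicial_map (B\<lparr>cells := D\<rparr>) P u \<Longrightarrow> (\<And>n b. b \<in> D n \<Longrightarrow> r n (u n b) = v n b) \<Longrightarrow>
      \<exists>w. simplicial_map B P w \<and> (\<forall>n. \<forall>b\<in>D n. w n b = u n b) \<and> (\<forall>n. \<forall>b\<in>cells B n. r n (w n b) = v n b)"
  shows "extends B D P r v"
  unfolding extends_def
proof (intro allI impI)
  fix G assume G: "plift B P r v G" and dom: "gdom G = D"
  let ?u = "\<lambda>n b. THE y. (n, b, y) \<in> G"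
  have uG: "(n, b, ?u n b) \<in> G" if "b \<in> D n" for n b
    using plift_the[OF G] that dom by simp
  obtain w where w: "simplicial_map B P w" "\<And>n b. b \<in> D n \<Longrightarrow> w n b = ?u n b"
    "\<And>n b. b \<in> cells B n \<Longrightarrow> r n (w n b) = v n b"
    using lift[of ?u] plift_smap[OF G B P] plift_cells(3)[OF G uG] dom by auto
  have "subcomplex B (cells B)" using B by (auto simp: subcomplex_def act_cells)
  then have "plift B P r v (graph_of (cells B) w)"
    using w(1,3) by (intro plift_graph_of) simp_all
  moreover have "G \<subseteq> graph_of (cells B) w"
  proof clarify
    fix n b y assume y: "(n, b, y) \<in> G"
    then have "b \<in> D n" using gdomI[OF y] dom by simp
    then show "(n, b, y) \<in> graph_of (cells B) w"
      using w(2) plift_cells(1)[OF G y] plift_the_eq[OF G y] by (simp add: graph_of_def)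
  qed
  ultimately show "\<exists>G'. plift B P r v G' \<and> G \<subseteq> G' \<and> gdom G' = cells B"
    using gdom_graph_of by blast
qed

lemma kan_smap: "kan_fibration X Y p \<Longrightarrow> simplicial_map X Y p"
  by (simp add: kan_fibration_def)

lemma kan_extends_horn:
  assumes r: "kan_fibration P T r" and n: "n \<ge> 1" "k \<le> n" and v: "simplicial_map (std_simplex n) T v"
  shows "extends (std_simplex n) (cells (horn n k)) P r v"
proof (rule extendsI[OF std_simplex_simplicial_set smap_dom[OF kan_smap[OF r]]])
  fix u assume "simplicial_map ((std_simplex n)\<lparr>cells := cells (horn n k)\<rparr>) P u"
    and ru: "\<And>m \<alpha>. \<alpha> \<in> cells (horn n k) m \<Longrightarrow> r m (u m \<alpha>) = v m \<alpha>"
  then have u: "simplicial_map (horn n k) P u" by (simp add: horn_eq)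
  have "eq_smap (horn n k) (r \<circ>\<^sub>s u) (v \<circ>\<^sub>s (\<lambda>m \<alpha>. \<alpha>))"
    unfolding eq_smap_def scomp_def using ru by blast
  moreover have "has_lifting (horn n k) (std_simplex n) (\<lambda>m \<alpha>. \<alpha>) P T r"
    using r n by (simp add: kan_fibration_def)
  ultimately obtain w where "simplicial_map (std_simplex n) P w"
      "eq_smap (horn n k) (w \<circ>\<^sub>s (\<lambda>m \<alpha>. \<alpha>)) u" "eq_smap (std_simplex n) (r \<circ>\<^sub>s w) v"
    unfolding has_lifting_def using u v by blast
  then show "\<exists>w. simplicial_map (std_simplex n) P w \<and> (\<forall>m. \<forall>\<alpha>\<in>cells (horn n k) m. w m \<alpha> = u m \<alpha>) \<and>
      (\<forall>m. \<forall>\<alpha>\<in>cells (std_simplex n) m. r m (w m \<alpha>) = v m \<alpha>)"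
    unfolding eq_smap_def scomp_def by blast
qed

subsection \<open>Extension cell by cell\<close>

lemma plift_chain_Union:
  assumes "C \<noteq> {}" and chain: "\<And>G H. G \<in> C \<Longrightarrow> H \<in> C \<Longrightarrow> G \<subseteq> H \<or> H \<subseteq> G"
    and G: "\<And>G. G \<in> C \<Longrightarrow> plift B P r v G"
  shows "plift B P r v (\<Union>C)"
  unfolding plift_def
proof (intro conjI allI impI ballI)
  fix n b y assume "(n, b, y) \<in> \<Union>C"
  then show "b \<in> cells B n" "y \<in> cells P n" "r n y = v n b"
    using plift_cells[OF G] by blast+
next
  fix m n b y \<alpha> assume "\<alpha> \<in> simp_op m n" "(n, b, y) \<in> \<Union>C"
  then show "(m, act B m n \<alpha> b, act P m n \<alpha> y) \<in> \<Union>C"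
    using plift_act[OF G] by blast
next
  fix n b y y' assume "(n, b, y) \<in> \<Union>C" "(n, b, y') \<in> \<Union>C"
  then obtain H where "H \<in> C" "(n, b, y) \<in> H" "(n, b, y') \<in> H"
    using chain by blast
  then show "y = y'" using plift_unique[OF G] by blast
qed

text \<open>A cell of minimal dimension outside a subcomplex is nondegenerate with its boundary inside.\<close>

lemma minimal_cell:
  assumes B: "simplicial_set B" and C: "subcomplex B C" and b: "b \<in> cells B n" "b \<notin> C n"
    and min: "\<And>m. m < n \<Longrightarrow> cells B m \<subseteq> C m"
  shows minimal_cell_boundary:
      "\<alpha> \<in> simp_op m n \<Longrightarrow> act B m n \<alpha> b \<in> C m \<longleftrightarrow> \<alpha> \<in> boundary n m"
    and minimal_cell_inj: "\<alpha> \<in> simp_op m n \<Longrightarrow> \<beta> \<in> simp_op m n \<Longrightarrow>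
      act B m n \<alpha> b = act B m n \<beta> b \<Longrightarrow> act B m n \<alpha> b \<notin> C m \<Longrightarrow> \<alpha> = \<beta>"
proof -
  have C_act: "act B m k \<alpha> x \<in> C m" if "\<alpha> \<in> simp_op m k" "x \<in> C k" for m k \<alpha> x
    using C that by (auto simp: subcomplex_def)
  have in_C: "act B m n \<alpha> b \<in> C m" if \<alpha>: "\<alpha> \<in> simp_op m n" and i: "i \<le> n" "i \<notin> \<alpha> ` {..m}" for m \<alpha> i
  proof -
    obtain k \<delta> \<sigma> where *: "k < n" "\<delta> \<in> simp_op k n" "\<sigma> \<in> simp_op m k" "\<alpha> = compose {..m} \<delta> \<sigma>"
      using simp_op_factor_coface[OF \<alpha> i] .
    have "act B k n \<delta> b \<in> C k"
      using min[OF *(1)] act_cells[OF B *(2) b(1)] by blast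
    then show ?thesis
      using C_act[OF *(3)] act_act[OF B *(2,3) b(1)] *(4) by metis
  qed
  have not_C: "i \<in> \<alpha> ` {..m}" if "act B m n \<alpha> b \<notin> C m" "\<alpha> \<in> simp_op m n" "i \<le> n" for m \<alpha> i
    using in_C that by blast
  have sect: "act B n n (compose {..n} \<beta> \<delta>) b = b"
    if "\<alpha> \<in> simp_op m n" "\<beta> \<in> simp_op m n" "\<delta> \<in> simp_op n m" "compose {..n} \<alpha> \<delta> = id_op n"
      "act B m n \<alpha> b = act B m n \<beta> b" for m \<alpha> \<beta> \<delta>
    using act_act[OF B that(1,3) b(1)] act_act[OF B that(2,3) b(1)] that(4,5) act_id[OF B b(1)]
    by simp
  show "act B m n \<alpha> b \<in> C m \<longleftrightarrow> \<alpha> \<in> boundary n m" if \<alpha>: "\<alpha> \<in> simp_op m n" for m \<alpha>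
  proof
    assume in_Cm: "act B m n \<alpha> b \<in> C m"
    show "\<alpha> \<in> boundary n m"
    proof (rule ccontr)
      assume "\<alpha> \<notin> boundary n m"
      then have surj: "\<And>i. i \<le> n \<Longrightarrow> i \<in> \<alpha> ` {..m}"
        using \<alpha> unfolding boundary_def by blast
      \<comment> \<open>A section of the surjection recovers \<open>b\<close> from its restriction,
        which would put \<open>b\<close> itself into \<open>C\<close>.\<close>
      obtain \<delta> where \<delta>: "\<delta> \<in> simp_op n m" "compose {..n} \<alpha> \<delta> = id_op n"
        by (rule simp_op_section[OF \<alpha> surj le0])
      have "act B n m \<delta> (act B m n \<alpha> b) = b"
        using act_act[OF B \<alpha> \<delta>(1) b(1)] \<delta>(2) act_id[OF B b(1)] by simp
      then show False using C_act[OF \<delta>(1) in_Cm] b(2) by simp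
    qed
  qed (use in_C[OF \<alpha>] in \<open>auto simp: boundary_def\<close>)
  show "\<alpha> = \<beta>" if \<alpha>: "\<alpha> \<in> simp_op m n" and \<beta>: "\<beta> \<in> simp_op m n"
    and eq: "act B m n \<alpha> b = act B m n \<beta> b" and nC: "act B m n \<alpha> b \<notin> C m" for m \<alpha> \<beta>
  proof (rule simp_op_eqI[OF \<alpha> \<beta>])
    fix x assume x: "x \<le> m"
    obtain \<delta> where \<delta>: "\<delta> \<in> simp_op n m" "compose {..n} \<alpha> \<delta> = id_op n" "\<delta> (\<alpha> x) = x"
      using simp_op_section[OF \<alpha> not_C[OF nC \<alpha>] x] by blast
    \<comment> \<open>Both operators act alike on \<open>b\<close>, so
      \<open>compose {..n} \<beta> \<delta>\<close> fixes \<open>b\<close>; as \<open>b\<close> is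
      outside \<open>C\<close>, this operator misses no vertex. The section passes through
      \<open>x\<close>, whence the values at \<open>x\<close> agree.\<close>
    have "compose {..n} \<beta> \<delta> = id_op n"
    proof (rule simp_op_surj_id[OF compose_simp_op[OF \<beta> \<delta>(1)]])
      fix i assume "i \<le> n"
      moreover have "act B n n (compose {..n} \<beta> \<delta>) b \<notin> C n"
        using sect[OF \<alpha> \<beta> \<delta>(1,2) eq] b(2) by simp
      ultimately show "i \<in> compose {..n} \<beta> \<delta> ` {..n}"
        using not_C compose_simp_op[OF \<beta> \<delta>(1)] by blast
    qed
    then have "compose {..n} \<beta> \<delta> (\<alpha> x) = \<alpha> x"
      using simp_op_le[OF \<alpha> x] by simp
    then show "\<alpha> x = \<beta> x"
      using simp_op_le[OF \<alpha> x] \<delta>(3) by simp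
  qed
qed

text \<open>The pushout-product of \<open>K \<subseteq> J\<close> with
  \<open>A \<subseteq> B\<close> is built from those of \<open>K \<subseteq> J\<close> with boundary
  inclusions, one for each cell attached to \<open>A\<close>. Zorn's lemma replaces an induction
  over skeleta: if a maximal partial lift were not total, a cell of least dimension could still be
  attached.\<close>

theorem cell_extension:
  assumes J: "simplicial_set J" and K: "subcomplex J K" and B: "simplicial_set B" and A: "subcomplex B A"
    and fill: "\<And>n b. b \<in> cells B n \<Longrightarrow>
      extends (sprod J (std_simplex n)) (\<lambda>m. K m \<times> simp_op m n \<union> cells J m \<times> boundary n m) P r
        (\<lambda>m x. v m (fst x, act B m n (snd x) b))"
  shows "extends (sprod J B) (\<lambda>n. K n \<times> cells B n \<union> cells J n \<times> A n) P r v"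
  unfolding extends_def
proof (intro allI impI)
  fix G0 assume G0: "plift (sprod J B) P r v G0"
    and dom0: "gdom G0 = (\<lambda>n. K n \<times> cells B n \<union> cells J n \<times> A n)"
  have A_act: "act B m n \<alpha> b \<in> A m" if "\<alpha> \<in> simp_op m n" "b \<in> A n" for m n \<alpha> b
    using A that by (auto simp: subcomplex_def)
  have A_cells: "b \<in> cells B n" if "b \<in> A n" for b n
    using A that by (auto simp: subcomplex_def)
  \<comment> \<open>\<open>full G\<close> is the largest subcomplex \<open>C\<close> such that
    \<open>G\<close> is defined on all of \<open>cells J \<times> C\<close>. The last clause of
    \<open>good\<close> keeps the domain equal to \<open>K \<times> B\<close> together with
    \<open>J \<times> full G\<close>, so progress is measured by cells of \<open>B\<close>
    alone.\<close>
  define full where "full G n = {b \<in> cells B n. \<forall>m. \<forall>\<alpha>\<in>simp_op m n. \<forall>j\<in>cells J m.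
      (j, act B m n \<alpha> b) \<in> gdom G m}" for G :: "(nat \<times> ('a \<times> 'b) \<times> 'c) set" and n
  define good where "good G \<longleftrightarrow> plift (sprod J B) P r v G \<and> G0 \<subseteq> G \<and>
      (\<forall>n j b. (j, b) \<in> gdom G n \<longrightarrow> j \<in> K n \<or> b \<in> full G n)" for G
  have full_mono: "full G n \<subseteq> full H n" if "G \<subseteq> H" for G H n
    using that unfolding full_def gdom_def by blast
  have full_sub: "subcomplex B (full G)" for G
    unfolding subcomplex_def
  proof (intro conjI allI ballI)
    fix m n \<alpha> b assume \<alpha>: "\<alpha> \<in> simp_op m n" and b: "b \<in> full G n"
    then have bc: "b \<in> cells B n" by (simp add: full_def)
    show "act B m n \<alpha> b \<in> full G m"
      unfolding full_def mem_Collect_eq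
    proof (intro conjI allI ballI)
      fix k \<beta> j assume \<beta>: "\<beta> \<in> simp_op k m" and "j \<in> cells J k"
      then have "(j, act B k n (compose {..k} \<alpha> \<beta>) b) \<in> gdom G k"
        using b compose_simp_op[OF \<alpha> \<beta>] by (simp add: full_def)
      then show "(j, act B k m \<beta> (act B m n \<alpha> b)) \<in> gdom G k"
        using act_act[OF B \<alpha> \<beta> bc] by simp
    qed (use act_cells[OF B \<alpha> bc] in simp)
  qed (auto simp: full_def)
  have "good G0"
    unfolding good_def
  proof (intro conjI allI impI)
    fix n j b assume "(j, b) \<in> gdom G0 n"
    then have "j \<in> K n \<or> b \<in> A n" by (auto simp: dom0)
    moreover have "b \<in> full G0 n" if "b \<in> A n"
      using that A_act A_cells by (auto simp: full_def dom0)
    ultimately show "j \<in> K n \<or> b \<in> full G0 n" by blast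
  qed (use G0 in auto)
  moreover have "good (\<Union>C)" if C: "C \<noteq> {}" "subset.chain {G. good G} C" for C
  proof -
    have gC: "good G" if "G \<in> C" for G
      using C(2) that unfolding subset.chain_def by blast
    have "plift (sprod J B) P r v (\<Union>C)"
    proof (rule plift_chain_Union[OF C(1)])
      fix G H assume "G \<in> C" "H \<in> C"
      then show "G \<subseteq> H \<or> H \<subseteq> G" using C(2) unfolding subset_chain_def by blast
    qed (use gC good_def in blast)
    moreover have "G0 \<subseteq> \<Union>C" using C(1) gC unfolding good_def by blast
    moreover have "j \<in> K n \<or> b \<in> full (\<Union>C) n" if "(j, b) \<in> gdom (\<Union>C) n" for n j b
    proof -
      obtain G where "G \<in> C" "(j, b) \<in> gdom G n" using \<open>(j, b) \<in> gdom (\<Union>C) n\<close>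
        by (auto simp: gdom_def)
      then show ?thesis using gC full_mono[of G "\<Union>C"] unfolding good_def by blast
    qed
    ultimately show ?thesis unfolding good_def by blast
  qed
  ultimately obtain G where G: "good G" and max: "\<And>H. good H \<Longrightarrow> G \<subseteq> H \<Longrightarrow> H = G"
    using subset_Zorn_nonempty[of "{G. good G}"] by blast
  have pG: "plift (sprod J B) P r v G" and G0G: "G0 \<subseteq> G"
    and domG: "\<And>n j b. (j, b) \<in> gdom G n \<Longrightarrow> j \<in> K n \<or> b \<in> full G n"
    using G by (auto simp: good_def)
  have all_full: "cells B n \<subseteq> full G n" for n
  proof (rule ccontr)
    assume "\<not> cells B n \<subseteq> full G n"
    then obtain n where n: "\<not> cells B n \<subseteq> full G n" and min: "\<And>m. m < n \<Longrightarrow> cells B m \<subseteq> full G m"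
      using exists_least_iff[of "\<lambda>n. \<not> cells B n \<subseteq> full G n"] by blast
    then obtain b where b: "b \<in> cells B n" "b \<notin> full G n" by blast
    have bd: "act B m n \<alpha> b \<in> full G m \<longleftrightarrow> \<alpha> \<in> boundary n m" if "\<alpha> \<in> simp_op m n" for m \<alpha>
      using min that by (intro minimal_cell_boundary[OF B full_sub b])
    have inj: "\<alpha> = \<beta>" if "\<alpha> \<in> simp_op m n" "\<beta> \<in> simp_op m n"
      "act B m n \<alpha> b = act B m n \<beta> b" "act B m n \<alpha> b \<notin> full G m" for m \<alpha> \<beta>
      using min that by (intro minimal_cell_inj[OF B full_sub b])
    let ?S = "sprod J (std_simplex n)"
    define \<phi> :: "nat \<Rightarrow> 'a \<times> (nat \<Rightarrow> nat) \<Rightarrow> 'a \<times> 'b"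
      where "\<phi> = (\<lambda>m x. (fst x, act B m n (snd x) b))"
    have \<phi>: "simplicial_map ?S (sprod J B) \<phi>"
      using sprod_simplicial_set[OF J B] sprod_simplicial_set[OF J std_simplex_simplicial_set] B b(1)
      by (auto simp: simplicial_map_def \<phi>_def act_cells act_act)
    define Gb where "Gb = {(m, x, y). x \<in> cells ?S m \<and> (m, \<phi> m x, y) \<in> G}"
    have pGb: "plift ?S P r (\<lambda>m x. v m (\<phi> m x)) Gb"
      unfolding Gb_def by (rule plift_pull[OF pG \<phi>])
    \<comment> \<open>Over \<open>b\<close> the lift is prescribed exactly on the pushout-product
      that \<open>fill\<close> extends: by minimality of \<open>n\<close> the boundary is full, and
      no interior cell is.\<close>
    have dom_iff: "(j, act B m n \<alpha> b) \<in> gdom G m \<longleftrightarrow> j \<in> K m \<or> \<alpha> \<in> boundary n m"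
      if "j \<in> cells J m" "\<alpha> \<in> simp_op m n" for m j \<alpha>
    proof
      assume "(j, act B m n \<alpha> b) \<in> gdom G m"
      then show "j \<in> K m \<or> \<alpha> \<in> boundary n m" using domG bd[OF that(2)] by blast
    next
      have bc: "act B m n \<alpha> b \<in> cells B m" using act_cells[OF B that(2) b(1)] .
      assume "j \<in> K m \<or> \<alpha> \<in> boundary n m"
      then show "(j, act B m n \<alpha> b) \<in> gdom G m"
      proof
        assume "j \<in> K m"
        then have "(j, act B m n \<alpha> b) \<in> gdom G0 m" using bc by (simp add: dom0)
        then show ?thesis using G0G by (auto simp: gdom_def)
      next
        assume "\<alpha> \<in> boundary n m"
        then have "act B m n \<alpha> b \<in> full G m" using bd[OF that(2)] by simp
        then have "(j, act B m m (id_op m) (act B m n \<alpha> b)) \<in> gdom G m"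
          using that(1) unfolding full_def by (auto simp del: restrict_apply)
        then show ?thesis using act_id[OF B bc] by simp
      qed
    qed
    have gdom_Gb: "gdom Gb m = {x \<in> cells ?S m. \<phi> m x \<in> gdom G m}" for m
      by (auto simp: gdom_def Gb_def)
    have "gdom Gb = (\<lambda>m. K m \<times> simp_op m n \<union> cells J m \<times> boundary n m)"
    proof (intro ext set_eqI)
      fix m and x :: "'a \<times> (nat \<Rightarrow> nat)"
      obtain j \<alpha> where x: "x = (j, \<alpha>)" by (cases x)
      show "x \<in> gdom Gb m \<longleftrightarrow> x \<in> K m \<times> simp_op m n \<union> cells J m \<times> boundary n m"
        using dom_iff[of j m \<alpha>] K
        by (auto simp: gdom_Gb x \<phi>_def subcomplex_def boundary_def)
    qed
    then obtain H where H: "plift ?S P r (\<lambda>m x. v m (\<phi> m x)) H" "Gb \<subseteq> H" "gdom H = cells ?S"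
      using fill[OF b(1), unfolded extends_def] pGb unfolding \<phi>_def by auto
    define G' where "G' = G \<union> {(m, \<phi> m x, y) | m x y. (m, x, y) \<in> H}"
    have "plift (sprod J B) P r v G'"
      unfolding G'_def
    proof (rule plift_glue[OF pG \<phi> H(1)])
      fix m x x' assume x: "x \<in> cells ?S m" "x' \<in> cells ?S m" and eq: "\<phi> m x = \<phi> m x'"
        and nd: "\<phi> m x \<notin> gdom G m"
      have "act B m n (snd x) b \<notin> full G m"
        using nd x bd[of "snd x" m] dom_iff[of "fst x" m "snd x"] by (auto simp: \<phi>_def)
      then show "x = x'"
        using x eq inj[of "snd x" m "snd x'"] by (auto simp: \<phi>_def)
    qed (use H(2) Gb_def in auto)
    moreover have dH: "(j, act B m n \<alpha> b) \<in> gdom G' m" if "j \<in> cells J m" "\<alpha> \<in> simp_op m n" for j m \<alpha>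
    proof -
      have "(j, \<alpha>) \<in> gdom H m" using that H(3) by simp
      then obtain y where "(m, (j, \<alpha>), y) \<in> H" by (auto simp: gdom_def)
      then have "(m, \<phi> m (j, \<alpha>), y) \<in> G'" unfolding G'_def by blast
      then show ?thesis by (auto simp: gdom_def \<phi>_def)
    qed
    moreover have "j \<in> K m \<or> c \<in> full G' m" if "(j, c) \<in> gdom G' m" for m j c
    proof (cases "(j, c) \<in> gdom G m")
      case True
      moreover have "G \<subseteq> G'" by (simp add: G'_def)
      ultimately show ?thesis using domG full_mono by blast
    next
      case False
      moreover obtain y where "(m, (j, c), y) \<in> G'"
        using \<open>(j, c) \<in> gdom G' m\<close> by (auto simp: gdom_def)
      ultimately obtain x where x: "(m, x, y) \<in> H" "(j, c) = \<phi> m x"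
        unfolding G'_def gdom_def by blast
      define \<alpha> where "\<alpha> = snd x"
      have \<alpha>: "\<alpha> \<in> simp_op m n" "c = act B m n \<alpha> b"
        using plift_cells(1)[OF H(1) x(1)] x(2) by (auto simp: \<phi>_def \<alpha>_def)
      have "b \<in> full G' n" using dH b(1) by (simp add: full_def)
      then show ?thesis using full_sub[of G'] \<alpha> by (auto simp: subcomplex_def)
    qed
    ultimately have "good G'" using G0G by (auto simp: good_def G'_def)
    then have "G' = G" using max by (auto simp: G'_def)
    then show False using dH b by (auto simp: full_def)
  qed
  have "gdom G n = cells (sprod J B) n" for n
  proof (intro equalityI subsetI)
    fix x assume "x \<in> gdom G n"
    then show "x \<in> cells (sprod J B) n" using plift_cells(1)[OF pG] unfolding gdom_def by blast
  next
    fix x assume "x \<in> cells (sprod J B) n"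
    then obtain j b where x: "x = (j, b)" "j \<in> cells J n" "b \<in> cells B n" by auto
    then have "b \<in> full G n" using all_full by auto
    then have "(j, act B n n (id_op n) b) \<in> gdom G n"
      using x(2) unfolding full_def by (auto simp del: restrict_apply)
    then show "x \<in> gdom G n" using x act_id[OF B] by simp
  qed
  then show "\<exists>G'. plift (sprod J B) P r v G' \<and> G0 \<subseteq> G' \<and> gdom G' = cells (sprod J B)"
    using pG G0G by blast
qed

text \<open>The case of \<open>cell_extension\<close> in which \<open>J\<close> is a point and
  \<open>K\<close>, \<open>A\<close> are empty. Most of the work is the passage across the
  isomorphism between a simplicial set and its product with a point.\<close>

theorem cellwise_lift:
  assumes v: "simplicial_map B T v" and P: "simplicial_set P"
    and fill: "\<And>n b. b \<in> cells B n \<Longrightarrow>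
      extends (std_simplex n) (boundary n) P r (\<lambda>m \<alpha>. act T m n \<alpha> (v n b))"
  obtains w where "simplicial_map B P w" "\<And>n b. b \<in> cells B n \<Longrightarrow> r n (w n b) = v n b"
proof -
  let ?pt = "std_simplex 0"
  have B: "simplicial_set B" using smap_dom[OF v] .
  have pt: "j = const_op 0 m" if "j \<in> simp_op m 0" for j m
    using that by (intro simp_op_eqI[OF that const_op_simp_op]) (auto dest: simp_op_le)
  have empty: "subcomplex X (\<lambda>n. {})" for X :: "'z sset" by (simp add: subcomplex_def)
  have "extends (sprod ?pt (std_simplex n)) (\<lambda>m. {} \<times> simp_op m n \<union> cells ?pt m \<times> boundary n m) P r
      (\<lambda>m x. v m (act B m n (snd x) b))" if b: "b \<in> cells B n" for n b
    unfolding extends_def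
  proof (intro allI impI)
    let ?S = "sprod ?pt (std_simplex n)" and ?v = "\<lambda>m \<alpha>. v m (act B m n \<alpha> b)"
    fix G assume G: "plift ?S P r (\<lambda>m x. ?v m (snd x)) G"
      and dom: "gdom G = (\<lambda>m. {} \<times> simp_op m n \<union> cells ?pt m \<times> boundary n m)"
    let ?G1 = "{(m, \<alpha>, y). \<alpha> \<in> cells (std_simplex n) m \<and> (m, (const_op 0 m, \<alpha>), y) \<in> G}"
    have S: "simplicial_set ?S" by (intro sprod_simplicial_set std_simplex_simplicial_set)
    have "simplicial_map (std_simplex n) ?S (\<lambda>m \<alpha>. (const_op 0 m, \<alpha>))"
      using S by (auto simp: simplicial_map_def)
    from plift_pull[OF G this] have G1: "plift (std_simplex n) P r ?v ?G1" by simp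
    have "gdom ?G1 = boundary n"
    proof (intro ext set_eqI)
      fix m \<alpha>
      have "\<alpha> \<in> gdom ?G1 m \<longleftrightarrow> \<alpha> \<in> simp_op m n \<and> (const_op 0 m, \<alpha>) \<in> gdom G m"
        by (auto simp: gdom_def)
      then show "\<alpha> \<in> gdom ?G1 m \<longleftrightarrow> \<alpha> \<in> boundary n m"
        by (auto simp: dom boundary_def)
    qed
    moreover have "extends (std_simplex n) (boundary n) P r ?v"
      using fill[OF b] smap_act[OF v _ b]
      by (subst extends_cong[of _ _ "\<lambda>m \<alpha>. act T m n \<alpha> (v n b)"]) auto
    ultimately obtain H where H: "plift (std_simplex n) P r ?v H" "?G1 \<subseteq> H"
      "gdom H = cells (std_simplex n)"
      using G1 unfolding extends_def by blast
    let ?G2 = "{(m, x, y). x \<in> cells ?S m \<and> (m, snd x, y) \<in> H}"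
    have "simplicial_map ?S (std_simplex n) (\<lambda>m x. snd x)"
      by (rule sprod_snd) simp_all
    from plift_pull[OF H(1) this] have G2: "plift ?S P r (\<lambda>m x. ?v m (snd x)) ?G2" .
    have "G \<subseteq> ?G2"
    proof clarify
      fix m j \<alpha> y assume y: "(m, (j, \<alpha>), y) \<in> G"
      have x: "j \<in> simp_op m 0" "\<alpha> \<in> simp_op m n" using plift_cells(1)[OF G y] by auto
      then have "(m, \<alpha>, y) \<in> ?G1" using y pt by auto
      then show "(j, \<alpha>) \<in> cells ?S m \<and> (m, snd (j, \<alpha>), y) \<in> H" using x H(2) by auto
    qed
    moreover have "gdom ?G2 m = cells ?S m" for m
    proof -
      have "gdom ?G2 m = {x \<in> cells ?S m. snd x \<in> gdom H m}" by (auto simp: gdom_def)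
      also have "\<dots> = cells ?S m" unfolding H(3) by auto
      finally show ?thesis .
    qed
    ultimately show "\<exists>G'. plift ?S P r (\<lambda>m x. ?v m (snd x)) G' \<and> G \<subseteq> G' \<and> gdom G' = cells ?S"
      using G2 by blast
  qed
  then have "extends (sprod ?pt B) (\<lambda>n. {} \<times> cells B n \<union> cells ?pt n \<times> {}) P r (\<lambda>m x. v m (snd x))"
    by (intro cell_extension[OF std_simplex_simplicial_set empty B empty]) simp
  then have ext: "extends (sprod ?pt B) (\<lambda>n. {}) P r (\<lambda>m x. v m (snd x))" by simp
  have ptB: "simplicial_set (sprod ?pt B)" by (intro sprod_simplicial_set std_simplex_simplicial_set B)
  have "simplicial_map ((sprod ?pt B)\<lparr>cells := \<lambda>n. {}\<rparr>) P (\<lambda>n x. undefined)"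
    using P subcomplex_simplicial_set[OF ptB empty] by (simp add: simplicial_map_def)
  from extendsD[OF ext ptB empty this] obtain w where w: "simplicial_map (sprod ?pt B) P w"
    "\<And>n x. x \<in> cells (sprod ?pt B) n \<Longrightarrow> r n (w n x) = v n (snd x)" by auto
  have "simplicial_map B (sprod ?pt B) (\<lambda>n b. (const_op 0 n, b))"
    using B ptB by (auto simp: simplicial_map_def)
  from smap_comp[OF this w(1)] show thesis
    using w(2) by (intro that[of "\<lambda>n b. w n (const_op 0 n, b)"]) (auto simp: scomp_def)
qed


subsection \<open>Prisms\<close>

abbreviation interval :: "(nat \<Rightarrow> nat) sset" where
  "interval \<equiv> std_simplex 1"

abbreviation prism :: "nat \<Rightarrow> ((nat \<Rightarrow> nat) \<times> (nat \<Rightarrow> nat)) sset" where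
  "prism n \<equiv> sprod interval (std_simplex n)"

lemma prism_simplicial_set: "simplicial_set (prism n)"
  by (intro sprod_simplicial_set std_simplex_simplicial_set)

text \<open>The \<open>j\<close>-th maximal simplex of the prism is \<open>(0,0) < \<dots> < (0,j) < (1,j) < \<dots> < (1,n)\<close>.\<close>

definition shuffle1 :: "nat \<Rightarrow> nat \<Rightarrow> nat \<Rightarrow> nat" where
  "shuffle1 n j = (\<lambda>i\<in>{..Suc n}. if i \<le> j then 0 else 1)"

definition shuffle2 :: "nat \<Rightarrow> nat \<Rightarrow> nat \<Rightarrow> nat" where
  "shuffle2 n j = (\<lambda>i\<in>{..Suc n}. if i \<le> j then i else i - 1)"

definition shuffle :: "nat \<Rightarrow> nat \<Rightarrow> (nat \<Rightarrow> nat, (nat \<Rightarrow> nat) \<times> (nat \<Rightarrow> nat)) smap" where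
  "shuffle n j = (\<lambda>m \<gamma>. (compose {..m} (shuffle1 n j) \<gamma>, compose {..m} (shuffle2 n j) \<gamma>))"

text \<open>Vertexwise test for lying in the \<open>j\<close>-th maximal simplex; in this form the
  intersections of different maximal simplices can be computed.\<close>

definition in_shuffle :: "nat \<Rightarrow> nat \<Rightarrow> (nat \<Rightarrow> nat) \<times> (nat \<Rightarrow> nat) \<Rightarrow> bool" where
  "in_shuffle j m x \<longleftrightarrow> (\<forall>i\<le>m. (fst x i = 0 \<longrightarrow> snd x i \<le> j) \<and> (fst x i \<noteq> 0 \<longrightarrow> j \<le> snd x i))"

lemma shuffle1_simp_op [simp]: "shuffle1 n j \<in> simp_op (Suc n) 1"
  unfolding shuffle1_def by (rule simp_opI) auto

lemma shuffle2_simp_op [simp]: "j \<le> n \<Longrightarrow> shuffle2 n j \<in> simp_op (Suc n) n"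
  unfolding shuffle2_def by (rule simp_opI) auto

lemma shuffle_smap: "j \<le> n \<Longrightarrow> simplicial_map (std_simplex (Suc n)) (prism n) (shuffle n j)"
  unfolding simplicial_map_def
  by (auto simp: shuffle_def prism_simplicial_set simp_op_compose_assoc simp del: One_nat_def
      intro!: compose_simp_op[of _ "Suc n"])

lemma shuffle_apply:
  assumes "\<gamma> \<in> simp_op m (Suc n)" "i \<le> m"
  shows "fst (shuffle n j m \<gamma>) i = (if \<gamma> i \<le> j then 0 else 1)"
    "snd (shuffle n j m \<gamma>) i = (if \<gamma> i \<le> j then \<gamma> i else \<gamma> i - 1)"
  using assms simp_op_le[OF assms] by (simp_all add: shuffle_def shuffle1_def shuffle2_def)

text \<open>The coordinates of the vertex with index \<open>i\<close> of the chain add up to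
  \<open>i\<close>, so the sum inverts the shuffle. The same sum is the witness
  \<open>\<gamma>\<close> in \<open>in_shuffle_iff\<close>.\<close>

lemma shuffle_inj:
  assumes "\<gamma> \<in> simp_op m (Suc n)" "\<gamma>' \<in> simp_op m (Suc n)" "shuffle n j m \<gamma> = shuffle n j m \<gamma>'"
  shows "\<gamma> = \<gamma>'"
proof (rule simp_op_eqI[OF assms(1,2)])
  fix i assume i: "i \<le> m"
  have "\<delta> i = fst (shuffle n j m \<delta>) i + snd (shuffle n j m \<delta>) i" if "\<delta> \<in> simp_op m (Suc n)" for \<delta>
    using shuffle_apply[OF that i, of j] by auto
  then show "\<gamma> i = \<gamma>' i" using assms by metis
qed

lemma in_shuffle_iff:
  assumes "j \<le> n" "x \<in> cells (prism n) m"
  shows "in_shuffle j m x \<longleftrightarrow> x \<in> shuffle n j m ` simp_op m (Suc n)"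
proof
  obtain \<beta> \<alpha> where x: "x = (\<beta>, \<alpha>)" and \<beta>: "\<beta> \<in> simp_op m 1" and \<alpha>: "\<alpha> \<in> simp_op m n"
    using assms(2) by auto
  assume sh: "in_shuffle j m x"
  define \<gamma> where "\<gamma> = (\<lambda>i\<in>{..m}. \<alpha> i + \<beta> i)"
  have \<gamma>: "\<gamma> \<in> simp_op m (Suc n)"
    unfolding \<gamma>_def
  proof (rule simp_opI)
    fix i assume "i \<le> m"
    then show "\<alpha> i + \<beta> i \<le> Suc n" using simp_op_le[OF \<alpha>, of i] simp_op_le[OF \<beta>, of i] by simp
  next
    fix i k assume "i \<le> k" "k \<le> m"
    then show "\<alpha> i + \<beta> i \<le> \<alpha> k + \<beta> k"
      using simp_op_mono[OF \<alpha>, of i k] simp_op_mono[OF \<beta>, of i k] by simp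
  qed
  have in_prism: "shuffle n j m \<gamma> \<in> cells (prism n) m"
    using smap_cells[OF shuffle_smap[OF assms(1)], of \<gamma> m] \<gamma> by simp
  have b1: "\<beta> i \<le> 1" if "i \<le> m" for i using simp_op_le[OF \<beta> that] .
  have eq: "fst (shuffle n j m \<gamma>) i = \<beta> i \<and> snd (shuffle n j m \<gamma>) i = \<alpha> i" if "i \<le> m" for i
    using shuffle_apply[OF \<gamma> that, of j] sh b1[OF that] that
    by (cases "\<beta> i") (auto simp: in_shuffle_def x \<gamma>_def)
  have "fst (shuffle n j m \<gamma>) = \<beta>" "snd (shuffle n j m \<gamma>) = \<alpha>"
    using in_prism eq by (auto intro!: simp_op_eqI[OF _ \<beta>] simp_op_eqI[OF _ \<alpha>])
  then have "x = shuffle n j m \<gamma>" by (simp add: x prod_eq_iff)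
  then show "x \<in> shuffle n j m ` simp_op m (Suc n)" using \<gamma> by blast
next
  assume "x \<in> shuffle n j m ` simp_op m (Suc n)"
  then obtain \<gamma> where \<gamma>: "\<gamma> \<in> simp_op m (Suc n)" and x: "x = shuffle n j m \<gamma>" by blast
  show "in_shuffle j m x"
    unfolding in_shuffle_def x
  proof (intro allI impI)
    fix i assume i: "i \<le> m"
    show "(fst (shuffle n j m \<gamma>) i = 0 \<longrightarrow> snd (shuffle n j m \<gamma>) i \<le> j) \<and>
      (fst (shuffle n j m \<gamma>) i \<noteq> 0 \<longrightarrow> j \<le> snd (shuffle n j m \<gamma>) i)"
      using shuffle_apply[OF \<gamma> i, of j] by auto
  qed
qed

text \<open>The turning point \<open>j\<close> is the second coordinate of the last vertex on the
  lower end; without such a vertex the cell lies on the upper end and \<open>j = 0\<close>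
  works.\<close>

lemma ex_shuffle:
  assumes "x \<in> cells (prism n) m"
  obtains j where "j \<le> n" "in_shuffle j m x"
proof -
  obtain \<beta> \<alpha> where x: "x = (\<beta>, \<alpha>)" and \<beta>: "\<beta> \<in> simp_op m 1" and \<alpha>: "\<alpha> \<in> simp_op m n"
    using assms by auto
  let ?Z = "{i \<in> {..m}. \<beta> i = 0}"
  show thesis
  proof (cases "?Z = {}")
    case True
    then have "in_shuffle 0 m x" by (auto simp: in_shuffle_def x)
    then show thesis using that[of 0] by simp
  next
    case False
    define k where "k = Max ?Z"
    have k: "k \<le> m" "\<beta> k = 0" "\<And>i. i \<le> m \<Longrightarrow> \<beta> i = 0 \<Longrightarrow> i \<le> k"
      using Max_in[of ?Z] False by (auto simp: k_def)
    have "k \<le> i" if "i \<le> m" "\<beta> i \<noteq> 0" for i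
      using simp_op_mono[OF \<beta>, of i k] k that by (cases "k \<le> i") auto
    then have "in_shuffle (\<alpha> k) m x"
      unfolding in_shuffle_def using k simp_op_mono[OF \<alpha>] by (auto simp: x)
    then show thesis using that[of "\<alpha> k"] simp_op_le[OF \<alpha> k(1)] by blast
  qed
qed

section \<open>Filling the open prism\<close>

definition open_prism :: "nat \<Rightarrow> nat \<Rightarrow> nat \<Rightarrow> ((nat \<Rightarrow> nat) \<times> (nat \<Rightarrow> nat)) set" where
  "open_prism \<epsilon> n m = {const_op \<epsilon> m} \<times> simp_op m n \<union> simp_op m 1 \<times> boundary n m"

text \<open>The attached maximal simplices are recorded as a set, because the two ends force
  opposite orders of attachment.\<close>

definition prism_stage :: "nat \<Rightarrow> nat \<Rightarrow> nat set \<Rightarrow> nat \<Rightarrow> ((nat \<Rightarrow> nat) \<times> (nat \<Rightarrow> nat)) set" where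
  "prism_stage \<epsilon> n S m = open_prism \<epsilon> n m \<union> {x \<in> cells (prism n) m. \<exists>i\<in>S. in_shuffle i m x}"

text \<open>Membership becomes a condition on the vertices visited by \<open>\<gamma>\<close>: lying
  in the end, in a wall, or in a simplex attached earlier. Avoiding the vertex \<open>l\<close> of
  the base means missing one index, except for \<open>l = j\<close>, over which both
  \<open>j\<close> and \<open>Suc j\<close> lie.\<close>

lemma shuffle_in_stage_iff:
  assumes \<epsilon>: "\<epsilon> \<le> 1" and j: "j \<le> n" and \<gamma>: "\<gamma> \<in> simp_op m (Suc n)"
  shows "shuffle n j m \<gamma> \<in> prism_stage \<epsilon> n S m \<longleftrightarrow>
     (\<forall>x\<le>m. \<gamma> x \<le> j \<longleftrightarrow> \<epsilon> = 0) \<or>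
     (\<exists>l\<le>n. \<forall>x\<le>m. (\<gamma> x \<le> j \<longrightarrow> \<gamma> x \<noteq> l) \<and> (j < \<gamma> x \<longrightarrow> \<gamma> x \<noteq> Suc l)) \<or>
     (\<exists>i\<in>S. \<forall>x\<le>m. (\<gamma> x \<le> j \<longrightarrow> \<gamma> x \<le> i) \<and> (j < \<gamma> x \<longrightarrow> i < \<gamma> x))"
proof -
  let ?s = "shuffle n j m \<gamma>"
  note ap = shuffle_apply[OF \<gamma>, of _ j]
  have in_prism: "?s \<in> cells (prism n) m"
    using smap_cells[OF shuffle_smap[OF j], of \<gamma> m] \<gamma> by simp
  then have s: "fst ?s \<in> simp_op m 1" "snd ?s \<in> simp_op m n" by auto
  have "fst ?s = const_op \<epsilon> m \<longleftrightarrow> (\<forall>x\<le>m. fst ?s x = \<epsilon>)"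
    using simp_op_eqI[OF s(1) const_op_simp_op[OF \<epsilon>]] by auto
  also have "\<dots> \<longleftrightarrow> (\<forall>x\<le>m. \<gamma> x \<le> j \<longleftrightarrow> \<epsilon> = 0)"
    using ap(1) \<epsilon> by auto
  finally have 1: "fst ?s = const_op \<epsilon> m \<longleftrightarrow> (\<forall>x\<le>m. \<gamma> x \<le> j \<longleftrightarrow> \<epsilon> = 0)" .
  have "snd ?s \<in> boundary n m \<longleftrightarrow> (\<exists>l\<le>n. \<forall>x\<le>m. snd ?s x \<noteq> l)"
    using s by (auto simp: boundary_def)
  also have "\<dots> \<longleftrightarrow> (\<exists>l\<le>n. \<forall>x\<le>m. (\<gamma> x \<le> j \<longrightarrow> \<gamma> x \<noteq> l) \<and> (j < \<gamma> x \<longrightarrow> \<gamma> x \<noteq> Suc l))"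
    using ap(2) by (intro ex_cong conj_cong refl all_cong) auto
  finally have 2: "snd ?s \<in> boundary n m \<longleftrightarrow>
    (\<exists>l\<le>n. \<forall>x\<le>m. (\<gamma> x \<le> j \<longrightarrow> \<gamma> x \<noteq> l) \<and> (j < \<gamma> x \<longrightarrow> \<gamma> x \<noteq> Suc l))" .
  have 3: "in_shuffle i m ?s \<longleftrightarrow> (\<forall>x\<le>m. (\<gamma> x \<le> j \<longrightarrow> \<gamma> x \<le> i) \<and> (j < \<gamma> x \<longrightarrow> i < \<gamma> x))" for i
    unfolding in_shuffle_def using ap by (intro all_cong) auto
  have "?s \<in> prism_stage \<epsilon> n S m \<longleftrightarrow>
      fst ?s = const_op \<epsilon> m \<or> snd ?s \<in> boundary n m \<or> (\<exists>i\<in>S. in_shuffle i m ?s)"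
    using in_prism s unfolding prism_stage_def open_prism_def
    by (cases ?s) auto
  then show ?thesis unfolding 1 2 3 .
qed

text \<open>A missing vertex \<open>Suc j\<close> puts the cell into the next maximal simplex, or
  into the end \<open>0\<close> if \<open>j = n\<close>; any other missing vertex except
  \<open>j\<close> puts it into a wall. So of all faces only the one opposite \<open>j\<close> is
  absent.\<close>

lemma shuffle_in_stage_horn0:
  assumes j: "j \<le> n" and \<gamma>: "\<gamma> \<in> simp_op m (Suc n)"
  shows "shuffle n j m \<gamma> \<in> prism_stage 0 n {Suc j..n} m \<longleftrightarrow> \<gamma> \<in> cells (horn (Suc n) j) m"
proof -
  have h: "\<gamma> \<in> cells (horn (Suc n) j) m \<longleftrightarrow> (\<exists>l\<le>Suc n. l \<noteq> j \<and> (\<forall>x\<le>m. \<gamma> x \<noteq> l))"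
    using \<gamma> by auto
  show ?thesis
    unfolding shuffle_in_stage_iff[OF le0 j \<gamma>] h
  proof (intro iffI, elim disjE exE bexE conjE)
    assume "\<forall>x\<le>m. (\<gamma> x \<le> j) = ((0::nat) = 0)"
    then show "\<exists>l\<le>Suc n. l \<noteq> j \<and> (\<forall>x\<le>m. \<gamma> x \<noteq> l)"
      using j by (intro exI[of _ "Suc n"]) auto
  next
    fix l assume l: "l \<le> n" "\<forall>x\<le>m. (\<gamma> x \<le> j \<longrightarrow> \<gamma> x \<noteq> l) \<and> (j < \<gamma> x \<longrightarrow> \<gamma> x \<noteq> Suc l)"
    have "\<gamma> x \<noteq> (if l < j then l else Suc l)" if "x \<le> m" for x
      using l(2)[rule_format, OF that] by (cases "\<gamma> x \<le> j") auto
    then show "\<exists>l\<le>Suc n. l \<noteq> j \<and> (\<forall>x\<le>m. \<gamma> x \<noteq> l)"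
      using j l(1) by (intro exI[of _ "if l < j then l else Suc l"]) auto
  next
    fix i assume "i \<in> {Suc j..n}" "\<forall>x\<le>m. (\<gamma> x \<le> j \<longrightarrow> \<gamma> x \<le> i) \<and> (j < \<gamma> x \<longrightarrow> i < \<gamma> x)"
    then show "\<exists>l\<le>Suc n. l \<noteq> j \<and> (\<forall>x\<le>m. \<gamma> x \<noteq> l)"
      using j by (intro exI[of _ "Suc j"]) fastforce
  next
    assume "\<exists>l\<le>Suc n. l \<noteq> j \<and> (\<forall>x\<le>m. \<gamma> x \<noteq> l)"
    then obtain l where l: "l \<le> Suc n" "l \<noteq> j" "\<And>x. x \<le> m \<Longrightarrow> \<gamma> x \<noteq> l" by blast
    consider "l < j" | "l = Suc j" "j = n" | "l = Suc j" "j < n" | "Suc j < l"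
      using l j by linarith
    then show "(\<forall>x\<le>m. (\<gamma> x \<le> j) = ((0::nat) = 0)) \<or>
     (\<exists>l\<le>n. \<forall>x\<le>m. (\<gamma> x \<le> j \<longrightarrow> \<gamma> x \<noteq> l) \<and> (j < \<gamma> x \<longrightarrow> \<gamma> x \<noteq> Suc l)) \<or>
     (\<exists>i\<in>{Suc j..n}. \<forall>x\<le>m. (\<gamma> x \<le> j \<longrightarrow> \<gamma> x \<le> i) \<and> (j < \<gamma> x \<longrightarrow> i < \<gamma> x))"
    proof cases
      case 1
      then show ?thesis using l j by (intro disjI2 disjI1 exI[of _ l]) auto
    next
      case 2
      then have "\<gamma> x \<le> j" if "x \<le> m" for x
        using l(3)[OF that] simp_op_le[OF \<gamma> that] by simp
      then show ?thesis by simp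
    next
      case 3
      have "Suc j < \<gamma> x" if "x \<le> m" "j < \<gamma> x" for x
        using l(3)[OF that(1)] 3 that(2) by simp
      then show ?thesis using 3 by (intro disjI2 bexI[of _ "Suc j"]) auto
    next
      case 4
      then show ?thesis using l j by (intro disjI2 disjI1 exI[of _ "l - 1"]) auto
    qed
  qed
qed

text \<open>Mirror image of \<open>shuffle_in_stage_horn0\<close>: a missing vertex \<open>j\<close>
  leads to the preceding maximal simplex, or to the end \<open>1\<close> if \<open>j = 0\<close>, so
  the absent face is the one opposite \<open>Suc j\<close>.\<close>

lemma shuffle_in_stage_horn1:
  assumes j: "j \<le> n" and \<gamma>: "\<gamma> \<in> simp_op m (Suc n)"
  shows "shuffle n j m \<gamma> \<in> prism_stage 1 n {..<j} m \<longleftrightarrow> \<gamma> \<in> cells (horn (Suc n) (Suc j)) m"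
proof -
  have h: "\<gamma> \<in> cells (horn (Suc n) (Suc j)) m \<longleftrightarrow>
      (\<exists>l\<le>Suc n. l \<noteq> Suc j \<and> (\<forall>x\<le>m. \<gamma> x \<noteq> l))"
    using \<gamma> by auto
  show ?thesis
    unfolding shuffle_in_stage_iff[OF order_refl j \<gamma>] h
  proof (intro iffI, elim disjE exE bexE conjE)
    assume "\<forall>x\<le>m. (\<gamma> x \<le> j) = ((1::nat) = 0)"
    then show "\<exists>l\<le>Suc n. l \<noteq> Suc j \<and> (\<forall>x\<le>m. \<gamma> x \<noteq> l)"
      using j by (intro exI[of _ 0]) force
  next
    fix l assume l: "l \<le> n" "\<forall>x\<le>m. (\<gamma> x \<le> j \<longrightarrow> \<gamma> x \<noteq> l) \<and> (j < \<gamma> x \<longrightarrow> \<gamma> x \<noteq> Suc l)"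
    have "\<gamma> x \<noteq> (if l \<le> j then l else Suc l)" if "x \<le> m" for x
      using l(2)[rule_format, OF that] by (cases "\<gamma> x \<le> j") auto
    then show "\<exists>l\<le>Suc n. l \<noteq> Suc j \<and> (\<forall>x\<le>m. \<gamma> x \<noteq> l)"
      using j l(1) by (intro exI[of _ "if l \<le> j then l else Suc l"]) auto
  next
    fix i assume "i \<in> {..<j}" "\<forall>x\<le>m. (\<gamma> x \<le> j \<longrightarrow> \<gamma> x \<le> i) \<and> (j < \<gamma> x \<longrightarrow> i < \<gamma> x)"
    then show "\<exists>l\<le>Suc n. l \<noteq> Suc j \<and> (\<forall>x\<le>m. \<gamma> x \<noteq> l)"
      using j by (intro exI[of _ j]) fastforce
  next
    assume "\<exists>l\<le>Suc n. l \<noteq> Suc j \<and> (\<forall>x\<le>m. \<gamma> x \<noteq> l)"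
    then obtain l where l: "l \<le> Suc n" "l \<noteq> Suc j" "\<And>x. x \<le> m \<Longrightarrow> \<gamma> x \<noteq> l" by blast
    consider "l < j" | "l = j" "j = 0" | "l = j" "0 < j" | "Suc j < l"
      using l j by linarith
    then show "(\<forall>x\<le>m. (\<gamma> x \<le> j) = ((1::nat) = 0)) \<or>
     (\<exists>l\<le>n. \<forall>x\<le>m. (\<gamma> x \<le> j \<longrightarrow> \<gamma> x \<noteq> l) \<and> (j < \<gamma> x \<longrightarrow> \<gamma> x \<noteq> Suc l)) \<or>
     (\<exists>i\<in>{..<j}. \<forall>x\<le>m. (\<gamma> x \<le> j \<longrightarrow> \<gamma> x \<le> i) \<and> (j < \<gamma> x \<longrightarrow> i < \<gamma> x))"
    proof cases
      case 1
      then show ?thesis using l j by (intro disjI2 disjI1 exI[of _ l]) auto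
    next
      case 2
      then show ?thesis using l(3) by simp
    next
      case 3
      have "\<gamma> x \<le> j - 1" if "x \<le> m" "\<gamma> x \<le> j" for x
        using l(3)[OF that(1)] 3 that(2) by simp
      then show ?thesis using 3 by (intro disjI2 bexI[of _ "j - 1"]) auto
    next
      case 4
      then show ?thesis using l j by (intro disjI2 disjI1 exI[of _ "l - 1"]) auto
    qed
  qed
qed

lemma prism_attach:
  assumes r: "kan_fibration P T r" and v: "simplicial_map (prism n) T v"
    and j: "j \<le> n" and k: "k \<le> Suc n"
    and iff: "\<And>m \<gamma>. \<gamma> \<in> simp_op m (Suc n) \<Longrightarrow>
      shuffle n j m \<gamma> \<in> prism_stage \<epsilon> n S m \<longleftrightarrow> \<gamma> \<in> cells (horn (Suc n) k) m"
    and G: "plift (prism n) P r v G" and dom: "gdom G = prism_stage \<epsilon> n S"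
  obtains G' where "plift (prism n) P r v G'" "G \<subseteq> G'" "gdom G' = prism_stage \<epsilon> n (insert j S)"
proof -
  let ?S = "std_simplex (Suc n)" and ?\<phi> = "shuffle n j"
  note \<phi> = shuffle_smap[OF j]
  define Gb where "Gb = {(m, x, y). x \<in> cells ?S m \<and> (m, ?\<phi> m x, y) \<in> G}"
  have pGb: "plift ?S P r (\<lambda>m x. v m (?\<phi> m x)) Gb"
    unfolding Gb_def by (rule plift_pull[OF G \<phi>])
  have "gdom Gb = cells (horn (Suc n) k)"
  proof (intro ext set_eqI)
    fix m x
    have "x \<in> gdom Gb m \<longleftrightarrow> x \<in> cells ?S m \<and> ?\<phi> m x \<in> gdom G m"
      by (auto simp: gdom_def Gb_def)
    also have "\<dots> \<longleftrightarrow> x \<in> cells (horn (Suc n) k) m"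
      using iff[of x m] by (auto simp: dom)
    finally show "x \<in> gdom Gb m \<longleftrightarrow> x \<in> cells (horn (Suc n) k) m" .
  qed
  moreover have "extends ?S (cells (horn (Suc n) k)) P r (\<lambda>m x. v m (?\<phi> m x))"
    using smap_comp[OF \<phi> v] k by (intro kan_extends_horn[OF r]) (auto simp: scomp_def)
  ultimately obtain H where H: "plift ?S P r (\<lambda>m x. v m (?\<phi> m x)) H" "Gb \<subseteq> H" "gdom H = cells ?S"
    using pGb unfolding extends_def by blast
  let ?G' = "G \<union> {(m, ?\<phi> m x, y) | m x y. (m, x, y) \<in> H}"
  have "plift (prism n) P r v ?G'"
  proof (rule plift_glue[OF G \<phi> H(1)])
    fix m x y assume "x \<in> cells ?S m" "(m, ?\<phi> m x, y) \<in> G"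
    then show "(m, x, y) \<in> H" using H(2) by (auto simp: Gb_def)
  qed (auto dest: shuffle_inj)
  moreover have "gdom ?G' m = prism_stage \<epsilon> n (insert j S) m" for m
  proof -
    have "gdom ?G' m = gdom G m \<union> ?\<phi> m ` gdom H m" by (auto simp: gdom_def)
    also have "?\<phi> m ` gdom H m = {x \<in> cells (prism n) m. in_shuffle j m x}"
    proof -
      have "?\<phi> m ` simp_op m (Suc n) \<subseteq> cells (prism n) m"
        using smap_cells[OF \<phi>, of _ m] by (intro image_subsetI) (metis std_simplex_cells)
      then show ?thesis
        using in_shuffle_iff[OF j, of _ m] by (auto simp: H(3) simp del: sprod_cells)
    qed
    finally show ?thesis by (auto simp: dom prism_stage_def)
  qed
  ultimately show thesis using that[of ?G'] by (auto simp: fun_eq_iff)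
qed

text \<open>The open prism inclusion is anodyne: each maximal simplex, attached in the right order,
  meets the earlier stage in a horn.\<close>

theorem kan_extends_prism:
  assumes r: "kan_fibration P T r" and v: "simplicial_map (prism n) T v" and \<epsilon>: "\<epsilon> \<le> 1"
  shows "extends (prism n) (open_prism \<epsilon> n) P r v"
  unfolding extends_def
proof (intro allI impI)
  fix G assume G: "plift (prism n) P r v G" and dom: "gdom G = open_prism \<epsilon> n"
  have stage0: "open_prism \<epsilon> n = prism_stage \<epsilon> n {}"
    by (auto simp: prism_stage_def)
  have "\<exists>G'. plift (prism n) P r v G' \<and> G \<subseteq> G' \<and> gdom G' = prism_stage \<epsilon> n {..n}"
  proof (cases "\<epsilon> = 0")
    case True
    \<comment> \<open>Attachment starts at the maximal simplex with a whole face in the given end.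
      For the end \<open>0\<close> this is the one with \<open>j = n\<close>, so the set grows
      downwards; for the end \<open>1\<close> it is \<open>j = 0\<close>, and the set grows
      upwards.\<close>
    have "\<exists>G'. plift (prism n) P r v G' \<and> G \<subseteq> G' \<and> gdom G' = prism_stage 0 n {Suc n - k..n}"
      if "k \<le> Suc n" for k
      using that
    proof (induction k)
      case 0
      then show ?case using G dom stage0 True by auto
    next
      case (Suc k)
      then obtain G' where G': "plift (prism n) P r v G'" "G \<subseteq> G'"
          "gdom G' = prism_stage 0 n {Suc n - k..n}" by auto
      have eq: "Suc n - k = Suc (n - k)" using Suc by simp
      obtain G'' where "plift (prism n) P r v G''" "G' \<subseteq> G''"
          "gdom G'' = prism_stage 0 n (insert (n - k) {Suc n - k..n})"
        using shuffle_in_stage_horn0[of "n - k" n] G'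
        by (auto simp: eq intro: prism_attach[OF r v, of "n - k" "n - k" 0 "{Suc n - k..n}" G'])
      moreover have "insert (n - k) {Suc n - k..n} = {Suc n - Suc k..n}" using Suc by auto
      ultimately show ?case using G'(2) by (metis subset_trans)
    qed
    from this[of "Suc n"] show ?thesis using True by (simp add: atLeast0AtMost)
  next
    case False
    then have \<epsilon>1: "\<epsilon> = 1" using \<epsilon> by simp
    have "\<exists>G'. plift (prism n) P r v G' \<and> G \<subseteq> G' \<and> gdom G' = prism_stage 1 n {..<k}"
      if "k \<le> Suc n" for k
      using that
    proof (induction k)
      case 0
      then show ?case using G dom stage0 \<epsilon>1 by auto
    next
      case (Suc k)
      then obtain G' where G': "plift (prism n) P r v G'" "G \<subseteq> G'"
          "gdom G' = prism_stage 1 n {..<k}" by auto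
      obtain G'' where "plift (prism n) P r v G''" "G' \<subseteq> G''"
          "gdom G'' = prism_stage 1 n (insert k {..<k})"
        using shuffle_in_stage_horn1[of k n] G' Suc
        by (auto intro: prism_attach[OF r v, of k "Suc k" 1 "{..<k}" G'])
      then show ?case using G'(2) unfolding lessThan_Suc by (metis subset_trans)
    qed
    from this[of "Suc n"] show ?thesis using \<epsilon>1 by (simp add: lessThan_Suc_atMost)
  qed
  moreover have "prism_stage \<epsilon> n {..n} m = cells (prism n) m" for m
  proof (intro equalityI subsetI)
    fix x assume "x \<in> cells (prism n) m"
    then show "x \<in> prism_stage \<epsilon> n {..n} m"
      using ex_shuffle[of x n m] unfolding prism_stage_def by blast
  next
    fix x assume "x \<in> prism_stage \<epsilon> n {..n} m"
    then show "x \<in> cells (prism n) m"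
      using const_op_simp_op[OF \<epsilon>] by (auto simp: prism_stage_def open_prism_def boundary_def)
  qed
  ultimately show "\<exists>G'. plift (prism n) P r v G' \<and> G \<subseteq> G' \<and> gdom G' = cells (prism n)"
    by (metis ext)
qed

text \<open>Homotopy lifting relative to \<open>A\<close>: \<open>cell_extension\<close> with the
  interval for \<open>J\<close> and one end for \<open>K\<close>. An empty \<open>A\<close> gives
  plain homotopy lifting.\<close>

theorem kan_extends_cylinder:
  assumes r: "kan_fibration P T r" and B: "simplicial_set B" and A: "subcomplex B A"
    and v: "simplicial_map (sprod interval B) T v" and \<epsilon>: "\<epsilon> \<le> 1"
  shows "extends (sprod interval B)
    (\<lambda>n. {const_op \<epsilon> n} \<times> cells B n \<union> simp_op n 1 \<times> A n) P r v"
proof -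
  have K: "subcomplex interval (\<lambda>n. {const_op \<epsilon> n})"
    using const_op_simp_op[OF \<epsilon>] \<epsilon> by (auto simp: subcomplex_def)
  have "extends (prism n) (\<lambda>m. {const_op \<epsilon> m} \<times> simp_op m n \<union> cells interval m \<times> boundary n m) P r
      (\<lambda>m x. v m (fst x, act B m n (snd x) b))" if b: "b \<in> cells B n" for n b
  proof -
    have "simplicial_map (prism n) (sprod interval B) (\<lambda>m x. (fst x, act B m n (snd x) b))"
      using B b by (auto simp: simplicial_map_def prism_simplicial_set sprod_simplicial_set
          act_cells act_act)
    from smap_comp[OF this v] show ?thesis
      using kan_extends_prism[OF r _ \<epsilon>] by (simp add: open_prism_def[abs_def] scomp_def)
  qed
  from cell_extension[OF std_simplex_simplicial_set K B A this] show ?thesis by simp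
qed

subsection \<open>Pushout-products of horns with the interval\<close>

lemma cylinder_subcomplex:
  assumes "simplicial_set J" "subcomplex J K" "simplicial_set B" "subcomplex B A"
  shows "subcomplex (sprod J B) (\<lambda>n. K n \<times> cells B n \<union> cells J n \<times> A n)"
  using assms by (auto simp: subcomplex_def subset_iff act_cells)

lemma ends_subcomplex:
  assumes "S \<subseteq> {..1}"
  shows "subcomplex interval (\<lambda>n. (\<lambda>\<epsilon>. const_op \<epsilon> n) ` S)"
  using assms const_op_simp_op[of _ 1] by (auto simp: subcomplex_def)

text \<open>Both ends are prescribed here, so open prisms do not apply directly. A second interval
  factor helps: the data are pulled back along \<open>R\<close>, extended over the larger cylinder
  from one end, and restricted to the other. This is what makes \<open>path_end\<close> a
  fibration.\<close>

lemma kan_lift_horn_cylinder: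
  fixes D :: "nat \<Rightarrow> ((nat \<Rightarrow> nat) \<times> (nat \<Rightarrow> nat)) set"
  assumes r: "kan_fibration P T r" and n: "1 \<le> n" and k: "k \<le> n"
    and v: "simplicial_map (prism n) T v"
    and D: "\<And>m. D m = {const_op 0 m, const_op 1 m} \<times> simp_op m n \<union> simp_op m 1 \<times> cells (horn n k) m"
    and u: "simplicial_map ((prism n)\<lparr>cells := D\<rparr>) P u"
    and ru: "\<And>m x. x \<in> D m \<Longrightarrow> r m (u m x) = v m x"
  obtains w where "simplicial_map (prism n) P w" "\<And>m x. x \<in> D m \<Longrightarrow> w m x = u m x"
    "\<And>m x. x \<in> cells (prism n) m \<Longrightarrow> r m (w m x) = v m x"
proof -
  \<comment> \<open>The horn inclusion is a retract of its pushout-product with an end of the interval; \<open>f\<close> is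
    the deformation of the simplex exhibiting this.\<close>
  obtain \<epsilon> l :: nat and f :: "nat \<Rightarrow> nat \<Rightarrow> nat" where \<epsilon>: "\<epsilon> \<le> 1"
    and f_mono: "\<And>s s' a a'. s \<le> s' \<Longrightarrow> a \<le> a' \<Longrightarrow> f s a \<le> f s' a'"
    and f_cases: "\<And>s a. f s a = a \<or> f s a = k" and f_id: "\<And>a. f (1 - \<epsilon>) a = a"
    and l: "l \<le> n" "l \<noteq> k" "\<And>a. f \<epsilon> a \<noteq> l"
  \<comment> \<open>Monotonicity in \<open>s\<close> fixes the direction. For \<open>k = 0\<close>
    the simplex grows out of its vertex \<open>0\<close>, and the starting image misses
    \<open>n\<close>; for \<open>k > 0\<close> it is pushed up by \<open>max a k\<close>, and the
    final image misses \<open>0\<close>.\<close>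
  proof (cases "k = 0")
    case True
    then show thesis using n by (intro that[of 0 "\<lambda>s a. if s = 0 then 0 else a" n]) auto
  next
    case False
    then show thesis using k by (intro that[of 1 "\<lambda>s a. if s = 0 then a else max a k" 0]) auto
  qed
  define \<rho> where "\<rho> m \<sigma> \<alpha> = (\<lambda>i\<in>{..m}. f (\<sigma> i) (\<alpha> i))" for m and \<sigma> \<alpha> :: "nat \<Rightarrow> nat"
  have \<rho>: "\<rho> m \<sigma> \<alpha> \<in> simp_op m n" if "\<sigma> \<in> simp_op m 1" "\<alpha> \<in> simp_op m n" for m \<sigma> \<alpha>
    unfolding \<rho>_def
  proof (rule simp_opI)
    fix i assume "i \<le> m"
    then show "f (\<sigma> i) (\<alpha> i) \<le> n"
      using f_cases[of "\<sigma> i" "\<alpha> i"] simp_op_le[OF that(2)] k by metis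
  next
    fix i j assume "i \<le> j" "j \<le> m"
    then show "f (\<sigma> i) (\<alpha> i) \<le> f (\<sigma> j) (\<alpha> j)"
      by (intro f_mono simp_op_mono[OF that(1)] simp_op_mono[OF that(2)])
  qed
  have \<rho>_act: "\<rho> m' (compose {..m'} \<sigma> \<theta>) (compose {..m'} \<alpha> \<theta>) = compose {..m'} (\<rho> m \<sigma> \<alpha>) \<theta>"
    if "\<theta> \<in> simp_op m' m" for m m' \<sigma> \<alpha> \<theta>
    using simp_op_le[OF that] by (auto simp: \<rho>_def compose_def fun_eq_iff)
  have \<rho>_id: "\<rho> m (const_op (1 - \<epsilon>) m) \<alpha> = \<alpha>" if "\<alpha> \<in> simp_op m n" for m \<alpha>
    using \<rho>[of "const_op (1 - \<epsilon>) m" m \<alpha>] that f_id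
    by (intro simp_op_eqI[of _ m n]) (auto simp: \<rho>_def)
  have \<rho>_end: "\<rho> m (const_op \<epsilon> m) \<alpha> \<in> cells (horn n k) m" if "\<alpha> \<in> simp_op m n" for m \<alpha>
    using \<rho>[OF const_op_simp_op[OF \<epsilon>] that] l by (auto simp: \<rho>_def)
  have \<rho>_horn: "\<rho> m \<sigma> \<alpha> \<in> cells (horn n k) m"
    if \<sigma>: "\<sigma> \<in> simp_op m 1" and \<alpha>: "\<alpha> \<in> cells (horn n k) m" for m \<sigma> \<alpha>
  proof -
    obtain j where j: "j \<le> n" "j \<noteq> k" "j \<notin> \<alpha> ` {..m}" using \<alpha> by auto
    have "f (\<sigma> i) (\<alpha> i) \<noteq> j" if "i \<le> m" for i
      using j that f_cases[of "\<sigma> i" "\<alpha> i"] by auto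
    then have "j \<notin> \<rho> m \<sigma> \<alpha> ` {..m}" by (auto simp: \<rho>_def)
    then show ?thesis using \<rho>[OF \<sigma>] \<alpha> j by auto
  qed
  define R :: "nat \<Rightarrow> (nat \<Rightarrow> nat) \<times> (nat \<Rightarrow> nat) \<times> (nat \<Rightarrow> nat) \<Rightarrow> (nat \<Rightarrow> nat) \<times> (nat \<Rightarrow> nat)"
    where "R = (\<lambda>m x. (fst (snd x), \<rho> m (fst x) (snd (snd x))))"
  let ?C = "sprod interval (prism n)"
  let ?D = "\<lambda>m. {const_op \<epsilon> m} \<times> cells (prism n) m \<union> simp_op m 1 \<times> D m"
  have C: "simplicial_set ?C" by (intro sprod_simplicial_set std_simplex_simplicial_set)
  have R: "simplicial_map ?C (prism n) R"
    using C prism_simplicial_set \<rho> by (auto simp: simplicial_map_def R_def \<rho>_act)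
  have Dsub: "subcomplex (prism n) D"
    using cylinder_subcomplex[OF std_simplex_simplicial_set ends_subcomplex[of "{0,1}"]
        std_simplex_simplicial_set horn_subcomplex[of n k]]
    by (simp add: D[abs_def])
  have Dsub': "subcomplex ?C ?D"
    using cylinder_subcomplex[OF std_simplex_simplicial_set ends_subcomplex[of "{\<epsilon>}"]
        prism_simplicial_set Dsub] \<epsilon> by simp
  \<comment> \<open>At the end \<open>\<epsilon>\<close> the deformation lands in the horn, because
    it misses \<open>l\<close>; the horn is preserved throughout, because only the vertex
    \<open>k\<close> is ever added to an image.\<close>
  have R_D: "R m x \<in> D m" if "x \<in> ?D m" for m x
    using that \<rho> \<rho>_end \<rho>_horn const_op_simp_op[OF \<epsilon>] by (auto simp: R_def D simp del: horn_cells)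
  have "simplicial_map (?C\<lparr>cells := ?D\<rparr>) ((prism n)\<lparr>cells := D\<rparr>) R"
    using R_D by (intro smap_restrict[OF R Dsub' Dsub])
  from smap_comp[OF this u] have uR: "simplicial_map (?C\<lparr>cells := ?D\<rparr>) P (u \<circ>\<^sub>s R)" .
  obtain w where w: "simplicial_map ?C P w" "\<And>m x. x \<in> ?D m \<Longrightarrow> w m x = (u \<circ>\<^sub>s R) m x"
    "\<And>m x. x \<in> cells ?C m \<Longrightarrow> r m (w m x) = (v \<circ>\<^sub>s R) m x"
    using extendsD[OF kan_extends_cylinder[OF r prism_simplicial_set Dsub smap_comp[OF R v] \<epsilon>] C Dsub' uR]
      ru R_D unfolding scomp_def by blast
  \<comment> \<open>At the end \<open>1 - \<epsilon>\<close> the map \<open>R\<close> is the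
    identity of the prism, so restricting \<open>w\<close> there solves the original
    problem.\<close>
  define c where "c m = const_op (1 - \<epsilon>) m" for m
  have c: "c m \<in> simp_op m 1" for m by (simp add: c_def)
  have c_act: "compose {..m'} (c m) \<theta> = c m'" if "\<theta> \<in> simp_op m' m" for m m' \<theta>
    using that by (simp add: c_def)
  have R_c: "R m (c m, x) = x" if "x \<in> cells (prism n) m" for m x
    using that \<rho>_id by (auto simp: R_def c_def)
  have "simplicial_map (prism n) ?C (\<lambda>m x. (c m, x))"
    using c C prism_simplicial_set by (auto simp: simplicial_map_def c_act)
  from smap_comp[OF this w(1)] have 1: "simplicial_map (prism n) P (\<lambda>m x. w m (c m, x))"
    by (simp add: scomp_def)
  have 2: "w m (c m, x) = u m x" if "x \<in> D m" for m x
  proof -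
    have "x \<in> cells (prism n) m" using Dsub that by (auto simp: subcomplex_def)
    then show ?thesis using w(2)[of "(c m, x)" m] that c R_c by (simp add: scomp_def)
  qed
  have 3: "r m (w m (c m, x)) = v m x" if "x \<in> cells (prism n) m" for m x
    using w(3)[of "(c m, x)" m] that c R_c[OF that] by (simp add: scomp_def)
  show thesis using that[OF 1 2 3] .
qed


subsection \<open>Lifting trivial cofibrations against fibrations over other cell types\<close>

lemma has_lifting_retract:
  assumes lift: "has_lifting A B i E Y p"
    and f: "simplicial_map E E' f" and g: "simplicial_map E' E g"
    and fg: "\<And>n y. y \<in> cells E' n \<Longrightarrow> f n (g n y) = y"
    and pg: "\<And>n y. y \<in> cells E' n \<Longrightarrow> p n (g n y) = p' n y"
    and p'f: "\<And>n x. x \<in> cells E n \<Longrightarrow> p' n (f n x) = p n x"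
    and i: "simplicial_map A B i"
  shows "has_lifting A B i E' Y p'"
  unfolding has_lifting_def
proof (intro allI impI, elim conjE)
  fix u v assume u: "simplicial_map A E' u" and v: "simplicial_map B Y v"
    and eq: "eq_smap A (p' \<circ>\<^sub>s u) (v \<circ>\<^sub>s i)"
  have "eq_smap A (p \<circ>\<^sub>s (g \<circ>\<^sub>s u)) (v \<circ>\<^sub>s i)"
    using eq pg smap_cells[OF u] by (simp add: eq_smap_def scomp_def)
  then obtain w where w: "simplicial_map B E w" "eq_smap A (w \<circ>\<^sub>s i) (g \<circ>\<^sub>s u)" "eq_smap B (p \<circ>\<^sub>s w) v"
    using lift smap_comp[OF u g] v unfolding has_lifting_def by blast
  have "eq_smap A ((f \<circ>\<^sub>s w) \<circ>\<^sub>s i) u"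
    using w(2) fg smap_cells[OF u] by (simp add: eq_smap_def scomp_def)
  moreover have "eq_smap B (p' \<circ>\<^sub>s (f \<circ>\<^sub>s w)) v"
    using w(3) p'f smap_cells[OF w(1)] by (simp add: eq_smap_def scomp_def)
  ultimately show "\<exists>w. simplicial_map B E' w \<and> eq_smap A (w \<circ>\<^sub>s i) u \<and> eq_smap B (p' \<circ>\<^sub>s w) v"
    using smap_comp[OF w(1) f] by blast
qed

text \<open>A total space with a foreign cell type is copied along \<open>f\<close> into the type
  used by \<open>trivial_cofibration\<close>. Injectivity in each dimension suffices, since cells of
  different dimensions may coincide as elements.\<close>

lemma trivial_cofibration_lifting:
  fixes A B Y :: "'a sset" and E :: "'e sset" and f :: "('e, 'a) smap"
  assumes i: "trivial_cofibration A B i" and p: "kan_fibration E Y p"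
    and inj: "\<And>n. inj_on (f n) (cells E n)"
  shows "has_lifting A B i E Y p"
proof -
  define g where "g = (\<lambda>n. inv_into (cells E n) (f n))"
  define E' where "E' = \<lparr>cells = (\<lambda>n. f n ` cells E n), act = (\<lambda>m n \<alpha> y. f m (act E m n \<alpha> (g n y)))\<rparr>"
  have gf: "g n (f n x) = x" if "x \<in> cells E n" for n x
    using that inj by (simp add: g_def)
  have E: "simplicial_set E" using p by (simp add: kan_fibration_def simplicial_map_def)
  have E': "simplicial_set E'"
    using E by (auto simp: simplicial_set_def E'_def gf)
  have f: "simplicial_map E E' f" and g: "simplicial_map E' E g"
    using E E' by (auto simp: simplicial_map_def E'_def gf act_cells)
  have fg: "f n (g n y) = y" if "y \<in> cells E' n" for n y
    using that by (auto simp: E'_def gf)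
  have "kan_fibration E' Y (p \<circ>\<^sub>s g)"
    unfolding kan_fibration_def
  proof (intro conjI allI impI)
    show "simplicial_map E' Y (p \<circ>\<^sub>s g)"
      using p by (intro smap_comp[OF g]) (simp add: kan_fibration_def)
    fix n k :: nat assume "1 \<le> n" "k \<le> n"
    then have "has_lifting (horn n k) (std_simplex n) (\<lambda>m \<alpha>. \<alpha>) E Y p"
      using p by (simp add: kan_fibration_def)
    then show "has_lifting (horn n k) (std_simplex n) (\<lambda>m \<alpha>. \<alpha>) E' Y (p \<circ>\<^sub>s g)"
      by (rule has_lifting_retract[OF _ f g fg])
        (auto simp: scomp_def gf simplicial_map_def)
  qed
  then have "has_lifting A B i E' Y (p \<circ>\<^sub>s g)"
    using i by (simp add: trivial_cofibration_def)
  moreover have "simplicial_map A B i" using i by (simp add: trivial_cofibration_def)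
  ultimately show ?thesis
    by (intro has_lifting_retract[of A B i E' Y "p \<circ>\<^sub>s g", OF _ g f gf]) (auto simp: scomp_def gf)
qed

text \<open>Iterated pairing; on lists of one length the length needs no code, and the common start
  value \<open>undefined\<close> does no harm.\<close>

lemma ex_inj_lists_of_length:
  assumes "infinite (UNIV :: 'a set)"
  obtains f :: "'a list \<Rightarrow> 'a" where "\<And>n. inj_on f {xs. length xs = n}"
proof -
  have "\<exists>g. bij_betw g ((UNIV :: 'a set) \<times> (UNIV :: 'a set)) (UNIV :: 'a set)"
    unfolding card_of_ordIso by (rule card_of_Times_same_infinite[OF assms])
  then obtain g :: "'a \<times> 'a \<Rightarrow> 'a" where g: "inj g"
    by (auto simp: bij_betw_def)
  define f where "f = (\<lambda>xs. foldr (\<lambda>x y. g (x, y)) xs undefined)"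
  have "xs = ys" if "length xs = length ys" "f xs = f ys" for xs ys
    using that by (induction rule: list_induct2) (auto simp: f_def dest: injD[OF g])
  then show thesis using that[of f] by (auto simp: inj_on_def)
qed


subsection \<open>A section that is a trivial cofibration is a deformation\<close>

text \<open>The fibrewise paths in \<open>P\<close> over \<open>X\<close> starting in the section \<open>i\<close>.\<close>

definition path_cell ::
  "'x sset \<Rightarrow> 'p sset \<Rightarrow> ('p, 'x) smap \<Rightarrow> ('x, 'p) smap \<Rightarrow> nat \<Rightarrow>
   ((nat \<Rightarrow> nat) \<times> (nat \<Rightarrow> nat), 'p) smap \<Rightarrow> bool" where
  "path_cell X P r i n h \<longleftrightarrow> simplicial_map (prism n) P h \<and>
     (\<forall>m x. x \<notin> cells (prism n) m \<longrightarrow> h m x = undefined) \<and>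
     (\<exists>b\<in>cells X n. \<forall>m. \<forall>\<alpha>\<in>simp_op m n. h m (const_op 0 m, \<alpha>) = i m (act X m n \<alpha> b) \<and>
        (\<forall>\<beta>\<in>simp_op m 1. r m (h m (\<beta>, \<alpha>)) = act X m n \<alpha> b))"

text \<open>Resetting to \<open>undefined\<close> off the prism keeps cells extensional, so that
  equality of functions is equality of simplicial maps and the action laws hold strictly.\<close>

definition path_act ::
  "nat \<Rightarrow> (nat \<Rightarrow> nat) \<Rightarrow> ((nat \<Rightarrow> nat) \<times> (nat \<Rightarrow> nat), 'p) smap \<Rightarrow>
   ((nat \<Rightarrow> nat) \<times> (nat \<Rightarrow> nat), 'p) smap" where
  "path_act n \<theta> h = (\<lambda>m x. if x \<in> cells (prism n) m then h m (fst x, compose {..m} \<theta> (snd x))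
     else undefined)"

definition path_sset :: "'x sset \<Rightarrow> 'p sset \<Rightarrow> ('p, 'x) smap \<Rightarrow> ('x, 'p) smap \<Rightarrow>
   (((nat \<Rightarrow> nat) \<times> (nat \<Rightarrow> nat), 'p) smap) sset" where
  "path_sset X P r i = \<lparr>cells = (\<lambda>n. {h. path_cell X P r i n h}), act = (\<lambda>m n. path_act m)\<rparr>"

definition path_end :: "(((nat \<Rightarrow> nat) \<times> (nat \<Rightarrow> nat), 'p) smap, 'p) smap" where
  "path_end = (\<lambda>n h. h n (const_op 1 n, id_op n))"

lemma path_sset_cells [simp]: "cells (path_sset X P r i) n = {h. path_cell X P r i n h}"
  by (simp add: path_sset_def)

lemma path_sset_act [simp]: "act (path_sset X P r i) m n \<theta> h = path_act m \<theta> h"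
  by (simp add: path_sset_def)

lemma path_act_apply:
  "\<beta> \<in> simp_op m 1 \<Longrightarrow> \<alpha> \<in> simp_op m n \<Longrightarrow> path_act n \<theta> h m (\<beta>, \<alpha>) = h m (\<beta>, compose {..m} \<theta> \<alpha>)"
  by (simp add: path_act_def)

lemma prism_reindex:
  "\<theta> \<in> simp_op n' n \<Longrightarrow>
    simplicial_map (prism n') (prism n) (\<lambda>m x. (fst x, compose {..m} \<theta> (snd x)))"
  by (auto simp: simplicial_map_def prism_simplicial_set simp_op_compose_assoc simp del: One_nat_def)

lemma smap_eq_on:
  "simplicial_map X Y f \<Longrightarrow> (\<And>n x. x \<in> cells X n \<Longrightarrow> g n x = f n x) \<Longrightarrow> simplicial_map X Y g"
  by (simp add: simplicial_map_def act_cells)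

text \<open>The base cell is only asserted to exist in \<open>path_cell\<close>; as the path is
  fibrewise, it is recovered by projecting the endpoint.\<close>

lemma path_cell_base:
  assumes X: "simplicial_set X" and h: "path_cell X P r i n h"
  shows "r n (path_end n h) \<in> cells X n"
    and "\<alpha> \<in> simp_op m n \<Longrightarrow> h m (const_op 0 m, \<alpha>) = i m (act X m n \<alpha> (r n (path_end n h)))"
    and "\<alpha> \<in> simp_op m n \<Longrightarrow> \<beta> \<in> simp_op m 1 \<Longrightarrow> r m (h m (\<beta>, \<alpha>)) = act X m n \<alpha> (r n (path_end n h))"
proof -
  obtain b where b: "b \<in> cells X n"
    "\<And>m \<alpha>. \<alpha> \<in> simp_op m n \<Longrightarrow> h m (const_op 0 m, \<alpha>) = i m (act X m n \<alpha> b)"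
    "\<And>m \<alpha> \<beta>. \<alpha> \<in> simp_op m n \<Longrightarrow> \<beta> \<in> simp_op m 1 \<Longrightarrow> r m (h m (\<beta>, \<alpha>)) = act X m n \<alpha> b"
    using h unfolding path_cell_def by blast
  have "r n (path_end n h) = b"
    using b(3)[OF id_op_simp_op const_op_simp_op[OF order_refl]] act_id[OF X b(1)]
    by (simp add: path_end_def)
  then show "r n (path_end n h) \<in> cells X n"
    "\<alpha> \<in> simp_op m n \<Longrightarrow> h m (const_op 0 m, \<alpha>) = i m (act X m n \<alpha> (r n (path_end n h)))"
    "\<alpha> \<in> simp_op m n \<Longrightarrow> \<beta> \<in> simp_op m 1 \<Longrightarrow> r m (h m (\<beta>, \<alpha>)) = act X m n \<alpha> (r n (path_end n h))"
    using b by simp_all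
qed

lemma path_cell_act:
  assumes X: "simplicial_set X" and h: "path_cell X P r i n h" and \<theta>: "\<theta> \<in> simp_op n' n"
  shows "path_cell X P r i n' (path_act n' \<theta> h)"
  unfolding path_cell_def
proof (intro conjI bexI[of _ "act X n' n \<theta> (r n (path_end n h))"] allI impI ballI)
  have "simplicial_map (prism n) P h" using h by (simp add: path_cell_def)
  from smap_comp[OF prism_reindex[OF \<theta>] this] show "simplicial_map (prism n') P (path_act n' \<theta> h)"
    by (rule smap_eq_on) (simp add: path_act_def scomp_def)
  note base = path_cell_base[OF X h]
  fix m \<alpha> assume \<alpha>: "\<alpha> \<in> simp_op m n'"
  note \<theta>\<alpha> = compose_simp_op[OF \<theta> \<alpha>]
  show "path_act n' \<theta> h m (const_op 0 m, \<alpha>) = i m (act X m n' \<alpha> (act X n' n \<theta> (r n (path_end n h))))"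
    using base(2)[OF \<theta>\<alpha>] act_act[OF X \<theta> \<alpha> base(1)] \<alpha> by (simp add: path_act_apply)
  fix \<beta> assume \<beta>: "\<beta> \<in> simp_op m 1"
  show "r m (path_act n' \<theta> h m (\<beta>, \<alpha>)) = act X m n' \<alpha> (act X n' n \<theta> (r n (path_end n h)))"
    using base(3)[OF \<theta>\<alpha> \<beta>] act_act[OF X \<theta> \<alpha> base(1)] \<alpha> \<beta> by (simp add: path_act_apply)
qed (use path_cell_base(1)[OF X h] act_cells[OF X \<theta>] in \<open>simp_all add: path_act_def\<close>)

lemma path_act_compose:
  assumes "\<alpha> \<in> simp_op m n" "\<beta> \<in> simp_op k m"
  shows "path_act k (compose {..k} \<alpha> \<beta>) h = path_act k \<beta> (path_act m \<alpha> h)"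
  using assms by (auto simp: path_act_def fun_eq_iff simp_op_compose_assoc)

lemma path_sset_simplicial_set:
  assumes X: "simplicial_set X"
  shows "simplicial_set (path_sset X P r i)"
proof -
  have "path_act n (id_op n) h = h" if "path_cell X P r i n h" for n h
    using that by (auto simp: path_act_def path_cell_def fun_eq_iff)
  then show ?thesis
    unfolding simplicial_set_def using path_cell_act[OF X] path_act_compose by auto
qed

lemma path_end_smap:
  assumes X: "simplicial_set X" and P: "simplicial_set P"
  shows "simplicial_map (path_sset X P r i) P path_end"
  unfolding simplicial_map_def
proof (intro conjI allI ballI)
  fix n h assume h: "h \<in> cells (path_sset X P r i) n"
  then have sm: "simplicial_map (prism n) P h" by (simp add: path_cell_def)
  then show "path_end n h \<in> cells P n"
    using smap_cells[OF sm, of "(const_op 1 n, id_op n)" n] by (simp add: path_end_def)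
  fix m \<theta> assume \<theta>: "\<theta> \<in> simp_op m n"
  have "path_end m (path_act m \<theta> h) = h m (const_op 1 m, \<theta>)"
    using \<theta> by (simp add: path_end_def path_act_apply)
  also have "\<dots> = act P m n \<theta> (path_end n h)"
    using smap_act[OF sm \<theta>, of "(const_op 1 n, id_op n)"] \<theta> by (simp add: path_end_def)
  finally show "path_end m (act (path_sset X P r i) m n \<theta> h) = act P m n \<theta> (path_end n h)" by simp
qed (use path_sset_simplicial_set[OF X] P in auto)

text \<open>By transposition, a horn of paths with a simplex of endpoints is a map on the horn
  cylinder with both ends: the walls come from the paths, the upper end from the endpoints, and the
  lower end is forced to be their image under \<open>r\<close> and then \<open>i\<close>. It is
  filled over the constant homotopy in the base.\<close>

lemma path_end_kan:
  fixes r :: "('p, 'x) smap" and i :: "('x, 'p) smap"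
  assumes r: "kan_fibration P X r" and i: "simplicial_map X P i"
    and ri: "\<And>n x. x \<in> cells X n \<Longrightarrow> r n (i n x) = x"
  shows "kan_fibration (path_sset X P r i) P path_end"
  unfolding kan_fibration_def has_lifting_def
proof (intro conjI allI impI, goal_cases)
  case 1
  show ?case by (rule path_end_smap[OF smap_dom[OF i] smap_cod[OF i]])
next
  case (2 n k u v)
  let ?E = "path_sset X P r i" and ?horn = "\<lambda>m. cells (horn n k) m"
  have rm: "simplicial_map P X r" using r by (simp add: kan_fibration_def)
  have X: "simplicial_set X" using smap_dom[OF i] .
  have nk: "1 \<le> n" "k \<le> n" and u: "simplicial_map (horn n k) ?E u"
    and v: "simplicial_map (std_simplex n) P v"
    and uv: "\<And>m \<alpha>. \<alpha> \<in> ?horn m \<Longrightarrow> path_end m (u m \<alpha>) = v m \<alpha>"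
    using 2 by (auto simp: eq_smap_def scomp_def)
  have u_cell: "path_cell X P r i m (u m \<alpha>)" if "\<alpha> \<in> ?horn m" for m \<alpha>
    using smap_cells[OF u that] by simp
  have u_smap: "simplicial_map (prism m) P (u m \<alpha>)" if "\<alpha> \<in> ?horn m" for m \<alpha>
    using u_cell[OF that] by (simp add: path_cell_def)
  have horn_op: "\<alpha> \<in> simp_op m n" if "\<alpha> \<in> ?horn m" for m \<alpha>
    using that by simp
  have horn_act: "compose {..m'} \<alpha> \<theta> \<in> ?horn m'" if "\<alpha> \<in> ?horn m" "\<theta> \<in> simp_op m' m" for m m' \<alpha> \<theta>
    using act_cells[OF horn_simplicial_set that(2,1)] by (simp del: horn_cells)
  define D where "D m = {const_op 0 m, const_op 1 m} \<times> simp_op m n \<union> simp_op m 1 \<times> ?horn m" for m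
  \<comment> \<open>The cases overlap; \<open>U_horn\<close>, \<open>U0\<close> and
    \<open>U1\<close> show that each of the three descriptions is valid on its whole part of
    \<open>D\<close>.\<close>
  define U where "U = (\<lambda>m x. if snd x \<in> ?horn m then u m (snd x) m (fst x, id_op m)
      else if fst x = const_op 0 m then i m (r m (v m (snd x))) else v m (snd x))"
  have U_horn: "U m (\<beta>, \<alpha>) = u m \<alpha> m (\<beta>, id_op m)" if "\<alpha> \<in> ?horn m" for m \<alpha> \<beta>
    unfolding U_def snd_conv fst_conv if_P[OF that] ..
  have U0: "U m (const_op 0 m, \<alpha>) = i m (r m (v m \<alpha>))" if "\<alpha> \<in> simp_op m n" for m \<alpha>
  proof (cases "\<alpha> \<in> ?horn m")
    case True
    have "r m (path_end m (u m \<alpha>)) \<in> cells X m" by (rule path_cell_base(1)[OF X u_cell[OF True]])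
    then show ?thesis
      using path_cell_base(2)[OF X u_cell[OF True] id_op_simp_op] uv[OF True] act_id[OF X]
      by (simp add: U_horn[OF True] del: restrict_apply)
  qed (simp add: U_def del: horn_cells)
  have ne: "const_op 1 m \<noteq> const_op 0 m" for m
    using const_op_apply[of 0 m 0] const_op_apply[of 0 m 1] by (metis le0 zero_neq_one)
  have U1: "U m (const_op 1 m, \<alpha>) = v m \<alpha>" if "\<alpha> \<in> simp_op m n" for m \<alpha>
  proof (cases "\<alpha> \<in> ?horn m")
    case True
    then show ?thesis using uv[OF True] by (simp add: U_horn[OF True] path_end_def)
  qed (use ne in \<open>simp add: U_def del: horn_cells\<close>)
  have Dsub: "subcomplex (prism n) D"
    using cylinder_subcomplex[OF std_simplex_simplicial_set ends_subcomplex[of "{0,1}"]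
        std_simplex_simplicial_set horn_subcomplex[of n k]]
    by (simp add: D_def[abs_def])
  have v_act: "v m' (compose {..m'} \<alpha> \<theta>) = act P m' m \<theta> (v m \<alpha>)"
    if "\<alpha> \<in> simp_op m n" "\<theta> \<in> simp_op m' m" for m m' \<alpha> \<theta>
    using smap_act[OF v that(2)] that(1) by simp
  have v_cells: "v m \<alpha> \<in> cells P m" if "\<alpha> \<in> simp_op m n" for m \<alpha>
    using smap_cells[OF v] that by simp
  have irv_act: "i m' (r m' (v m' (compose {..m'} \<alpha> \<theta>))) = act P m' m \<theta> (i m (r m (v m \<alpha>)))"
    if "\<alpha> \<in> simp_op m n" "\<theta> \<in> simp_op m' m" for m m' \<alpha> \<theta>
    using smap_act[OF i that(2)] smap_act[OF rm that(2)] v_act[OF that] v_cells[OF that(1)]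
      smap_cells[OF rm] by simp
  have U_act: "U m' (compose {..m'} \<beta> \<theta>, compose {..m'} \<alpha> \<theta>) = act P m' m \<theta> (U m (\<beta>, \<alpha>))"
    if x: "(\<beta>, \<alpha>) \<in> D m" and \<theta>: "\<theta> \<in> simp_op m' m" for m m' \<beta> \<alpha> \<theta>
  proof (cases "\<alpha> \<in> ?horn m")
    case True
    have \<beta>: "\<beta> \<in> simp_op m 1" using x by (auto simp: D_def)
    have "U m' (compose {..m'} \<beta> \<theta>, compose {..m'} \<alpha> \<theta>)
        = u m' (compose {..m'} \<alpha> \<theta>) m' (compose {..m'} \<beta> \<theta>, id_op m')"
      by (rule U_horn[OF horn_act[OF True \<theta>]])
    also have "u m' (compose {..m'} \<alpha> \<theta>) = path_act m' \<theta> (u m \<alpha>)"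
      using smap_act[OF u \<theta> True] by simp
    also have "\<dots> m' (compose {..m'} \<beta> \<theta>, id_op m') = u m \<alpha> m' (compose {..m'} \<beta> \<theta>, \<theta>)"
      using \<theta> \<beta> compose_simp_op[OF \<beta> \<theta>] by (simp add: path_act_apply)
    also have "\<dots> = act P m' m \<theta> (u m \<alpha> m (\<beta>, id_op m))"
      using smap_act[OF u_smap[OF True] \<theta>, of "(\<beta>, id_op m)"] \<theta> \<beta> by simp
    finally show ?thesis by (simp only: U_horn[OF True])
  next
    case False
    then have "\<beta> = const_op 0 m \<or> \<beta> = const_op 1 m" and \<alpha>: "\<alpha> \<in> simp_op m n"
      using x by (auto simp: D_def)
    then show ?thesis
      using U0 U1 irv_act[OF \<alpha> \<theta>] v_act[OF \<alpha> \<theta>] compose_simp_op[OF \<alpha> \<theta>]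
        compose_const_op[OF \<theta>] by metis
  qed
  have rU: "r m (U m (\<beta>, \<alpha>)) = r m (v m \<alpha>)" if x: "(\<beta>, \<alpha>) \<in> D m" for m \<beta> \<alpha>
  proof (cases "\<alpha> \<in> ?horn m")
    case True
    have \<beta>: "\<beta> \<in> simp_op m 1" using x by (auto simp: D_def)
    have "r m (path_end m (u m \<alpha>)) \<in> cells X m" by (rule path_cell_base(1)[OF X u_cell[OF True]])
    then show ?thesis
      using path_cell_base(3)[OF X u_cell[OF True] id_op_simp_op \<beta>] uv[OF True] act_id[OF X]
      by (simp add: U_horn[OF True] del: restrict_apply)
  next
    case False
    then have "\<beta> = const_op 0 m \<or> \<beta> = const_op 1 m" and \<alpha>: "\<alpha> \<in> simp_op m n"
      using x by (auto simp: D_def)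
    then show ?thesis using U0[OF \<alpha>] U1[OF \<alpha>] ri smap_cells[OF rm v_cells[OF \<alpha>]] by metis
  qed
  have U_cells: "U m (\<beta>, \<alpha>) \<in> cells P m" if x: "(\<beta>, \<alpha>) \<in> D m" for m \<beta> \<alpha>
  proof (cases "\<alpha> \<in> ?horn m")
    case True
    have \<beta>: "\<beta> \<in> simp_op m 1" using x by (auto simp: D_def)
    then show ?thesis
      using smap_cells[OF u_smap[OF True], of "(\<beta>, id_op m)" m] U_horn[OF True] by simp
  next
    case False
    then have "\<beta> = const_op 0 m \<or> \<beta> = const_op 1 m" and \<alpha>: "\<alpha> \<in> simp_op m n"
      using x by (auto simp: D_def)
    then show ?thesis
      using U0[OF \<alpha>] U1[OF \<alpha>] v_cells[OF \<alpha>] smap_cells[OF i] smap_cells[OF rm] by metis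
  qed
  have U: "simplicial_map ((prism n)\<lparr>cells := D\<rparr>) P U"
    using subcomplex_simplicial_set[OF prism_simplicial_set Dsub] smap_cod[OF i] U_cells U_act
    by (auto simp: simplicial_map_def)
  have V: "simplicial_map (prism n) X (\<lambda>m x. r m (v m (snd x)))"
  proof -
    note pr = sprod_snd[OF std_simplex_simplicial_set std_simplex_simplicial_set]
    from smap_comp[OF smap_comp[OF pr v] rm] show ?thesis by (simp add: scomp_def)
  qed
  have rU': "r m (U m x) = r m (v m (snd x))" if "x \<in> D m" for m x
    using rU[of "fst x" "snd x" m] that by simp
  obtain W where W: "simplicial_map (prism n) P W" "\<And>m x. x \<in> D m \<Longrightarrow> W m x = U m x"
    "\<And>m x. x \<in> cells (prism n) m \<Longrightarrow> r m (W m x) = r m (v m (snd x))"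
    using kan_lift_horn_cylinder[OF r nk V D_def U rU'] by blast
  \<comment> \<open>Transposition back: the operator \<open>\<theta>\<close> becomes the path
    obtained by reindexing the filler along it.\<close>
  define w where "w = (\<lambda>m \<theta>. path_act m \<theta> W)"
  have w_cell: "path_cell X P r i m (w m \<theta>)" if \<theta>: "\<theta> \<in> simp_op m n" for m \<theta>
    unfolding path_cell_def
  proof (intro conjI bexI[of _ "r m (v m \<theta>)"] allI impI ballI)
    show "simplicial_map (prism m) P (w m \<theta>)"
      using smap_comp[OF prism_reindex[OF \<theta>] W(1)]
      by (rule smap_eq_on) (simp add: w_def path_act_def scomp_def)
    fix l \<alpha> assume \<alpha>: "\<alpha> \<in> simp_op l m"
    have rv: "r l (v l (compose {..l} \<theta> \<alpha>)) = act X l m \<alpha> (r m (v m \<theta>))"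
      using v_act[OF \<theta> \<alpha>] smap_act[OF rm \<alpha> v_cells[OF \<theta>]] by simp
    have "(const_op 0 l, compose {..l} \<theta> \<alpha>) \<in> D l"
      using compose_simp_op[OF \<theta> \<alpha>] by (simp add: D_def)
    then show "w m \<theta> l (const_op 0 l, \<alpha>) = i l (act X l m \<alpha> (r m (v m \<theta>)))"
      using W(2) U0[OF compose_simp_op[OF \<theta> \<alpha>]] rv \<alpha> by (simp add: w_def path_act_apply)
    fix \<beta> assume "\<beta> \<in> simp_op l 1"
    then show "r l (w m \<theta> l (\<beta>, \<alpha>)) = act X l m \<alpha> (r m (v m \<theta>))"
      using W(3)[of "(\<beta>, compose {..l} \<theta> \<alpha>)" l] rv \<theta> \<alpha> by (simp add: w_def path_act_apply)
  qed (use smap_cells[OF rm v_cells[OF \<theta>]] in \<open>simp_all add: w_def path_act_def\<close>)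
  have w_smap: "simplicial_map (std_simplex n) ?E w"
    unfolding simplicial_map_def using w_cell path_sset_simplicial_set[OF X] path_act_compose
    by (auto simp: w_def)
  have wu: "w m \<theta> = u m \<theta>" if \<theta>: "\<theta> \<in> ?horn m" for m \<theta>
  proof (intro ext)
    fix l x
    show "w m \<theta> l x = u m \<theta> l x"
    proof (cases "x \<in> cells (prism m) l")
      case False
      then show ?thesis using u_cell[OF \<theta>] by (cases x) (auto simp: w_def path_act_def path_cell_def)
    next
      case True
      obtain \<beta> \<alpha> where x: "x = (\<beta>, \<alpha>)" "\<beta> \<in> simp_op l 1" "\<alpha> \<in> simp_op l m" using True by auto
      note \<theta>\<alpha> = horn_act[OF \<theta> x(3)]
      have "w m \<theta> l x = W l (\<beta>, compose {..l} \<theta> \<alpha>)" using x by (simp add: w_def path_act_apply)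
      also have "\<dots> = U l (\<beta>, compose {..l} \<theta> \<alpha>)" using W(2) \<theta>\<alpha> x by (simp add: D_def)
      also have "\<dots> = u l (compose {..l} \<theta> \<alpha>) l (\<beta>, id_op l)" by (rule U_horn[OF \<theta>\<alpha>])
      also have "u l (compose {..l} \<theta> \<alpha>) = path_act l \<alpha> (u m \<theta>)"
        using smap_act[OF u x(3) \<theta>] by simp
      also have "\<dots> l (\<beta>, id_op l) = u m \<theta> l x" using x by (simp add: path_act_apply)
      finally show ?thesis .
    qed
  qed
  have ev: "path_end m (w m \<theta>) = v m \<theta>" if \<theta>: "\<theta> \<in> simp_op m n" for m \<theta>
    using W(2)[of "(const_op 1 m, \<theta>)" m] U1[OF \<theta>] \<theta> by (simp add: D_def w_def path_end_def path_act_apply)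
  show ?case
    using w_smap wu ev by (intro exI[of _ w]) (auto simp: eq_smap_def scomp_def simp del: horn_cells)
qed

text \<open>A map out of the prism is determined by its values on the maximal simplices.\<close>

lemma path_cell_inj:
  assumes "infinite (UNIV :: 'p set)"
  obtains f :: "nat \<Rightarrow> ((nat \<Rightarrow> nat) \<times> (nat \<Rightarrow> nat), 'p) smap \<Rightarrow> 'p"
  where "\<And>n. inj_on (f n) (cells (path_sset X P r i) n)"
proof -
  obtain enc :: "'p list \<Rightarrow> 'p" where enc: "\<And>n. inj_on enc {xs. length xs = n}"
    using ex_inj_lists_of_length[OF assms] by blast
  \<comment> \<open>The top cell of the \<open>j\<close>-th maximal simplex. A prism over an
    \<open>n\<close>-simplex has \<open>n + 1\<close> of them, so in dimension \<open>n\<close> all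
    encoded lists have the same length.\<close>
  let ?top = "\<lambda>n j. shuffle n j (Suc n) (id_op (Suc n))"
  define f where "f n h = enc (map (\<lambda>j. h (Suc n) (?top n j)) [0..<Suc n])"
    for n and h :: "((nat \<Rightarrow> nat) \<times> (nat \<Rightarrow> nat), 'p) smap"
  have "inj_on (f n) (cells (path_sset X P r i) n)" for n
  proof (rule inj_onI, intro ext)
    fix h h' m x assume h: "h \<in> cells (path_sset X P r i) n" "h' \<in> cells (path_sset X P r i) n"
      and eq: "f n h = f n h'"
    then have sm: "simplicial_map (prism n) P h" "simplicial_map (prism n) P h'"
      by (simp_all add: path_cell_def)
    have "map (\<lambda>j. h (Suc n) (?top n j)) [0..<Suc n] = map (\<lambda>j. h' (Suc n) (?top n j)) [0..<Suc n]"
      using eq unfolding f_def by (rule inj_onD[OF enc[of "Suc n"]]) simp_all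
    then have top: "h (Suc n) (?top n j) = h' (Suc n) (?top n j)" if "j \<le> n" for j
      using that by (simp del: upt_Suc restrict_apply add: map_eq_conv)
    show "h m x = h' m x"
    proof (cases "x \<in> cells (prism n) m")
      case True
      then obtain j where j: "j \<le> n" "in_shuffle j m x" using ex_shuffle by blast
      then obtain \<gamma> where \<gamma>: "\<gamma> \<in> simp_op m (Suc n)" "x = shuffle n j m \<gamma>"
        using in_shuffle_iff[OF j(1) True] by blast
      have eval: "g m x = act P m (Suc n) \<gamma> (g (Suc n) (?top n j))" if "simplicial_map (prism n) P g" for g
        using yoneda_eq[OF smap_comp[OF shuffle_smap[OF j(1)] that] \<gamma>(1)] \<gamma>(2)
        by (simp add: scomp_def del: restrict_apply)
      show ?thesis unfolding eval[OF sm(1)] eval[OF sm(2)] top[OF j(1)] ..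
    next
      case False
      then show ?thesis using h by (cases x) (simp add: path_cell_def)
    qed
  qed
  then show thesis using that by blast
qed

text \<open>The lifting square has constant paths above and the identity of \<open>P\<close> below.
  Its diagonal assigns to \<open>p\<close> a fibrewise path from \<open>i (r p)\<close> to
  \<open>p\<close>, and transposing it gives \<open>H\<close>.\<close>

theorem section_deformation:
  fixes X P :: "'a sset"
  assumes inf: "infinite (UNIV :: 'a set)" and i: "trivial_cofibration X P i"
    and r: "kan_fibration P X r" and ri: "\<And>n x. x \<in> cells X n \<Longrightarrow> r n (i n x) = x"
  obtains H where "simplicial_map (sprod interval P) P H"
    "\<And>n \<beta> p. \<beta> \<in> simp_op n 1 \<Longrightarrow> p \<in> cells P n \<Longrightarrow> r n (H n (\<beta>, p)) = r n p"
    "\<And>n p. p \<in> cells P n \<Longrightarrow> H n (const_op 0 n, p) = i n (r n p)"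
    "\<And>n p. p \<in> cells P n \<Longrightarrow> H n (const_op 1 n, p) = p"
proof -
  let ?E = "path_sset X P r i"
  have im: "simplicial_map X P i" using i by (simp add: trivial_cofibration_def)
  have X: "simplicial_set X" and P: "simplicial_set P" using smap_dom[OF im] smap_cod[OF im] .
  obtain f :: "nat \<Rightarrow> ((nat \<Rightarrow> nat) \<times> (nat \<Rightarrow> nat), 'a) smap \<Rightarrow> 'a"
    where f: "\<And>n. inj_on (f n) (cells ?E n)" using path_cell_inj[OF inf] by blast
  have lift: "has_lifting X P i ?E P path_end"
    using trivial_cofibration_lifting[OF i path_end_kan[OF r im ri] f] .
  define u where "u = (\<lambda>n x m y. if y \<in> cells (prism n) m then i m (act X m n (snd y) x) else undefined)"
  have u_cell: "path_cell X P r i n (u n x)" if x: "x \<in> cells X n" for n x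
    unfolding path_cell_def
  proof (intro conjI bexI[of _ x] allI impI ballI)
    note pr = sprod_snd[OF std_simplex_simplicial_set std_simplex_simplicial_set]
    from smap_comp[OF smap_comp[OF pr yoneda_smap[OF X x]] im]
    show "simplicial_map (prism n) P (u n x)"
      by (rule smap_eq_on) (simp add: u_def scomp_def)
  qed (use x ri act_cells[OF X _ x] in \<open>auto simp: u_def\<close>)
  have "simplicial_map X ?E u"
    unfolding simplicial_map_def
  proof (intro conjI allI ballI)
    fix m n \<theta> x assume "\<theta> \<in> simp_op m n" "x \<in> cells X n"
    then show "u m (act X m n \<theta> x) = act ?E m n \<theta> (u n x)"
      by (auto simp: u_def path_act_def fun_eq_iff act_act[OF X])
  qed (use u_cell X path_sset_simplicial_set in auto)
  moreover have "path_end n (u n x) = i n x" if "x \<in> cells X n" for n x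
    using act_id[OF X that] by (simp add: path_end_def u_def)
  ultimately obtain w where w: "simplicial_map P ?E w" "\<And>n p. p \<in> cells P n \<Longrightarrow> path_end n (w n p) = p"
    using lift smap_id[OF P] unfolding has_lifting_def eq_smap_def scomp_def by metis
  have w_cell: "path_cell X P r i n (w n p)" if "p \<in> cells P n" for n p
    using smap_cells[OF w(1) that] by simp
  define H where "H = (\<lambda>n x. w n (snd x) n (fst x, id_op n))"
  have rp: "r n p \<in> cells X n" if "p \<in> cells P n" for n p
    using r that by (simp add: kan_fibration_def simplicial_map_def)
  have H_cells: "H n (\<beta>, p) \<in> cells P n" if "\<beta> \<in> simp_op n 1" "p \<in> cells P n" for n \<beta> p
    using w_cell[OF that(2)] that(1) smap_cells[of "prism n" P "w n p" "(\<beta>, id_op n)" n]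
    by (simp add: H_def path_cell_def)
  have H_act: "H m (compose {..m} \<beta> \<theta>, act P m n \<theta> p) = act P m n \<theta> (H n (\<beta>, p))"
    if \<theta>: "\<theta> \<in> simp_op m n" and \<beta>: "\<beta> \<in> simp_op n 1" and p: "p \<in> cells P n" for m n \<theta> \<beta> p
  proof -
    have sm: "simplicial_map (prism n) P (w n p)" using w_cell[OF p] by (simp add: path_cell_def)
    have "H m (compose {..m} \<beta> \<theta>, act P m n \<theta> p) = path_act m \<theta> (w n p) m (compose {..m} \<beta> \<theta>, id_op m)"
      using smap_act[OF w(1) \<theta> p] by (simp add: H_def)
    also have "\<dots> = w n p m (compose {..m} \<beta> \<theta>, \<theta>)"
      using compose_simp_op[OF \<beta> \<theta>] \<theta> by (simp add: path_act_apply)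
    also have "\<dots> = act P m n \<theta> (w n p n (\<beta>, id_op n))"
      using smap_act[OF sm \<theta>, of "(\<beta>, id_op n)"] \<beta> \<theta> by simp
    finally show ?thesis by (simp add: H_def)
  qed
  show thesis
  proof (rule that[of H])
    show "simplicial_map (sprod interval P) P H"
      using P H_cells H_act sprod_simplicial_set[OF std_simplex_simplicial_set P]
      by (auto simp: simplicial_map_def)
  next
    fix n \<beta> p assume \<beta>: "\<beta> \<in> simp_op n 1" and p: "p \<in> cells P n"
    show "r n (H n (\<beta>, p)) = r n p"
      using path_cell_base(3)[OF X w_cell[OF p] id_op_simp_op \<beta>] w(2)[OF p] act_id[OF X rp[OF p]]
      by (simp add: H_def)
  next
    fix n p assume p: "p \<in> cells P n"
    show "H n (const_op 0 n, p) = i n (r n p)"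
      using path_cell_base(2)[OF X w_cell[OF p] id_op_simp_op] w(2)[OF p] act_id[OF X rp[OF p]]
      by (simp add: H_def)
    show "H n (const_op 1 n, p) = p"
      using w(2)[OF p] by (simp add: H_def path_end_def)
  qed
qed

subsection \<open>Composition, base change and lifting of cells\<close>

lemma kan_comp:
  assumes p: "kan_fibration X Y p" and q: "kan_fibration Y Z q"
  shows "kan_fibration X Z (q \<circ>\<^sub>s p)"
  unfolding kan_fibration_def
proof (intro conjI allI impI smap_comp[OF kan_smap[OF p] kan_smap[OF q]])
  fix n k :: nat assume nk: "1 \<le> n" "k \<le> n"
  let ?i = "\<lambda>m \<alpha>. \<alpha> :: nat \<Rightarrow> nat"
  show "has_lifting (horn n k) (std_simplex n) ?i X Z (q \<circ>\<^sub>s p)"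
    unfolding has_lifting_def
  proof (intro allI impI, elim conjE)
    fix u v assume u: "simplicial_map (horn n k) X u" and v: "simplicial_map (std_simplex n) Z v"
      and eq: "eq_smap (horn n k) (q \<circ>\<^sub>s p \<circ>\<^sub>s u) (v \<circ>\<^sub>s ?i)"
    have "eq_smap (horn n k) (q \<circ>\<^sub>s (p \<circ>\<^sub>s u)) (v \<circ>\<^sub>s ?i)"
      using eq by (simp add: eq_smap_def scomp_def)
    then obtain w where w: "simplicial_map (std_simplex n) Y w"
      "eq_smap (horn n k) (w \<circ>\<^sub>s ?i) (p \<circ>\<^sub>s u)" "eq_smap (std_simplex n) (q \<circ>\<^sub>s w) v"
      using q nk v smap_comp[OF u kan_smap[OF p]] unfolding kan_fibration_def has_lifting_def by blast
    from w(2) have "eq_smap (horn n k) (p \<circ>\<^sub>s u) (w \<circ>\<^sub>s ?i)" by (simp add: eq_smap_def)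
    then obtain w' where w': "simplicial_map (std_simplex n) X w'"
      "eq_smap (horn n k) (w' \<circ>\<^sub>s ?i) u" "eq_smap (std_simplex n) (p \<circ>\<^sub>s w') w"
      using p nk u w(1) unfolding kan_fibration_def has_lifting_def by blast
    moreover have "eq_smap (std_simplex n) (q \<circ>\<^sub>s p \<circ>\<^sub>s w') v"
      using w'(3) w(3) by (simp add: eq_smap_def scomp_def)
    ultimately show "\<exists>w. simplicial_map (std_simplex n) X w \<and> eq_smap (horn n k) (w \<circ>\<^sub>s ?i) u \<and>
      eq_smap (std_simplex n) (q \<circ>\<^sub>s p \<circ>\<^sub>s w) v" by blast
  qed
qed

lemma kan_pullback_fst:
  assumes f: "simplicial_map X B f" and g: "kan_fibration Y B g"
  shows "kan_fibration (pullback X f Y g) X spr1"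
proof -
  let ?P = "pullback X f Y g" and ?i = "\<lambda>m \<alpha>. \<alpha> :: nat \<Rightarrow> nat"
  note PS = pullback_simplicial_set[OF f kan_smap[OF g]]
  have pr1: "simplicial_map ?P X spr1" and pr2: "simplicial_map ?P Y spr2"
    using PS f kan_smap[OF g] by (auto simp: simplicial_map_def spr1_def spr2_def)
  show ?thesis
    unfolding kan_fibration_def
  proof (intro conjI allI impI pr1)
    fix n k :: nat assume nk: "1 \<le> n" "k \<le> n"
    show "has_lifting (horn n k) (std_simplex n) ?i ?P X spr1"
      unfolding has_lifting_def
    proof (intro allI impI, elim conjE)
      fix u v assume u: "simplicial_map (horn n k) ?P u" and v: "simplicial_map (std_simplex n) X v"
        and eq: "eq_smap (horn n k) (spr1 \<circ>\<^sub>s u) (v \<circ>\<^sub>s ?i)"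
      have uc: "g m (snd (u m \<alpha>)) = f m (fst (u m \<alpha>))" if "\<alpha> \<in> cells (horn n k) m" for m \<alpha>
        using smap_cells[OF u that] by auto
      have "eq_smap (horn n k) (g \<circ>\<^sub>s (spr2 \<circ>\<^sub>s u)) ((f \<circ>\<^sub>s v) \<circ>\<^sub>s ?i)"
        using eq uc unfolding eq_smap_def scomp_def spr1_def spr2_def by metis
      then obtain w where w: "simplicial_map (std_simplex n) Y w"
        "eq_smap (horn n k) (w \<circ>\<^sub>s ?i) (spr2 \<circ>\<^sub>s u)" "eq_smap (std_simplex n) (g \<circ>\<^sub>s w) (f \<circ>\<^sub>s v)"
        using g nk smap_comp[OF v f] smap_comp[OF u pr2]
        unfolding kan_fibration_def has_lifting_def by blast
      have "simplicial_map (std_simplex n) ?P (\<lambda>m \<alpha>. (v m \<alpha>, w m \<alpha>))"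
        using v w(1,3) PS by (auto simp: simplicial_map_def eq_smap_def scomp_def)
      moreover have "eq_smap (horn n k) ((\<lambda>m \<alpha>. (v m \<alpha>, w m \<alpha>)) \<circ>\<^sub>s ?i) u"
        using eq w(2) unfolding eq_smap_def scomp_def spr1_def spr2_def by (metis prod.collapse)
      moreover have "eq_smap (std_simplex n) (spr1 \<circ>\<^sub>s (\<lambda>m \<alpha>. (v m \<alpha>, w m \<alpha>))) v"
        by (simp add: eq_smap_def scomp_def spr1_def)
      ultimately show "\<exists>w. simplicial_map (std_simplex n) ?P w \<and> eq_smap (horn n k) (w \<circ>\<^sub>s ?i) u \<and>
        eq_smap (std_simplex n) (spr1 \<circ>\<^sub>s w) v" by blast
    qed
  qed
qed

lemma const_smap:
  assumes "simplicial_set A" "simplicial_set Y" "y \<in> cells Y 0"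
  shows "simplicial_map A Y (\<lambda>m x. act Y m 0 (const_op 0 m) y)"
  using assms by (auto simp: simplicial_map_def act_cells act_act)

text \<open>\<open>horn 1 c\<close> consists of the vertex \<open>c\<close> alone, so filling it is
  path lifting; \<open>c\<close> and \<open>d\<close> are free so that an edge can be followed in
  either direction.\<close>

lemma kan_lift_vertex:
  assumes r: "kan_fibration P T r" and x: "x \<in> cells T 1" and c: "c \<le> 1" and d: "d \<le> 1"
    and y: "y \<in> cells P 0" "r 0 y = act T 0 1 (const_op c 0) x"
  obtains y' where "y' \<in> cells P 0" "r 0 y' = act T 0 1 (const_op d 0) x"
proof -
  note rm = kan_smap[OF r]
  have T: "simplicial_set T" and P: "simplicial_set P" using smap_cod[OF rm] smap_dom[OF rm] .
  let ?u = "\<lambda>m \<alpha>. act P m 0 (const_op 0 m) y"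
  have u: "simplicial_map (interval\<lparr>cells := cells (horn 1 c)\<rparr>) P ?u"
    using const_smap[OF subcomplex_simplicial_set[OF std_simplex_simplicial_set horn_subcomplex] P y(1)] .
  have ru: "r m (?u m \<alpha>) = act T m 1 \<alpha> x" if \<alpha>: "\<alpha> \<in> cells (horn 1 c) m" for m \<alpha>
  proof -
    have \<alpha>c: "\<alpha> \<in> simp_op m 1" using \<alpha> by simp
    have eq: "\<alpha> = const_op c m"
    proof (rule simp_op_eqI[OF \<alpha>c const_op_simp_op[OF c]])
      fix i assume i: "i \<le> m"
      obtain l where l: "l \<le> 1" "l \<noteq> c" "l \<notin> \<alpha> ` {..m}" using \<alpha> by auto
      have "\<alpha> i \<noteq> l" "\<alpha> i \<le> 1" using l(3) i simp_op_le[OF \<alpha>c i] by auto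
      then show "\<alpha> i = const_op c m i" using l(1,2) c i by simp
    qed
    have "r m (?u m \<alpha>) = act T m 0 (const_op 0 m) (act T 0 1 (const_op c 0) x)"
      using smap_act[OF rm _ y(1), of "const_op 0 m" m] y(2) by simp
    also have "\<dots> = act T m 1 (const_op c m) x"
      using act_act[OF T const_op_simp_op[OF c] const_op_simp_op[OF order_refl] x, of m]
        compose_const_op[OF const_op_simp_op[of 0 0 m]] by simp
    finally show ?thesis by (simp add: eq)
  qed
  obtain w where w: "simplicial_map interval P w"
    "\<And>m \<alpha>. \<alpha> \<in> cells (horn 1 c) m \<Longrightarrow> w m \<alpha> = ?u m \<alpha>"
    "\<And>m \<alpha>. \<alpha> \<in> cells interval m \<Longrightarrow> r m (w m \<alpha>) = act T m 1 \<alpha> x"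
    by (rule extendsD[OF kan_extends_horn[OF r order_refl c yoneda_smap[OF T x]]
        std_simplex_simplicial_set horn_subcomplex u ru]) (assumption, rule that)
  show thesis
    using w(3)[of "const_op d 0" 0] smap_cells[OF w(1), of "const_op d 0" 0] d
    by (intro that[of "w 0 (const_op d 0)"]) (auto simp del: One_nat_def)
qed

text \<open>The simplex contracts to its vertex \<open>0\<close> through the product
  \<open>\<beta> i * \<alpha> i\<close>. Homotopy lifting along this contraction starts at the
  constant simplex on \<open>y\<close> and ends at a lift of \<open>b\<close>.\<close>

lemma kan_lift_cell:
  assumes r: "kan_fibration P T r" and b: "b \<in> cells T n"
    and y: "y \<in> cells P 0" "r 0 y = act T 0 n (const_op 0 0) b"
  obtains w where "w \<in> cells P n" "r n w = b"
proof -
  note rm = kan_smap[OF r]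
  have T: "simplicial_set T" and P: "simplicial_set P" using smap_cod[OF rm] smap_dom[OF rm] .
  define \<mu> where "\<mu> m \<beta> \<alpha> = (\<lambda>i\<in>{..m}. \<beta> i * \<alpha> i)" for m and \<beta> \<alpha> :: "nat \<Rightarrow> nat"
  have \<mu>: "\<mu> m \<beta> \<alpha> \<in> simp_op m n" if "\<beta> \<in> simp_op m 1" "\<alpha> \<in> simp_op m n" for m \<beta> \<alpha>
    unfolding \<mu>_def
  proof (rule simp_opI)
    fix i assume i: "i \<le> m"
    show "\<beta> i * \<alpha> i \<le> n"
      using mult_le_mono[OF simp_op_le[OF that(1) i] simp_op_le[OF that(2) i]] by simp
  next
    fix i j assume "i \<le> j" "j \<le> m"
    then show "\<beta> i * \<alpha> i \<le> \<beta> j * \<alpha> j"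
      by (intro mult_le_mono simp_op_mono[OF that(1)] simp_op_mono[OF that(2)])
  qed
  have \<mu>_act: "\<mu> m' (compose {..m'} \<beta> \<theta>) (compose {..m'} \<alpha> \<theta>) = compose {..m'} (\<mu> m \<beta> \<alpha>) \<theta>"
    if "\<theta> \<in> simp_op m' m" for m m' \<beta> \<alpha> \<theta>
    using simp_op_le[OF that] by (auto simp: \<mu>_def compose_def fun_eq_iff)
  have \<mu>0: "\<mu> m (const_op 0 m) \<alpha> = const_op 0 m" for m \<alpha>
    by (auto simp: \<mu>_def const_op_def fun_eq_iff)
  have \<mu>1: "\<mu> n (const_op 1 n) (id_op n) = id_op n"
    by (auto simp: \<mu>_def const_op_def fun_eq_iff)
  let ?v = "\<lambda>m x. act T m n (\<mu> m (fst x) (snd x)) b"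
  have "simplicial_map (prism n) (std_simplex n) (\<lambda>m x. \<mu> m (fst x) (snd x))"
    using \<mu> by (auto simp: simplicial_map_def sprod_simplicial_set \<mu>_act)
  from smap_comp[OF this yoneda_smap[OF T b]] have v: "simplicial_map (prism n) T ?v"
    by (simp add: scomp_def)
  let ?D = "\<lambda>m. {const_op 0 m} \<times> cells (std_simplex n) m \<union> simp_op m 1 \<times> {}"
  have D: "subcomplex (prism n) ?D"
    by (auto simp: subcomplex_def)
  have empty: "subcomplex (std_simplex n) (\<lambda>m. {})" by (simp add: subcomplex_def)
  let ?u = "\<lambda>m x. act P m 0 (const_op 0 m) y"
  have u: "simplicial_map ((prism n)\<lparr>cells := ?D\<rparr>) P ?u"
    using const_smap[OF subcomplex_simplicial_set[OF prism_simplicial_set D] P y(1)] .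
  have ru: "r m (?u m x) = ?v m x" if x: "x \<in> ?D m" for m x
  proof -
    have "r m (?u m x) = act T m 0 (const_op 0 m) (act T 0 n (const_op 0 0) b)"
      using smap_act[OF rm _ y(1), of "const_op 0 m" m] y(2) by simp
    also have "\<dots> = act T m n (const_op 0 m) b"
      using act_act[OF T const_op_simp_op[OF le0] const_op_simp_op[OF order_refl] b, of m]
        compose_const_op[OF const_op_simp_op[of 0 0 m]] by simp
    finally show ?thesis using x \<mu>0 by auto
  qed
  obtain w where w: "simplicial_map (prism n) P w" "\<And>m x. x \<in> ?D m \<Longrightarrow> w m x = ?u m x"
    "\<And>m x. x \<in> cells (prism n) m \<Longrightarrow> r m (w m x) = ?v m x"
    by (rule extendsD[OF kan_extends_cylinder[OF r std_simplex_simplicial_set empty v le0]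
        prism_simplicial_set D u ru]) (assumption, rule that)
  let ?x = "(const_op 1 n, id_op n)"
  have x: "?x \<in> cells (prism n) n" by simp
  show thesis
    using w(3)[OF x] smap_cells[OF w(1) x] \<mu>1 act_id[OF T b]
    by (intro that[of "w n ?x"]) (auto simp del: One_nat_def restrict_apply)
qed

subsection \<open>Propositional fibrations\<close>

text \<open>Applied to the projection of a path to its start point,
  \<open>section_deformation\<close> contracts every path to a reflexivity path with the start point
  kept fixed; this plays the role of path induction.\<close>

lemma path_fibration_deformation:
  fixes X P :: "'a sset" and q :: "('a, 'a \<times> 'a) smap"
  assumes inf: "infinite (UNIV :: 'a set)" and pf: "path_fibration X B f P i q" and f: "kan_fibration X B f"
  obtains H where "simplicial_map (sprod interval P) P H"
    "\<And>n \<beta> z. \<beta> \<in> simp_op n 1 \<Longrightarrow> z \<in> cells P n \<Longrightarrow> fst (q n (H n (\<beta>, z))) = fst (q n z)"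
    "\<And>n z. z \<in> cells P n \<Longrightarrow> H n (const_op 0 n, z) = i n (fst (q n z))"
    "\<And>n z. z \<in> cells P n \<Longrightarrow> H n (const_op 1 n, z) = z"
proof -
  let ?r = "spr1 \<circ>\<^sub>s q"
  have i: "trivial_cofibration X P i" and q: "kan_fibration P (pullback X f X f) q"
    and qi: "\<And>n x. x \<in> cells X n \<Longrightarrow> q n (i n x) = (x, x)"
    using pf by (auto simp: path_fibration_def eq_smap_def scomp_def)
  have r: "kan_fibration P X ?r"
    by (rule kan_comp[OF q kan_pullback_fst[OF kan_smap[OF f] f]])
  have ri: "?r n (i n x) = x" if "x \<in> cells X n" for n x
    using qi[OF that] by (simp add: scomp_def spr1_def)
  obtain H where H: "simplicial_map (sprod interval P) P H"
    "\<And>n \<beta> p. \<beta> \<in> simp_op n 1 \<Longrightarrow> p \<in> cells P n \<Longrightarrow> ?r n (H n (\<beta>, p)) = ?r n p"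
    "\<And>n p. p \<in> cells P n \<Longrightarrow> H n (const_op 0 n, p) = i n (?r n p)"
    "\<And>n p. p \<in> cells P n \<Longrightarrow> H n (const_op 1 n, p) = p"
    by (rule section_deformation[OF inf i r ri]) (assumption, rule that)
  show thesis
    using H(2-4) by (intro that[OF H(1)]) (simp_all add: scomp_def spr1_def)
qed

text \<open>A lift \<open>w\<close> of the simplex, unrelated to the given lift \<open>u\<close> of its boundary, is joined to \<open>u\<close> on
  the boundary by the paths that truncatedness provides, and is moved along them to a filler of \<open>u\<close>.\<close>

theorem minus_one_truncated_extends_boundary:
  fixes X :: "'a sset" and B :: "'b sset"
  assumes inf: "infinite (UNIV :: 'a set)" and tr: "minus_one_truncated X B f"
    and b: "b \<in> cells B n" and inhabited: "n = 0 \<Longrightarrow> \<exists>x\<in>cells X 0. f 0 x = b"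
  shows "extends (std_simplex n) (boundary n) X f (\<lambda>m \<alpha>. act B m n \<alpha> b)"
proof -
  obtain P i q where f: "kan_fibration X B f" and pf: "path_fibration X B f P i q"
    and sec: "has_section P (pullback X f X f) q"
    using tr by (auto simp: minus_one_truncated_def)
  note fm = kan_smap[OF f]
  have X: "simplicial_set X" and B: "simplicial_set B" using smap_dom[OF fm] smap_cod[OF fm] .
  have q: "kan_fibration P (pullback X f X f) q" and im: "simplicial_map X P i"
    and qi: "\<And>n x. x \<in> cells X n \<Longrightarrow> q n (i n x) = (x, x)"
    using pf by (auto simp: path_fibration_def eq_smap_def scomp_def trivial_cofibration_def)
  note qm = kan_smap[OF q]
  have P: "simplicial_set P" using smap_dom[OF qm] .
  obtain s where s: "simplicial_map (pullback X f X f) P s"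
    and qs: "\<And>n x y. x \<in> cells X n \<Longrightarrow> y \<in> cells X n \<Longrightarrow> f n x = f n y \<Longrightarrow> q n (s n (x, y)) = (x, y)"
    using sec by (auto simp: has_section_def eq_smap_def scomp_def)
  obtain H where H: "simplicial_map (sprod interval P) P H"
    and rH: "\<And>n \<beta> z. \<beta> \<in> simp_op n 1 \<Longrightarrow> z \<in> cells P n \<Longrightarrow> fst (q n (H n (\<beta>, z))) = fst (q n z)"
    and H0: "\<And>n z. z \<in> cells P n \<Longrightarrow> H n (const_op 0 n, z) = i n (fst (q n z))"
    and H1: "\<And>n z. z \<in> cells P n \<Longrightarrow> H n (const_op 1 n, z) = z"
    by (rule path_fibration_deformation[OF inf pf f]) (rule that)
  have r: "kan_fibration P X (spr1 \<circ>\<^sub>s q)"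
    by (rule kan_comp[OF q kan_pullback_fst[OF fm f]])
  show ?thesis
  proof (rule extendsI[OF std_simplex_simplicial_set X])
    fix u assume u: "simplicial_map ((std_simplex n)\<lparr>cells := boundary n\<rparr>) X u"
      and fu: "\<And>m \<alpha>. \<alpha> \<in> boundary n m \<Longrightarrow> f m (u m \<alpha>) = act B m n \<alpha> b"
    have bd_op: "\<alpha> \<in> simp_op m n" if "\<alpha> \<in> boundary n m" for m \<alpha>
      using that by (simp add: boundary_def)
    have bd_act: "compose {..m'} \<alpha> \<theta> \<in> boundary n m'" if "\<alpha> \<in> boundary n m" "\<theta> \<in> simp_op m' m" for m m' \<alpha> \<theta>
      using boundary_subcomplex[of n] that by (auto simp: subcomplex_def)
    have u_cells: "u m \<alpha> \<in> cells X m" if "\<alpha> \<in> boundary n m" for m \<alpha>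
      using smap_cells[OF u] that by simp
    have u_act: "u m' (compose {..m'} \<alpha> \<theta>) = act X m' m \<theta> (u m \<alpha>)"
      if "\<alpha> \<in> boundary n m" "\<theta> \<in> simp_op m' m" for m m' \<alpha> \<theta>
      using smap_act[OF u that(2)] that(1) by simp
    \<comment> \<open>For \<open>n > 0\<close> the vertex \<open>0\<close> lies in the boundary,
      where \<open>u\<close> already provides a lift; for \<open>n = 0\<close> the boundary is empty
      and \<open>inhabited\<close> is used.\<close>
    obtain y where y: "y \<in> cells X 0" "f 0 y = act B 0 n (const_op 0 0) b"
    proof (cases "n = 0")
      case True
      then show thesis using inhabited that b act_id[OF B, of b 0] by (auto simp: const_op_0_0)
    next
      case False
      then have "const_op 0 0 \<in> boundary n 0"
        by (auto simp: boundary_def intro!: exI[of _ n])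
      then show thesis using that[of "u 0 (const_op 0 0)"] fu u_cells by blast
    qed
    obtain w where w: "w \<in> cells X n" "f n w = b"
      using kan_lift_cell[OF f b y] .
    have fw: "f m (act X m n \<alpha> w) = act B m n \<alpha> b" if "\<alpha> \<in> simp_op m n" for m \<alpha>
      using smap_act[OF fm that w(1)] w(2) by simp
    \<comment> \<open>The section \<open>s\<close> of \<open>q\<close> picks, compatibly with faces,
      a path from the restriction of \<open>w\<close> to \<open>u\<close>.\<close>
    define a where "a m \<alpha> = s m (act X m n \<alpha> w, u m \<alpha>)" for m \<alpha>
    have pair: "(act X m n \<alpha> w, u m \<alpha>) \<in> cells (pullback X f X f) m" if "\<alpha> \<in> boundary n m" for m \<alpha>
      using act_cells[OF X bd_op[OF that] w(1)] u_cells[OF that] fw[OF bd_op[OF that]] fu[OF that] by simp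
    have a_cells: "a m \<alpha> \<in> cells P m" if "\<alpha> \<in> boundary n m" for m \<alpha>
      using smap_cells[OF s pair[OF that]] by (simp add: a_def)
    have qa: "q m (a m \<alpha>) = (act X m n \<alpha> w, u m \<alpha>)" if "\<alpha> \<in> boundary n m" for m \<alpha>
      using qs pair[OF that] by (simp add: a_def)
    have a_act: "a m' (compose {..m'} \<alpha> \<theta>) = act P m' m \<theta> (a m \<alpha>)"
      if "\<alpha> \<in> boundary n m" "\<theta> \<in> simp_op m' m" for m m' \<alpha> \<theta>
      using smap_act[OF s that(2) pair[OF that(1)]] u_act[OF that] act_act[OF X bd_op[OF that(1)] that(2) w(1)]
      by (simp add: a_def)
    \<comment> \<open>A family of paths starting in \<open>w\<close>: reflexivity on the lower end,
      the contraction of \<open>a\<close> on the walls. They agree where they meet by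
      \<open>H0\<close>.\<close>
    define g where "g = (\<lambda>m x. if snd x \<in> boundary n m then H m (fst x, a m (snd x))
        else i m (act X m n (snd x) w))"
    have g_bd: "g m (\<beta>, \<alpha>) = H m (\<beta>, a m \<alpha>)" if "\<alpha> \<in> boundary n m" for m \<beta> \<alpha>
      using that by (simp add: g_def)
    have g0: "g m (const_op 0 m, \<alpha>) = i m (act X m n \<alpha> w)" for m \<alpha>
      using H0[OF a_cells] qa by (simp add: g_def)
    have open_cases: "\<alpha> \<in> boundary n m \<and> \<beta> \<in> simp_op m 1 \<or> \<beta> = const_op 0 m \<and> \<alpha> \<in> simp_op m n"
      if "(\<beta>, \<alpha>) \<in> open_prism 0 n m" for m \<beta> \<alpha>
      using that by (auto simp: open_prism_def)
    have g_cells: "g m (\<beta>, \<alpha>) \<in> cells P m" if "(\<beta>, \<alpha>) \<in> open_prism 0 n m" for m \<beta> \<alpha>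
      using open_cases[OF that]
    proof (elim disjE conjE)
      assume "\<alpha> \<in> boundary n m" "\<beta> \<in> simp_op m 1"
      then show ?thesis using smap_cells[OF H, of "(\<beta>, a m \<alpha>)" m] a_cells g_bd by simp
    next
      assume "\<beta> = const_op 0 m" "\<alpha> \<in> simp_op m n"
      then show ?thesis using g0 smap_cells[OF im] act_cells[OF X _ w(1)] by simp
    qed
    have g_act: "g m' (compose {..m'} \<beta> \<theta>, compose {..m'} \<alpha> \<theta>) = act P m' m \<theta> (g m (\<beta>, \<alpha>))"
      if x: "(\<beta>, \<alpha>) \<in> open_prism 0 n m" and \<theta>: "\<theta> \<in> simp_op m' m" for m m' \<beta> \<alpha> \<theta>
      using open_cases[OF x]
    proof (elim disjE conjE)
      assume \<alpha>: "\<alpha> \<in> boundary n m" and \<beta>: "\<beta> \<in> simp_op m 1"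
      then have "(\<beta>, a m \<alpha>) \<in> cells (sprod interval P) m" using a_cells by simp
      from smap_act[OF H \<theta> this] show ?thesis
        using g_bd[OF \<alpha>] g_bd[OF bd_act[OF \<alpha> \<theta>]] a_act[OF \<alpha> \<theta>] by simp
    next
      assume \<beta>: "\<beta> = const_op 0 m" and \<alpha>: "\<alpha> \<in> simp_op m n"
      have "compose {..m'} \<beta> \<theta> = const_op 0 m'" using \<beta> compose_const_op[OF \<theta>] by simp
      then show ?thesis
        using g0 \<beta> act_act[OF X \<alpha> \<theta> w(1)] smap_act[OF im \<theta> act_cells[OF X \<alpha> w(1)]] by simp
    qed
    let ?v = "\<lambda>m x. act X m n (snd x) w"
    have rg: "(spr1 \<circ>\<^sub>s q) m (g m x) = ?v m x" if x: "x \<in> open_prism 0 n m" for m x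
    proof -
      obtain \<beta> \<alpha> where x': "x = (\<beta>, \<alpha>)" by (cases x)
      show ?thesis
        using open_cases[OF x[unfolded x']] unfolding x'
      proof (elim disjE conjE)
        assume \<alpha>: "\<alpha> \<in> boundary n m" and \<beta>: "\<beta> \<in> simp_op m 1"
        show "(spr1 \<circ>\<^sub>s q) m (g m (\<beta>, \<alpha>)) = ?v m (\<beta>, \<alpha>)"
          using rH[OF \<beta> a_cells[OF \<alpha>]] g_bd[OF \<alpha>] qa[OF \<alpha>] by (simp add: scomp_def spr1_def)
      next
        assume \<beta>: "\<beta> = const_op 0 m" and \<alpha>: "\<alpha> \<in> simp_op m n"
        show "(spr1 \<circ>\<^sub>s q) m (g m (\<beta>, \<alpha>)) = ?v m (\<beta>, \<alpha>)"
          using g0 \<beta> qi[OF act_cells[OF X \<alpha> w(1)]] by (simp add: scomp_def spr1_def)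
      qed
    qed
    have Dsub: "subcomplex (prism n) (open_prism 0 n)"
      using cylinder_subcomplex[OF std_simplex_simplicial_set ends_subcomplex[of "{0}"]
          std_simplex_simplicial_set boundary_subcomplex[of n]]
      by (simp add: open_prism_def[abs_def])
    have g: "simplicial_map ((prism n)\<lparr>cells := open_prism 0 n\<rparr>) P g"
      using subcomplex_simplicial_set[OF prism_simplicial_set Dsub] P g_cells g_act
      by (auto simp: simplicial_map_def)
    have v: "simplicial_map (prism n) X ?v"
      using smap_comp[OF sprod_snd[OF std_simplex_simplicial_set std_simplex_simplicial_set]
          yoneda_smap[OF X w(1)], of 1] by (simp add: scomp_def)
    obtain W where W: "simplicial_map (prism n) P W"
      "\<And>m x. x \<in> open_prism 0 n m \<Longrightarrow> W m x = g m x"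
      "\<And>m x. x \<in> cells (prism n) m \<Longrightarrow> (spr1 \<circ>\<^sub>s q) m (W m x) = ?v m x"
      by (rule extendsD[OF kan_extends_prism[OF r v le0] prism_simplicial_set Dsub g rg])
        (assumption, rule that)
    have end1: "simplicial_map (std_simplex n) (prism n) (\<lambda>m \<alpha>. (const_op 1 m, \<alpha>))"
      by (auto simp: simplicial_map_def sprod_simplicial_set)
    have pr2: "simplicial_map (pullback X f X f) X spr2"
      using X pullback_simplicial_set[OF fm fm] by (auto simp: simplicial_map_def spr2_def)
    \<comment> \<open>\<open>W\<close> extends the paths over the whole prism; on the upper end
      their endpoints form the filler, which agrees with \<open>u\<close> on the boundary by
      \<open>H1\<close>.\<close>
    let ?w = "\<lambda>m \<alpha>. snd (q m (W m (const_op 1 m, \<alpha>)))"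
    have w': "simplicial_map (std_simplex n) X ?w"
      using smap_comp[OF smap_comp[OF smap_comp[OF end1 W(1)] qm] pr2] by (simp add: scomp_def spr2_def)
    have "?w m \<alpha> = u m \<alpha>" if \<alpha>: "\<alpha> \<in> boundary n m" for m \<alpha>
    proof -
      have "(const_op 1 m, \<alpha>) \<in> open_prism 0 n m"
        using \<alpha> by (simp add: open_prism_def)
      then show ?thesis using W(2) g_bd[OF \<alpha>] H1[OF a_cells[OF \<alpha>]] qa[OF \<alpha>] by simp
    qed
    moreover have "f m (?w m \<alpha>) = act B m n \<alpha> b" if \<alpha>: "\<alpha> \<in> simp_op m n" for m \<alpha>
    proof -
      have x: "(const_op 1 m, \<alpha>) \<in> cells (prism n) m" using \<alpha> by simp
      have "f m (?w m \<alpha>) = f m (fst (q m (W m (const_op 1 m, \<alpha>))))"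
        using smap_cells[OF qm smap_cells[OF W(1) x]] by auto
      then show ?thesis using W(3)[OF x] fw[OF \<alpha>] by (simp add: scomp_def spr1_def)
    qed
    ultimately show "\<exists>w. simplicial_map (std_simplex n) X w \<and> (\<forall>m. \<forall>\<alpha>\<in>boundary n m. w m \<alpha> = u m \<alpha>) \<and>
      (\<forall>m. \<forall>\<alpha>\<in>cells (std_simplex n) m. f m (w m \<alpha>) = act B m n \<alpha> b)"
      using w' by (intro exI[of _ ?w]) simp
  qed
qed

corollary minus_one_truncated_section:
  fixes X :: "'a sset"
  assumes inf: "infinite (UNIV :: 'a set)" and tr: "minus_one_truncated X B f"
    and surj: "\<And>b. b \<in> cells B 0 \<Longrightarrow> \<exists>x\<in>cells X 0. f 0 x = b"
  shows "has_section X B f"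
proof -
  have f: "simplicial_map X B f" using tr by (simp add: minus_one_truncated_def kan_smap)
  obtain s where s: "simplicial_map B X s" "\<And>n b. b \<in> cells B n \<Longrightarrow> f n (s n b) = b"
    using cellwise_lift[OF smap_id[OF smap_cod[OF f]] smap_dom[OF f]
        minus_one_truncated_extends_boundary[OF inf tr]] surj by blast
  then show ?thesis by (auto simp: has_section_def eq_smap_def scomp_def)
qed

text \<open>The diagonal of a monomorphism is an isomorphism onto the kernel pair, so
  \<open>Z\<close> is its own path space, with the identity as trivial cofibration.\<close>

lemma kan_mono_minus_one_truncated:
  assumes f: "kan_fibration Z X f" and inj: "\<And>n. inj_on (f n) (cells Z n)"
  shows "minus_one_truncated Z X f"
proof -
  let ?P = "pullback Z f Z f" and ?d = "\<lambda>n x. (x, x)"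
  note fm = kan_smap[OF f]
  have Z: "simplicial_set Z" using smap_dom[OF fm] .
  have P: "simplicial_set ?P" by (rule pullback_simplicial_set[OF fm fm])
  have diag: "fst x = snd x" if "x \<in> cells ?P n" for x n
    using that inj_onD[OF inj[of n], of "fst x" "snd x"] by auto
  have d: "simplicial_map Z ?P ?d" using Z P by (auto simp: simplicial_map_def)
  have pr1: "simplicial_map ?P Z (\<lambda>n x. fst x)" using Z P by (auto simp: simplicial_map_def)
  have id: "trivial_cofibration Z Z (\<lambda>n x. x)"
    using smap_id[OF Z] unfolding trivial_cofibration_def has_lifting_def
    by (auto simp: eq_smap_def scomp_def)
  have "has_lifting (horn n k) (std_simplex n) (\<lambda>m \<alpha>. \<alpha>) Z ?P ?d" for n k
    unfolding has_lifting_def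
  proof (intro allI impI, elim conjE)
    fix u v assume v: "simplicial_map (std_simplex n) ?P v"
      and eq: "eq_smap (horn n k) (?d \<circ>\<^sub>s u) (v \<circ>\<^sub>s (\<lambda>m \<alpha>. \<alpha>))"
    let ?w = "\<lambda>m \<alpha>. fst (v m \<alpha>)"
    have "simplicial_map (std_simplex n) Z ?w"
      using smap_comp[OF v pr1] by (simp add: scomp_def)
    moreover have "eq_smap (horn n k) (?w \<circ>\<^sub>s (\<lambda>m \<alpha>. \<alpha>)) u"
      using eq unfolding eq_smap_def scomp_def by (metis fst_conv)
    moreover have "eq_smap (std_simplex n) (?d \<circ>\<^sub>s ?w) v"
      using diag[OF smap_cells[OF v]] unfolding eq_smap_def scomp_def by (simp add: prod_eq_iff)
    ultimately show "\<exists>w. simplicial_map (std_simplex n) Z w \<and>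
      eq_smap (horn n k) (w \<circ>\<^sub>s (\<lambda>m \<alpha>. \<alpha>)) u \<and> eq_smap (std_simplex n) (?d \<circ>\<^sub>s w) v" by blast
  qed
  then have "kan_fibration Z ?P ?d" using d by (simp add: kan_fibration_def)
  then have "path_fibration Z X f Z (\<lambda>n x. x) ?d"
    using id by (simp add: path_fibration_def eq_smap_def scomp_def)
  moreover have "has_section Z ?P ?d"
    unfolding has_section_def using pr1 diag
    by (intro exI[of _ "\<lambda>n x. fst x"]) (simp add: eq_smap_def scomp_def prod_eq_iff)
  ultimately show ?thesis using f unfolding minus_one_truncated_def by blast
qed

text \<open>The cells of \<open>X\<close> all of whose vertices lie in the image of \<open>e\<close> form a union of components, hence a
  propositional fibration through which \<open>e\<close> factors.\<close>

theorem minus_one_connected_surj_vertices: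
  fixes X Y :: "'u sset"
  assumes e: "kan_fibration Y X e" and conn: "minus_one_connected Y X e" and x: "x \<in> cells X 0"
  shows "\<exists>y\<in>cells Y 0. e 0 y = x"
proof -
  note em = kan_smap[OF e]
  have X: "simplicial_set X" and Y: "simplicial_set Y" using smap_cod[OF em] smap_dom[OF em] .
  define I where "I = e 0 ` cells Y 0"
  define V where "V n = {x \<in> cells X n. \<forall>j\<le>n. act X 0 n (const_op j 0) x \<in> I}" for n
  have V_sub: "subcomplex X V"
    unfolding subcomplex_def
  proof (intro conjI allI ballI)
    fix m n \<alpha> x assume \<alpha>: "\<alpha> \<in> simp_op m n" and x: "x \<in> V n"
    then have xc: "x \<in> cells X n" by (simp add: V_def)
    have "act X 0 m (const_op j 0) (act X m n \<alpha> x) \<in> I" if "j \<le> m" for j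
    proof -
      have "compose {..0} \<alpha> (const_op j 0) = const_op (\<alpha> j) 0"
        by (rule compose_const)
      then show ?thesis
        using act_act[OF X \<alpha> const_op_simp_op[OF that] xc, of 0] x simp_op_le[OF \<alpha> that]
        by (simp add: V_def)
    qed
    then show "act X m n \<alpha> x \<in> V m" using act_cells[OF X \<alpha> xc] by (simp add: V_def)
  qed (auto simp: V_def)
  define Z where "Z = X\<lparr>cells := V\<rparr>"
  have Z: "simplicial_set Z" using subcomplex_simplicial_set[OF X V_sub] by (simp add: Z_def)
  have incl: "simplicial_map Z X (\<lambda>n x. x)"
    using X Z by (auto simp: simplicial_map_def Z_def V_def)
  have edge: "act X 0 1 (const_op d 0) x \<in> I"
    if x: "x \<in> cells X 1" and c: "act X 0 1 (const_op c 0) x \<in> I" "c \<le> 1" and d: "d \<le> 1" for x c d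
  proof -
    obtain y where "y \<in> cells Y 0" "e 0 y = act X 0 1 (const_op c 0) x"
      using c(1) by (auto simp: I_def)
    then obtain y' where "y' \<in> cells Y 0" "e 0 y' = act X 0 1 (const_op d 0) x"
      using kan_lift_vertex[OF e x c(2) d] by blast
    then show ?thesis unfolding I_def by (metis image_eqI)
  qed
  have "has_lifting (horn n k) (std_simplex n) (\<lambda>m \<alpha>. \<alpha>) Z X (\<lambda>n x. x)" if nk: "1 \<le> n" "k \<le> n" for n k
    unfolding has_lifting_def
  proof (intro allI impI, elim conjE)
    fix u v assume u: "simplicial_map (horn n k) Z u" and v: "simplicial_map (std_simplex n) X v"
      and eq: "eq_smap (horn n k) ((\<lambda>n x. x) \<circ>\<^sub>s u) (v \<circ>\<^sub>s (\<lambda>m \<alpha>. \<alpha>))"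
    have uv: "u m \<alpha> = v m \<alpha>" if "\<alpha> \<in> cells (horn n k) m" for m \<alpha>
      using eq that unfolding eq_smap_def scomp_def by blast
    \<comment> \<open>As \<open>n \<ge> 1\<close>, the vertex \<open>k\<close> lies in the horn;
      every other vertex is joined to it by an edge, along which membership in \<open>I\<close>
      spreads. So \<open>v\<close> itself is the filler.\<close>
    have "const_op k 0 \<in> cells (horn n k) 0"
      using nk by (auto intro!: exI[of _ "if k = 0 then n else 0"] split: if_splits)
    then have "v 0 (const_op k 0) \<in> V 0"
      using smap_cells[OF u] uv by (metis Z_def select_convs(1) surjective update_convs(1))
    then have vk: "v 0 (const_op k 0) \<in> I"
      using act_id[OF X, of "v 0 (const_op k 0)" 0] by (simp add: V_def const_op_0_0)
    have vert: "v 0 (const_op j 0) \<in> I" if j: "j \<le> n" for j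
    proof -
      \<comment> \<open>Operators are monotone, so the edge between \<open>j\<close> and
        \<open>k\<close> is oriented by size; \<open>c\<close> and \<open>d\<close> below record
        which of its ends is \<open>k\<close> and which is \<open>j\<close>.\<close>
      define \<delta> where "\<delta> = (\<lambda>i\<in>{..1::nat}. if i = 0 then min j k else max j k)"
      have \<delta>: "\<delta> \<in> simp_op 1 n"
        unfolding \<delta>_def using j nk by (intro simp_opI) auto
      have ends: "act X 0 1 (const_op c 0) (v 1 \<delta>) = v 0 (const_op (\<delta> c) 0)" if "c \<le> 1" for c
      proof -
        have "act X 0 1 (const_op c 0) (v 1 \<delta>) = v 0 (compose {..0} \<delta> (const_op c 0))"
          using smap_act[OF v const_op_simp_op[OF that, of 0], of \<delta>] \<delta> by simp
        also have "compose {..0} \<delta> (const_op c 0) = const_op (\<delta> c) 0"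
          by (rule compose_const)
        finally show ?thesis .
      qed
      obtain c d where cd: "c \<le> 1" "d \<le> 1" "\<delta> c = k" "\<delta> d = j"
      proof (cases "j \<le> k")
        case True
        then show thesis by (intro that[of 1 0]) (auto simp: \<delta>_def)
      next
        case False
        then show thesis by (intro that[of 0 1]) (auto simp: \<delta>_def)
      qed
      have "v 1 \<delta> \<in> cells X 1" using smap_cells[OF v] \<delta> by simp
      then show ?thesis using edge[of "v 1 \<delta>" c d] ends[OF cd(1)] ends[OF cd(2)] cd vk by simp
    qed
    have "v m \<alpha> \<in> V m" if \<alpha>: "\<alpha> \<in> simp_op m n" for m \<alpha>
    proof -
      have "act X 0 m (const_op j 0) (v m \<alpha>) \<in> I" if j: "j \<le> m" for j
      proof -
        have "act X 0 m (const_op j 0) (v m \<alpha>) = v 0 (compose {..0} \<alpha> (const_op j 0))"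
          using smap_act[OF v const_op_simp_op[OF j, of 0], of \<alpha>] \<alpha> by simp
        also have "compose {..0} \<alpha> (const_op j 0) = const_op (\<alpha> j) 0"
          by (rule compose_const)
        finally show ?thesis using vert[OF simp_op_le[OF \<alpha> j]] by simp
      qed
      then show ?thesis using smap_cells[OF v] \<alpha> by (simp add: V_def)
    qed
    then have "simplicial_map (std_simplex n) Z v"
      using v Z by (auto simp: simplicial_map_def Z_def)
    then show "\<exists>w. simplicial_map (std_simplex n) Z w \<and> eq_smap (horn n k) (w \<circ>\<^sub>s (\<lambda>m \<alpha>. \<alpha>)) u \<and>
      eq_smap (std_simplex n) ((\<lambda>n x. x) \<circ>\<^sub>s w) v"
      using uv by (intro exI[of _ v]) (simp add: eq_smap_def scomp_def)
  qed
  then have "kan_fibration Z X (\<lambda>n x. x)" using incl by (simp add: kan_fibration_def)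
  then have trZ: "minus_one_truncated Z X (\<lambda>n x. x)" by (rule kan_mono_minus_one_truncated) simp
  obtain T t \<eta> s where T: "is_minus_one_truncation Y X e T t \<eta>"
    and s: "simplicial_map X T s" "\<And>n x. x \<in> cells X n \<Longrightarrow> t n (s n x) = x"
    using conn by (auto simp: minus_one_connected_def has_section_def eq_smap_def scomp_def)
  have g: "simplicial_map (pullback Y e X (\<lambda>n x. x)) Z spr2"
  proof -
    have "x \<in> V n" if "y \<in> cells Y n" "x = e n y" for n x y
      using that smap_cells[OF em] smap_act[OF em _ that(1)] act_cells[OF Y _ that(1)]
      by (auto simp: V_def I_def simp flip: smap_act[OF em])
    then show ?thesis
      using Z pullback_simplicial_set[OF em smap_id[OF X]]
      by (auto simp: simplicial_map_def spr2_def Z_def)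
  qed
  \<comment> \<open>The universal property over the identity of \<open>X\<close> with
    \<open>Z\<close> as target: \<open>h\<close> carries the section \<open>s\<close> of
    \<open>T\<close> into \<open>Z\<close>, which places the vertex \<open>x\<close> in
    \<open>I\<close>.\<close>
  obtain h where h: "simplicial_map (pullback T t X (\<lambda>n x. x)) Z h"
    "eq_smap (pullback T t X (\<lambda>n x. x)) ((\<lambda>n x. x) \<circ>\<^sub>s h) spr2"
    using T smap_id[OF X] trZ g unfolding is_minus_one_truncation_def
    by (metis (no_types, lifting) eq_smap_def scomp_def)
  have sx: "(s 0 x, x) \<in> cells (pullback T t X (\<lambda>n x. x)) 0"
    using s smap_cells[OF s(1)] x by simp
  have "h 0 (s 0 x, x) = x"
    using h(2)[unfolded eq_smap_def, rule_format, OF sx] by (simp add: scomp_def spr2_def)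
  then have "x \<in> V 0" using smap_cells[OF h(1) sx] by (simp add: Z_def)
  then have "x \<in> I" using act_id[OF X x] by (simp add: V_def const_op_0_0)
  then show ?thesis by (auto simp: I_def)
qed

subsection \<open>Sections over 0-truncated fibres\<close>

text \<open>A fibre \<open>F\<close> of a 0-truncated fibration contracts onto a set \<open>c\<close> of representatives of its
  components. Over the representatives a section of \<open>e\<close> is chosen, and it is transported along the
  contraction.\<close>

theorem zero_truncated_fibre_section:
  fixes \<Gamma> X Y :: "'u sset"
  assumes inf: "infinite (UNIV :: 'u set)" and tr: "zero_truncated X \<Gamma> p"
    and e: "kan_fibration Y X e" and surj: "\<And>x. x \<in> cells X 0 \<Longrightarrow> \<exists>y\<in>cells Y 0. e 0 y = x"
    and \<gamma>: "\<gamma> \<in> cells \<Gamma> 0"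
    and F: "\<And>n. F n = {x \<in> cells X n. p n x = act \<Gamma> n 0 (const_op 0 n) \<gamma>}"
  obtains s where "simplicial_map (X\<lparr>cells := F\<rparr>) Y s" "\<And>n x. x \<in> F n \<Longrightarrow> e n (s n x) = x"
proof -
  obtain P i q where p: "kan_fibration X \<Gamma> p" and pf: "path_fibration X \<Gamma> p P i q"
    and trq: "minus_one_truncated P (pullback X p X p) q"
    using tr by (auto simp: zero_truncated_def)
  let ?PB = "pullback X p X p"
  note pm = kan_smap[OF p] and em = kan_smap[OF e]
  have X: "simplicial_set X" and \<Gamma>: "simplicial_set \<Gamma>" and Y: "simplicial_set Y"
    using smap_dom[OF pm] smap_cod[OF pm] smap_dom[OF em] .
  have q: "kan_fibration P ?PB q" and im: "simplicial_map X P i"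
    and qi: "\<And>n x. x \<in> cells X n \<Longrightarrow> q n (i n x) = (x, x)"
    using pf by (auto simp: path_fibration_def eq_smap_def scomp_def trivial_cofibration_def)
  note qm = kan_smap[OF q]
  have P: "simplicial_set P" and PB: "simplicial_set ?PB" using smap_dom[OF qm] smap_cod[OF qm] .
  have const_const: "act Z m n \<alpha> (act Z n 0 (const_op 0 n) z) = act Z m 0 (const_op 0 m) z"
    if "simplicial_set Z" "\<alpha> \<in> simp_op m n" "z \<in> cells Z 0" for Z :: "'u sset" and m n \<alpha> z
    using that by (simp add: act_act)
  have F_sub: "subcomplex X F"
    unfolding subcomplex_def F
    using act_cells[OF X] smap_act[OF pm] const_const[OF \<Gamma> _ \<gamma>] by auto
  define Fs where "Fs = X\<lparr>cells := F\<rparr>"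
  have Fs: "simplicial_set Fs" using subcomplex_simplicial_set[OF X F_sub] by (simp add: Fs_def)
  have F_act: "act X m n \<alpha> x \<in> F m" if "\<alpha> \<in> simp_op m n" "x \<in> F n" for m n \<alpha> x
    using F_sub that by (auto simp: subcomplex_def)
  have F_cells: "x \<in> cells X n" if "x \<in> F n" for n x using that by (simp add: F)

  \<comment> \<open>Edges of the fibre, usable in both directions through \<open>c\<close> and
    \<open>d\<close>; the closure of \<open>R\<close> is the relation of lying in one
    component.\<close>
  define R where "R = {(act X 0 1 (const_op c 0) z, act X 0 1 (const_op d 0) z) | c d z.
      c \<le> 1 \<and> d \<le> 1 \<and> z \<in> F 1}"
  have "sym R" unfolding R_def by (rule symI) blast
  then have E_sym: "sym (R\<^sup>*)" by (rule sym_rtrancl)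
  have R_F: "y \<in> F 0" if "(x, y) \<in> R" for x y
    using that F_act by (auto simp: R_def)
  have E_F: "y \<in> F 0" if "(x, y) \<in> R\<^sup>*" "x \<in> F 0" for x y
    using that by (induction rule: rtrancl_induct) (auto intro: R_F)
  \<comment> \<open>\<open>SOME\<close> returns equal values for equal predicates, so
    \<open>c\<close> is constant on components.\<close>
  define c where "c x = (SOME y. (x, y) \<in> R\<^sup>*)" for x
  have xc: "(x, c x) \<in> R\<^sup>*" for x unfolding c_def by (rule someI[of _ x]) simp
  have c_eq: "c x = c y" if "(x, y) \<in> R\<^sup>*" for x y
  proof -
    have "(x, z) \<in> R\<^sup>* \<longleftrightarrow> (y, z) \<in> R\<^sup>*" for z
      using that symD[OF E_sym that] by (meson rtrancl_trans)
    then show ?thesis by (simp add: c_def)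
  qed
  have cF: "c x \<in> F 0" if "x \<in> F 0" for x using E_F[OF xc that] .

  \<comment> \<open>A simplex is assigned the component of its initial vertex. An operator may move
    that vertex, but only along an edge of the same simplex, the \<open>\<delta>\<close> of
    \<open>cvx_act\<close>.\<close>
  define vx where "vx n x = act X 0 n (const_op 0 0) x" for n x
  have vx_F: "vx n x \<in> F 0" if "x \<in> F n" for n x using F_act that by (simp add: vx_def)
  have cvx_act: "c (vx m (act X m n \<alpha> x)) = c (vx n x)" if \<alpha>: "\<alpha> \<in> simp_op m n" and x: "x \<in> F n" for m n \<alpha> x
  proof -
    define \<delta> where "\<delta> = (\<lambda>i\<in>{..1::nat}. if i = 0 then 0 else \<alpha> 0)"
    have \<delta>: "\<delta> \<in> simp_op 1 n"
      unfolding \<delta>_def using simp_op_le[OF \<alpha>, of 0] by (intro simp_opI) auto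
    have "vx m (act X m n \<alpha> x) = act X 0 n (const_op (\<alpha> 0) 0) x"
      using act_act[OF X \<alpha> const_op_simp_op[OF le0] F_cells[OF x], of 0]
      by (simp add: vx_def compose_const del: atMost_0)
    also have "\<dots> = act X 0 1 (const_op 1 0) (act X 1 n \<delta> x)"
      using act_act[OF X \<delta> const_op_simp_op[OF order_refl] F_cells[OF x], of 0]
      by (simp add: compose_const \<delta>_def del: atMost_0)
    finally have 1: "vx m (act X m n \<alpha> x) = act X 0 1 (const_op 1 0) (act X 1 n \<delta> x)" .
    have 2: "vx n x = act X 0 1 (const_op 0 0) (act X 1 n \<delta> x)"
      using act_act[OF X \<delta> const_op_simp_op[OF le0] F_cells[OF x], of 0]
      by (simp add: vx_def compose_const \<delta>_def del: atMost_0)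
    have "(vx m (act X m n \<alpha> x), vx n x) \<in> R"
      unfolding R_def 1 2 using F_act[OF \<delta> x] by blast
    then show ?thesis by (intro c_eq) blast
  qed
  have comp_smap: "simplicial_map Fs Z (\<lambda>n x. act Z n 0 (const_op 0 n) (f (c (vx n x))))"
    if Z: "simplicial_set Z" and f: "\<And>x. x \<in> F 0 \<Longrightarrow> f x \<in> cells Z 0" for Z :: "'u sset" and f
    unfolding simplicial_map_def using Fs Z f vx_F cF cvx_act const_const[OF Z]
    by (auto simp: Fs_def act_cells)
  define C where "C n x = act X n 0 (const_op 0 n) (c (vx n x))" for n x
  have C: "simplicial_map Fs X C"
    using comp_smap[OF X, of "\<lambda>x. x"] F_cells by (simp add: C_def[abs_def])
  have CF: "C n x \<in> F n" if "x \<in> F n" for n x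
    unfolding C_def using cF[OF vx_F[OF that]] F_act by simp
  have incl: "simplicial_map Fs X (\<lambda>n x. x)"
    using Fs X F_cells by (auto simp: simplicial_map_def Fs_def)
  have pair: "(x, y) \<in> cells ?PB n" if "x \<in> F n" "y \<in> F n" for n x y
    using that by (simp add: F)
  have CI: "simplicial_map Fs ?PB (\<lambda>n x. (C n x, x))"
    unfolding simplicial_map_def
  proof (intro conjI allI ballI Fs PB)
    fix n x assume "x \<in> cells Fs n"
    then have x: "x \<in> F n" by (simp add: Fs_def)
    show "(C n x, x) \<in> cells ?PB n" by (rule pair[OF CF[OF x] x])
  next
    fix m n \<alpha> x assume "\<alpha> \<in> simp_op m n" "x \<in> cells Fs n"
    from smap_act[OF C this] show "(C m (act Fs m n \<alpha> x), act Fs m n \<alpha> x) = act ?PB m n \<alpha> (C n x, x)"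
      by (simp add: Fs_def)
  qed

  \<comment> \<open>Starting from a reflexivity path at \<open>a\<close>, the endpoint is moved
    along a chain of edges: the edge with first coordinate constant at \<open>a\<close> is lifted
    against \<open>q\<close>.\<close>
  have path: "\<exists>z\<in>cells P 0. q 0 z = (c x, x)" if x: "x \<in> F 0" for x
  proof -
    have "\<exists>z\<in>cells P 0. q 0 z = (a, b)" if "(a, b) \<in> R\<^sup>*" "a \<in> F 0" for a b
      using that(1)
    proof (induction rule: rtrancl_induct)
      case base
      then show ?case using qi[OF F_cells[OF that(2)]] smap_cells[OF im F_cells[OF that(2)]] by blast
    next
      case (step b b')
      then obtain z j k g where z: "z \<in> cells P 0" "q 0 z = (a, b)" and jk: "j \<le> 1" "k \<le> 1" and g: "g \<in> F 1"
        and b: "b = act X 0 1 (const_op j 0) g" "b' = act X 0 1 (const_op k 0) g"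
        by (auto simp: R_def)
      let ?g = "(act X 1 0 (const_op 0 1) a, g)"
      have "?g \<in> cells ?PB 1" by (intro pair g F_act[OF _ that(2)]) simp
      moreover have ends: "act ?PB 0 1 (const_op l 0) ?g = (a, act X 0 1 (const_op l 0) g)" if "l \<le> 1" for l
        using const_const[OF X const_op_simp_op[OF that] F_cells[OF \<open>a \<in> F 0\<close>], of 0]
          act_id[OF X F_cells[OF \<open>a \<in> F 0\<close>]] by (simp add: const_op_0_0)
      ultimately obtain z' where "z' \<in> cells P 0" "q 0 z' = act ?PB 0 1 (const_op k 0) ?g"
        using kan_lift_vertex[OF q _ jk z(1)] z(2) b(1) jk(1) by metis
      then show ?case using ends[OF jk(2)] b(2) by auto
    qed
    then show ?thesis using symD[OF E_sym xc] cF[OF x] by blast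
  qed

  \<comment> \<open>Here 0-truncatedness enters: \<open>q\<close> is propositional, so the paths
    from representatives found at vertices extend to all simplices of the fibre.\<close>
  have "extends (std_simplex n) (boundary n) P q (\<lambda>m \<alpha>. act ?PB m n \<alpha> (C n x, x))"
    if "x \<in> cells Fs n" for n x
  proof (rule minus_one_truncated_extends_boundary[OF inf trq])
    have x: "x \<in> F n" using that by (simp add: Fs_def)
    show "(C n x, x) \<in> cells ?PB n" by (rule pair[OF CF[OF x] x])
    assume n: "n = 0"
    have x0: "x \<in> F 0" using x n by simp
    have "C n x = c x"
      using act_id[OF X F_cells[OF x0]] act_id[OF X F_cells[OF cF[OF x0]]]
      by (simp add: n C_def vx_def const_op_0_0)
    then show "\<exists>z\<in>cells P 0. q 0 z = (C n x, x)" using path[OF x0] by simp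
  qed
  then obtain \<Phi> where \<Phi>: "simplicial_map Fs P \<Phi>" "\<And>n x. x \<in> cells Fs n \<Longrightarrow> q n (\<Phi> n x) = (C n x, x)"
    using cellwise_lift[OF CI P] by blast
  obtain H where H: "simplicial_map (sprod interval P) P H"
    and rH: "\<And>n \<beta> z. \<beta> \<in> simp_op n 1 \<Longrightarrow> z \<in> cells P n \<Longrightarrow> fst (q n (H n (\<beta>, z))) = fst (q n z)"
    and H0: "\<And>n z. z \<in> cells P n \<Longrightarrow> H n (const_op 0 n, z) = i n (fst (q n z))"
    and H1: "\<And>n z. z \<in> cells P n \<Longrightarrow> H n (const_op 1 n, z) = z"
    by (rule path_fibration_deformation[OF inf pf p]) (rule that)
  \<comment> \<open>Contracting the paths \<open>\<Phi>\<close> to their start points and following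
    the endpoints gives a homotopy in \<open>X\<close> from \<open>C\<close> to the inclusion of the
    fibre.\<close>
  let ?IF = "sprod interval Fs" and ?S = "\<lambda>n x. snd (q n (H n (fst x, \<Phi> n (snd x))))"
  have IF: "simplicial_set ?IF" by (intro sprod_simplicial_set std_simplex_simplicial_set Fs)
  have "simplicial_map ?IF (sprod interval P) (\<lambda>n x. (fst x, \<Phi> n (snd x)))"
    using IF sprod_simplicial_set[OF std_simplex_simplicial_set P, of 1] smap_cells[OF \<Phi>(1)] smap_act[OF \<Phi>(1)]
    by (auto simp: simplicial_map_def)
  moreover have "simplicial_map ?PB X spr2"
    using X PB by (auto simp: simplicial_map_def spr2_def)
  ultimately have S: "simplicial_map ?IF X ?S"
    using smap_comp[OF smap_comp[OF smap_comp[OF _ H] qm]] by (fastforce simp: scomp_def spr2_def)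
  have \<Phi>_cells: "\<Phi> n x \<in> cells P n" if "x \<in> F n" for n x
    using smap_cells[OF \<Phi>(1)] that by (simp add: Fs_def)
  have q\<Phi>: "q n (\<Phi> n x) = (C n x, x)" if "x \<in> F n" for n x
    using \<Phi>(2) that by (simp add: Fs_def)
  have S0: "?S n (const_op 0 n, x) = C n x" if x: "x \<in> F n" for n x
    using H0[OF \<Phi>_cells[OF x]] q\<Phi>[OF x] qi[OF F_cells[OF CF[OF x]]] by simp
  have S1: "?S n (const_op 1 n, x) = x" if x: "x \<in> F n" for n x
    using H1[OF \<Phi>_cells[OF x]] q\<Phi>[OF x] by simp

  \<comment> \<open>The choices at different vertices are unrelated; this is harmless because
    \<open>y\<close> is applied only to representatives, whose value is constant along each simplex
    of the fibre.\<close>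
  obtain y where y: "\<And>x. x \<in> cells X 0 \<Longrightarrow> y x \<in> cells Y 0 \<and> e 0 (y x) = x"
    using surj by metis
  let ?D = "\<lambda>n. {const_op 0 n} \<times> cells Fs n \<union> simp_op n 1 \<times> {}"
  let ?u = "\<lambda>n x. act Y n 0 (const_op 0 n) (y (c (vx n (snd x))))"
  have empty: "subcomplex Fs (\<lambda>n. {})" by (simp add: subcomplex_def)
  have D: "subcomplex ?IF ?D"
    using act_cells[OF Fs] by (auto simp: subcomplex_def)
  have uF: "simplicial_map Fs Y (\<lambda>n x. act Y n 0 (const_op 0 n) (y (c (vx n x))))"
    using comp_smap[OF Y, of y] y F_cells by blast
  have "simplicial_map (?IF\<lparr>cells := ?D\<rparr>) (Fs\<lparr>cells := cells Fs\<rparr>) (\<lambda>n x. snd x)"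
    using act_cells[OF Fs]
    by (intro smap_restrict[OF sprod_snd[OF std_simplex_simplicial_set Fs] D]) (auto simp: subcomplex_def)
  then have "simplicial_map (?IF\<lparr>cells := ?D\<rparr>) Fs (\<lambda>n x. snd x)" by simp
  from smap_comp[OF this uF] have u: "simplicial_map (?IF\<lparr>cells := ?D\<rparr>) Y ?u" by (simp add: scomp_def)
  have eu: "e n (?u n z) = ?S n z" if z: "z \<in> ?D n" for n z
  proof -
    obtain x where x: "z = (const_op 0 n, x)" "x \<in> F n" using z by (auto simp: Fs_def)
    have cx: "c (vx n x) \<in> cells X 0" using F_cells[OF cF[OF vx_F[OF x(2)]]] .
    have "e n (?u n z) = C n x"
      using smap_act[OF em const_op_simp_op[OF le0]] y[OF cx] x(1) by (simp add: C_def)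
    then show ?thesis using S0[OF x(2)] x(1) by simp
  qed
  obtain L where L: "simplicial_map ?IF Y L" "\<And>n z. z \<in> ?D n \<Longrightarrow> L n z = ?u n z"
    "\<And>n z. z \<in> cells ?IF n \<Longrightarrow> e n (L n z) = ?S n z"
    by (rule extendsD[OF kan_extends_cylinder[OF e Fs empty S le0] IF D u eu]) (assumption, rule that)
  have "simplicial_map Fs ?IF (\<lambda>n x. (const_op 1 n, x))"
    using Fs IF by (auto simp: simplicial_map_def)
  from smap_comp[OF this L(1)] have "simplicial_map Fs Y (\<lambda>n x. L n (const_op 1 n, x))"
    by (simp add: scomp_def)
  moreover have "e n (L n (const_op 1 n, x)) = x" if x: "x \<in> F n" for n x
    using L(3)[of "(const_op 1 n, x)" n] S1[OF x] x by (simp add: Fs_def)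
  ultimately show thesis using that by (simp add: Fs_def)
qed

text \<open>A section of \<open>e\<close> over the fibre at \<open>\<gamma>\<close> is a map over
  \<open>X\<close> from the pullback of \<open>X\<close> along \<open>\<gamma>\<close>, and its
  transpose is the required vertex.\<close>

theorem dependent_product_surj_vertices:
  fixes \<Gamma> X Y :: "'u sset"
  assumes inf: "infinite (UNIV :: 'u set)" and p: "kan_fibration X \<Gamma> p" and tr: "zero_truncated X \<Gamma> p"
    and e: "kan_fibration Y X e" and conn: "minus_one_connected Y X e"
    and Q: "is_dependent_product X \<Gamma> p Y e Q \<pi> \<epsilon>" and \<gamma>: "\<gamma> \<in> cells \<Gamma> 0"
  shows "\<exists>z\<in>cells Q 0. \<pi> 0 z = \<gamma>"
proof -
  note pm = kan_smap[OF p]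
  have \<Gamma>: "simplicial_set \<Gamma>" using smap_cod[OF pm] .
  define F where "F n = {x \<in> cells X n. p n x = act \<Gamma> n 0 (const_op 0 n) \<gamma>}" for n
  obtain s where s: "simplicial_map (X\<lparr>cells := F\<rparr>) Y s" "\<And>n x. x \<in> F n \<Longrightarrow> e n (s n x) = x"
    by (rule zero_truncated_fibre_section[OF inf tr e minus_one_connected_surj_vertices[OF e conn] \<gamma> F_def])
      (assumption, rule that)
  \<comment> \<open>The terminal simplicial set, realised with one and the same element in every
    dimension so that its cells have the type of those of \<open>\<Gamma>\<close>, as the test
    objects of \<open>is_dependent_product\<close> do.\<close>
  define D :: "'u sset" where "D = \<lparr>cells = \<lambda>n. {undefined}, act = \<lambda>m n \<alpha> x. x\<rparr>"
  define d where "d = (\<lambda>n (x :: 'u). act \<Gamma> n 0 (const_op 0 n) \<gamma>)"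
  have D: "simplicial_set D" by (simp add: simplicial_set_def D_def)
  have d: "simplicial_map D \<Gamma> d"
    using const_smap[OF D \<Gamma> \<gamma>] by (simp add: d_def)
  let ?PB = "pullback D d X p"
  have PB: "simplicial_set ?PB" by (rule pullback_simplicial_set[OF d pm])
  have snd_F: "snd z \<in> F n" if "z \<in> cells ?PB n" for n z
    using that by (auto simp: F_def d_def)
  have "simplicial_map ?PB (X\<lparr>cells := F\<rparr>) (\<lambda>n z. snd z)"
    unfolding simplicial_map_def using PB smap_dom[OF s(1)] snd_F by auto
  from smap_comp[OF this s(1)] have "simplicial_map ?PB Y (\<lambda>n z. s n (snd z))" by (simp add: scomp_def)
  moreover have "eq_smap ?PB (e \<circ>\<^sub>s (\<lambda>n z. s n (snd z))) spr2"
    unfolding eq_smap_def scomp_def spr2_def using s(2) snd_F by blast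
  ultimately obtain h where h: "simplicial_map D Q h" "eq_smap D (\<pi> \<circ>\<^sub>s h) d"
    using Q d unfolding is_dependent_product_def by metis
  have x: "undefined \<in> cells D 0" by (simp add: D_def)
  have "\<pi> 0 (h 0 undefined) = \<gamma>"
    using h(2)[unfolded eq_smap_def, rule_format, OF x] act_id[OF \<Gamma> \<gamma>]
    by (simp add: scomp_def d_def const_op_0_0)
  then show ?thesis using smap_cells[OF h(1) x] by blast
qed

theorem theorem5p12:
  fixes \<Gamma> X Y :: "'u sset" and Q T :: "'q sset"
    and p :: "('u, 'u) smap" and e :: "('u, 'u) smap"
    and \<pi> t :: "('q, 'u) smap" and \<epsilon> :: "('q \<times> 'u, 'u) smap" and \<eta> :: "('q, 'q) smap"
  assumes "infinite (UNIV :: 'u set)" and "infinite (UNIV :: 'q set)"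
    and "kan_fibration X \<Gamma> p" and "zero_truncated X \<Gamma> p"
    and "kan_fibration Y X e" and "minus_one_connected Y X e"
    and "is_dependent_product X \<Gamma> p Y e Q \<pi> \<epsilon>"
    and "is_minus_one_truncation Q \<Gamma> \<pi> T t \<eta>"
  shows "has_section T \<Gamma> t"
proof -
  have T: "minus_one_truncated T \<Gamma> t" and \<eta>: "simplicial_map Q T \<eta>" "eq_smap Q (t \<circ>\<^sub>s \<eta>) \<pi>"
    using assms(8) by (auto simp: is_minus_one_truncation_def)
  have "\<exists>z\<in>cells T 0. t 0 z = \<gamma>" if \<gamma>: "\<gamma> \<in> cells \<Gamma> 0" for \<gamma>
  proof -
    obtain z where "z \<in> cells Q 0" "\<pi> 0 z = \<gamma>"
      using dependent_product_surj_vertices[OF assms(1,3,4,5,6,7) \<gamma>] by blast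
    then show ?thesis
      using \<eta> smap_cells[OF \<eta>(1)] unfolding eq_smap_def scomp_def by metis
  qed
  then show ?thesis by (rule minus_one_truncated_section[OF assms(2) T])
qed

end
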